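(* Let $h$ be a strictly increasing potential shape, let $\delta>0$, $x_0,x_\delta\in\mathbb{R}^d$, and let $\gamma$ be a local minimizer of $I^{\delta}_{f_K,x_0,x_\delta}$. Then: (i) The set $NDS(\gamma)$ of nondegenerate shock times of $\gamma$ is finite; that is, there are finitely many times $0\le t_1<\dots<t_\ell\le\delta$ such that $t\mapsto\eta(\gamma(t))$ is constant on each connected component of $[0,\delta]\setminus\{t_1,\dots,t_\ell\}$. (ii) Setting $t_0=0$ and $t_{\ell+1}=\delta$, $\gamma$ is of class $C^{1,1}$ on $[t_i,t_{i+1}]$ for every $i\in\{0,\dots,\ell\}$. Moreover, if $\eta_i\in\mathcal{E}$ is such that $\gamma((t_i,t_{i+1}))\subseteq Q_{\eta_i}$, then \[|\ddot\gamma(r)|\le h'(|\gamma(r)-\eta_i|^2)\,|\gamma(r)-\eta_i|\quad\text{for a.e. } r\in(t_i,t_{i+1}).\]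
   Context: Let $K=\{p_1,\dots,p_N\}\subset\mathbb{R}^d$ be a finite set of $N$ distinct points. Define $f_K(x):=-\tfrac12\operatorname{dist}_K(x)^2=-\min_{y\in K}\tfrac12|x-y|^2$ and the convex function $g_K(x):=\max_{y\in K}\big(x\cdot y-\tfrac12|y|^2\big)=f_K(x)+\tfrac12|x|^2$. The optimality class of $x\in\mathbb{R}^d$ is $\operatorname{opt}(x):=\{y\in K:|x-y|=\operatorname{dist}_K(x)\}$, and $\eta(x)$ denotes the orthogonal projection of $x$ onto $\operatorname{conv}(\operatorname{opt}(x))$. The subdifferential of $f_K$ is $\partial f_K(x):=\{\xi\in\mathbb{R}^d: f_K(y)\ge f_K(x)+\xi\cdot(y-x)-\tfrac12|y-x|^2\ \forall y\}$, and the extended gradient $\nabla f_K(x)$ is the element of minimal norm of $\partial f_K(x)$; it equals $\eta(x)-x$. A potential shape is a $C^1$ function $h:[0,\infty)\to[0,\infty)$. For $\delta>0$ and $x_0,x_\delta\in\mathbb{R}^d$, $I^{\delta}_{f_K,x_0,x_\delta}:C([0,\delta],\mathbb{R}^d)\to[0,+\infty]$ is $I(\gamma)=\int_0^\delta|\dot\gamma|^2+h(|\nabla f_K(\gamma)|^2)\,dt$ if $\gamma$ is absolutely continuous with $\gamma(0)=x_0,\gamma(\delta)=x_\delta$, and $+\infty$ otherwise. A local minimizer is a $\gamma$ with $I(\gamma)<\infty$ such that for some $\rho>0$, $I(\gamma)\le I(\sigma)$ for every $\sigma$ with $\sup_{[0,\delta]}|\sigma-\gamma|<\rho$. Let $\mathcal{E}$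 be the (finite) range of $\eta$ and, for $\eta\in\mathcal{E}$, let the potential zone be $Q_\eta:=\{x:\eta(x)=\eta\}$. A time $t\in[0,\delta]$ is a nondegenerate shock of $\gamma$ if $s\mapsto\eta(\gamma(s))$ is not constant on $I$ for every neighborhood $I$ of $t$ in $[0,\delta]$; $NDS(\gamma)$ is the set of such times. *)

theory Defs
  imports "HOL-Analysis.Analysis"
begin

definition distK :: "'a::euclidean_space set \<Rightarrow> 'a \<Rightarrow> real" where
  "distK K x = Min ((\<lambda>y. dist x y) ` K)"

definition fK :: "'a::euclidean_space set \<Rightarrow> 'a \<Rightarrow> real" where
  "fK K x = - (1/2) * (distK K x)\<^sup>2"

definition opt :: "'a::euclidean_space set \<Rightarrow> 'a \<Rightarrow> 'a set" where
  "opt K x = {y \<in> K. dist x y = distK K x}"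

definition etaK :: "'a::euclidean_space set \<Rightarrow> 'a \<Rightarrow> 'a" where
  "etaK K x = closest_point (convex hull (opt K x)) x"

definition calE :: "'a::euclidean_space set \<Rightarrow> 'a set" where
  "calE K = range (etaK K)"

definition potential_zone :: "'a::euclidean_space set \<Rightarrow> 'a \<Rightarrow> 'a set" where
  "potential_zone K e = {x. etaK K x = e}"

definition subdiffK :: "'a::euclidean_space set \<Rightarrow> 'a \<Rightarrow> 'a set" where
  "subdiffK K x = {\<xi>. \<forall>y. fK K y \<ge> fK K x + \<xi> \<bullet> (y - x) - (1/2) * (norm (y - x))\<^sup>2}"

definition ext_grad :: "'a::euclidean_space set \<Rightarrow> 'a \<Rightarrow> 'a" where
  "ext_grad K x = closest_point (subdiffK K x) 0"

definition abs_cont_on :: "real \<Rightarrow> real \<Rightarrow> (real \<Rightarrow> 'a::real_normed_vector) \<Rightarrow> bool" where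
  "abs_cont_on s t f \<longleftrightarrow>
     (\<forall>e>0. \<exists>d>0. \<forall>(n::nat) (a::nat \<Rightarrow> real) b.
        (\<forall>k<n. s \<le> a k \<and> a k \<le> b k \<and> b k \<le> t) \<and>
        (\<forall>i<n. \<forall>j<n. i \<noteq> j \<longrightarrow> b i \<le> a j \<or> b j \<le> a i) \<and>
        (\<Sum>k<n. b k - a k) < d
        \<longrightarrow> (\<Sum>k<n. norm (f (b k) - f (a k))) < e)"

definition actI :: "'a::euclidean_space set \<Rightarrow> (real \<Rightarrow> real) \<Rightarrow> real \<Rightarrow> 'a \<Rightarrow> 'a \<Rightarrow> (real \<Rightarrow> 'a) \<Rightarrow> ennreal" where
  "actI K h \<delta> x0 x\<delta> \<gamma> =
     (if abs_cont_on 0 \<delta> \<gamma> \<and> \<gamma> 0 = x0 \<and> \<gamma> \<delta> = x\<delta>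
      then (\<integral>\<^sup>+ t. indicator {0..\<delta>} t *
              ennreal ((norm (vector_derivative \<gamma> (at t within {0..\<delta>})))\<^sup>2
                       + h ((norm (ext_grad K (\<gamma> t)))\<^sup>2)) \<partial>lborel)
      else \<infinity>)"

definition local_minimizer :: "'a::euclidean_space set \<Rightarrow> (real \<Rightarrow> real) \<Rightarrow> real \<Rightarrow> 'a \<Rightarrow> 'a \<Rightarrow> (real \<Rightarrow> 'a) \<Rightarrow> bool" where
  "local_minimizer K h \<delta> x0 x\<delta> \<gamma> \<longleftrightarrow>
     actI K h \<delta> x0 x\<delta> \<gamma> < \<infinity> \<and>
     (\<exists>\<rho>>0. \<forall>\<sigma>. continuous_on {0..\<delta>} \<sigma> \<and> (SUP t\<in>{0..\<delta>}. dist (\<sigma> t) (\<gamma> t)) < \<rho>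
                \<longrightarrow> actI K h \<delta> x0 x\<delta> \<gamma> \<le> actI K h \<delta> x0 x\<delta> \<sigma>)"

definition NDS :: "'a::euclidean_space set \<Rightarrow> real \<Rightarrow> (real \<Rightarrow> 'a) \<Rightarrow> real set" where
  "NDS K \<delta> \<gamma> = {t \<in> {0..\<delta>}. \<forall>I. openin (top_of_set {0..\<delta>}) I \<and> t \<in> I \<longrightarrow>
        \<not> (\<exists>c. \<forall>s\<in>I. etaK K (\<gamma> s) = c)}"

definition C11_on :: "real \<Rightarrow> real \<Rightarrow> (real \<Rightarrow> 'a::real_normed_vector) \<Rightarrow> bool" where
  "C11_on a b \<gamma> \<longleftrightarrow> (\<exists>g L. (\<forall>t\<in>{a..b}. (\<gamma> has_vector_derivative g t) (at t within {a..b}))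
                         \<and> L-lipschitz_on {a..b} g)"

end

theory Submission
  imports Defs
begin

text \<open>
  For a subgradient \<open>e\<close> of \<open>gK K\<close> the set \<open>phase e\<close> of points where \<open>e\<close> is a subgradient is closed and convex,
  and on it the potential is at most \<open>h (norm (x - e) ^ 2)\<close>, with equality on the zone of \<open>e\<close>. So a minimizer
  that stays in one zone may be compared with \<open>\<gamma> + \<epsilon> (l - \<gamma>)\<close>, where \<open>l\<close> is a chord: to first order in \<open>\<epsilon>\<close> this
  bounds the integrated square deviation of the velocity from its mean by a multiple of the cube of the length of
  the interval, which yields \<open>C\<^sup>1\<^sup>,\<^sup>1\<close>; blowing up at a point of differentiability of the velocity gives the sharp
  bound on the acceleration.

  For the finiteness of the shocks fix a time \<open>\<tau>\<close> and look at one side of it. Near \<open>x = \<gamma> \<tau>\<close> the zones are cones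
  with apex \<open>x\<close> and, up to a Lipschitz error, the potential depends on the zone only. At a time \<open>T\<close> spent in the
  cheapest zone that is visited arbitrarily close to \<open>\<tau>\<close>, the chord from \<open>x\<close> to \<open>\<gamma> T\<close> is an almost optimal
  competitor; this forces the slopes of \<open>\<gamma>\<close> at \<open>\<tau>\<close> to converge to some \<open>v\<close>. The zone met by the ray in direction \<open>v\<close>
  is strictly cheaper than all other zones in nearby directions: following the ray shows that \<open>\<gamma>\<close> must enter it,
  and replacing excursions by chords shows that it never leaves it.
\<close>

section \<open>Absolutely continuous curves\<close>

text \<open>The nearest sites jump, so \<open>V\<close> is discontinuous and cannot be varied across
  zone boundaries. What survives is one-sided: a competitor may be charged \<open>H e\<close>
  wherever it lies in \<open>phase e\<close>, and convexity of that set keeps chords inside. The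
  obstacle to finiteness is that a curve of finite energy might switch zones infinitely often near
  \<open>\<tau>\<close>, where only the Hoelder exponent 1/2 is known in advance: no velocity, hence
  no tangent zone. Freezing the position in the potential at \<open>\<gamma> \<tau>\<close> costs
  O(sqrt T) per unit time up to time T. This bounds the kinetic excess over the chord by O(T^(3/2)),
  so slopes on comparable scales differ by O(T^(1/4)), which is summable along geometric scales. The
  positive gap between the finitely many potential values at \<open>\<gamma> \<tau>\<close>
  outweighs all such errors. In the blow-up, a parabola of acceleration A on [-q, q] has kinetic
  excess (2/3) |A|^2 q^3, and its distance to the chord integrates to (2/3) |A| q^3; the common
  factor cancels and no constant is lost. Since the action uses pointwise derivatives,
  differentiability of absolutely continuous curves is derived from Vitali coverings.\<close>

definition nonoverlapping :: "real \<Rightarrow> real \<Rightarrow> nat \<Rightarrow> (nat \<Rightarrow> real) \<Rightarrow> (nat \<Rightarrow> real) \<Rightarrow> bool" where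
  "nonoverlapping a b n p q \<longleftrightarrow> (\<forall>k<n. a \<le> p k \<and> p k \<le> q k \<and> q k \<le> b) \<and>
     (\<forall>i<n. \<forall>j<n. i \<noteq> j \<longrightarrow> q i \<le> p j \<or> q j \<le> p i)"

definition ac_modulus :: "real \<Rightarrow> real \<Rightarrow> (real \<Rightarrow> 'a::real_normed_vector) \<Rightarrow> real \<Rightarrow> real \<Rightarrow> bool" where
  "ac_modulus a b f e d \<longleftrightarrow> d > 0 \<and> (\<forall>n p q. nonoverlapping a b n p q \<longrightarrow> (\<Sum>k<n. q k - p k) < d
     \<longrightarrow> (\<Sum>k<n. norm (f (q k) - f (p k))) < e)"

lemma abs_cont_on_iff: "abs_cont_on a b f \<longleftrightarrow> (\<forall>e>0. \<exists>d. ac_modulus a b f e d)"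
  by (simp add: abs_cont_on_def nonoverlapping_def ac_modulus_def imp_conjL)

lemma ac_modulusD:
  "ac_modulus a b f e d \<Longrightarrow> nonoverlapping a b n p q \<Longrightarrow> (\<Sum>k<n. q k - p k) < d \<Longrightarrow>
    (\<Sum>k<n. norm (f (q k) - f (p k))) < e"
  by (simp add: ac_modulus_def)

lemma ac_modulus_pos: "ac_modulus a b f e d \<Longrightarrow> d > 0"
  by (simp add: ac_modulus_def)

text \<open>Divisions and tagged divisions come as finite index sets with disjoint open interiors
  rather than as ordered families; this adapts the modulus to that form.\<close>

lemma ac_modulus_sum:
  assumes mod: "ac_modulus a b f e d" and fin: "finite I"
    and le: "\<And>i. i \<in> I \<Longrightarrow> a \<le> p i \<and> p i \<le> q i \<and> q i \<le> b"
    and dis: "\<And>i j. i \<in> I \<Longrightarrow> j \<in> I \<Longrightarrow> i \<noteq> j \<Longrightarrow> {p i<..<q i} \<inter> {p j<..<q j} = {}"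
    and sm: "(\<Sum>i\<in>I. q i - p i) < d"
  shows "(\<Sum>i\<in>I. norm (f (q i) - f (p i))) < e"
proof -
  \<comment> \<open>Degenerate intervals may lie inside others, so they are discarded before enumerating.\<close>
  define J where "J = {i\<in>I. p i < q i}"
  have fJ: "finite J" "J \<subseteq> I" using fin by (auto simp: J_def)
  obtain h where h: "bij_betw h {0..<card J} J"
    using ex_bij_betw_nat_finite[OF fJ(1)] by blast
  have hJ: "h k \<in> J" if "k < card J" for k
    using h that by (auto simp: bij_betw_def)
  have inj: "h i \<noteq> h j" if "i < card J" "j < card J" "i \<noteq> j" for i j
    using h that by (auto simp: bij_betw_def inj_on_def)
  have reindex: "(\<Sum>k<card J. F (h k)) = (\<Sum>i\<in>J. F i)" for F :: "'b \<Rightarrow> real"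
    using sum.reindex_bij_betw[OF h, of F] by (simp add: atLeast0LessThan)
  have sJ: "(\<Sum>i\<in>J. F i) = (\<Sum>i\<in>I. F i)" if "\<And>i. i \<in> I \<Longrightarrow> p i = q i \<Longrightarrow> F i = 0" for F :: "'b \<Rightarrow> real"
  proof (rule sum.mono_neutral_left)
    show "\<forall>i\<in>I - J. F i = 0" using that le by (force simp: J_def)
  qed (use fin fJ in auto)
  have sep: "q i \<le> p j \<or> q j \<le> p i" if "i \<in> J" "j \<in> J" "i \<noteq> j" for i j
  proof (rule ccontr)
    assume "\<not> ?thesis"
    then have "max (p i) (p j) < min (q i) (q j)"
      using that by (auto simp: J_def)
    then obtain z where "max (p i) (p j) < z" "z < min (q i) (q j)"
      using dense by blast
    then have "z \<in> {p i<..<q i} \<inter> {p j<..<q j}" by auto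
    then show False using dis[of i j] that fJ by blast
  qed
  have "(\<Sum>k<card J. norm (f (q (h k)) - f (p (h k)))) < e"
  proof (rule ac_modulusD[OF mod])
    show "nonoverlapping a b (card J) (\<lambda>k. p (h k)) (\<lambda>k. q (h k))"
      unfolding nonoverlapping_def using hJ inj sep le fJ by (meson subsetD)
    show "(\<Sum>k<card J. q (h k) - p (h k)) < d"
      using sm reindex[of "\<lambda>i. q i - p i"] sJ[of "\<lambda>i. q i - p i"] by simp
  qed
  then show ?thesis
    using reindex[of "\<lambda>i. norm (f (q i) - f (p i))"] sJ[of "\<lambda>i. norm (f (q i) - f (p i))"] by simp
qed

lemma abs_cont_on_subinterval:
  assumes "abs_cont_on a b f" "a \<le> c" "d \<le> b"
  shows "abs_cont_on c d f"
proof -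
  have *: "nonoverlapping a b n p q" if "nonoverlapping c d n p q" for n p q
    using that assms(2,3) unfolding nonoverlapping_def by (meson order_trans)
  have "ac_modulus c d f e r" if "ac_modulus a b f e r" for e r
    using that * unfolding ac_modulus_def by simp
  then show ?thesis using assms(1) unfolding abs_cont_on_iff by meson
qed

lemma abs_cont_on_imp_continuous_on:
  assumes "abs_cont_on a b f"
  shows "continuous_on {a..b} f"
  unfolding continuous_on_iff
proof (intro ballI allI impI)
  fix x e :: real assume x: "x \<in> {a..b}" and e: "e > 0"
  obtain d where d: "ac_modulus a b f e d" using assms e abs_cont_on_iff by blast
  have "dist (f y) (f x) < e" if "y \<in> {a..b}" "dist y x < d" for y
  proof (cases "y \<le> x")
    case True
    then show ?thesis using ac_modulus_sum[OF d, of "{()}" "\<lambda>_. y" "\<lambda>_. x"] that x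
      by (auto simp: dist_norm norm_minus_commute)
  next
    case False
    then show ?thesis using ac_modulus_sum[OF d, of "{()}" "\<lambda>_. x" "\<lambda>_. y"] that x
      by (auto simp: dist_norm norm_minus_commute)
  qed
  then show "\<exists>d>0. \<forall>x'\<in>{a..b}. dist x' x < d \<longrightarrow> dist (f x') (f x) < e"
    using ac_modulus_pos[OF d] by blast
qed

text \<open>One estimate serves for all closure properties: combinations of two curves, components,
  negation, congruence and Lipschitz images arise by choosing \<open>f\<close>, \<open>g\<close> and
  \<open>C\<close>. The \<open>+ 1\<close> in \<open>e / (2 * (C + 1))\<close> covers
  \<open>C = 0\<close> and makes the final inequality strict.\<close>

lemma abs_cont_on_dominated:
  fixes f :: "real \<Rightarrow> 'a::real_normed_vector" and g :: "real \<Rightarrow> 'b::real_normed_vector" and k :: "real \<Rightarrow> 'c::real_normed_vector"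
  assumes f: "abs_cont_on a b f" and g: "abs_cont_on a b g" and C: "C \<ge> 0"
    and le: "\<And>x y. a \<le> x \<Longrightarrow> x \<le> y \<Longrightarrow> y \<le> b \<Longrightarrow> norm (k y - k x) \<le> C * (norm (f y - f x) + norm (g y - g x))"
  shows "abs_cont_on a b k"
  unfolding abs_cont_on_iff
proof (intro allI impI)
  fix e :: real assume e: "e > 0"
  define e' where "e' = e / (2 * (C + 1))"
  have e': "e' > 0" using e C by (simp add: e'_def)
  obtain d1 where d1: "ac_modulus a b f e' d1" using f e' abs_cont_on_iff by blast
  obtain d2 where d2: "ac_modulus a b g e' d2" using g e' abs_cont_on_iff by blast
  have "(\<Sum>i<n. norm (k (q i) - k (p i))) < e"
    if *: "nonoverlapping a b n p q" and s: "(\<Sum>k<n. q k - p k) < min d1 d2" for n p q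
  proof -
    have 1: "(\<Sum>k<n. norm (f (q k) - f (p k))) < e'" using s by (intro ac_modulusD[OF d1 *]) simp
    have 2: "(\<Sum>k<n. norm (g (q k) - g (p k))) < e'" using s by (intro ac_modulusD[OF d2 *]) simp
    have "(\<Sum>i<n. norm (k (q i) - k (p i))) \<le> (\<Sum>i<n. C * (norm (f (q i) - f (p i)) + norm (g (q i) - g (p i))))"
      using * unfolding nonoverlapping_def by (intro sum_mono le) auto
    also have "\<dots> = C * ((\<Sum>k<n. norm (f (q k) - f (p k))) + (\<Sum>k<n. norm (g (q k) - g (p k))))"
      by (simp add: sum_distrib_left sum.distrib algebra_simps)
    also have "\<dots> \<le> C * (e' + e')" using 1 2 C by (intro mult_left_mono) auto
    also have "\<dots> < 2 * (C + 1) * e'" using e' by (simp add: algebra_simps)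
    also have "\<dots> = e" using C by (simp add: e'_def)
    finally show ?thesis .
  qed
  then have "ac_modulus a b k e (min d1 d2)"
    using ac_modulus_pos[OF d1] ac_modulus_pos[OF d2] by (simp add: ac_modulus_def)
  then show "\<exists>d. ac_modulus a b k e d" by blast
qed

lemma abs_cont_on_lipschitz:
  fixes f :: "real \<Rightarrow> 'a::real_normed_vector"
  assumes "L-lipschitz_on {a..b} f"
  shows "abs_cont_on a b f"
proof -
  have L: "L \<ge> 0" using assms lipschitz_on_nonneg by blast
  have "ac_modulus a b (\<lambda>x::real. x) e e" if "e > 0" for e
    unfolding ac_modulus_def
  proof (intro conjI allI impI that)
    fix n p q assume *: "nonoverlapping a b n p q" "(\<Sum>k<n. q k - p k) < e"
    have "(\<Sum>k<n. norm (q k - p k)) = (\<Sum>k<n. q k - p k)"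
      using * by (intro sum.cong) (auto simp: nonoverlapping_def)
    with * show "(\<Sum>k<n. norm (q k - p k)) < e" by simp
  qed
  then have id: "abs_cont_on a b (\<lambda>x::real. x)" unfolding abs_cont_on_iff by blast
  show ?thesis
  proof (rule abs_cont_on_dominated[OF id id L])
    fix x y assume "a \<le> x" "x \<le> y" "y \<le> b"
    then have "norm (f y - f x) \<le> L * norm (y - x)"
      using lipschitz_onD[OF assms, of y x] by (auto simp: dist_norm)
    also have "\<dots> \<le> L * (norm (y - x) + norm (y - x))"
      using L by (intro mult_left_mono) auto
    finally show "norm (f y - f x) \<le> L * (norm (y - x) + norm (y - x))" .
  qed
qed

text \<open>Truncation by \<open>min _ c\<close> and \<open>max _ c\<close> cuts every interval at
  \<open>c\<close>; the pieces on each side stay nonoverlapping and are no longer in total than the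
  given family. This is what allows a competitor to be spliced into the minimizer.\<close>

lemma abs_cont_on_join:
  fixes f :: "real \<Rightarrow> 'a::real_normed_vector"
  assumes f: "abs_cont_on a c f" and g: "abs_cont_on c b f" and ac: "a \<le> c" "c \<le> b"
  shows "abs_cont_on a b f"
  unfolding abs_cont_on_iff
proof (intro allI impI)
  fix e :: real assume e: "e > 0"
  then have e2: "e/2 > 0" by simp
  obtain d1 where d1: "ac_modulus a c f (e/2) d1" using f e2 abs_cont_on_iff by blast
  obtain d2 where d2: "ac_modulus c b f (e/2) d2" using g e2 abs_cont_on_iff by blast
  have "(\<Sum>i<n. norm (f (q i) - f (p i))) < e"
    if *: "nonoverlapping a b n p q" and s: "(\<Sum>k<n. q k - p k) < min d1 d2" for n p q
  proof -
    have le: "a \<le> p k" "p k \<le> q k" "q k \<le> b" if "k < n" for k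
      using * that unfolding nonoverlapping_def by auto
    have sep: "q i \<le> p j \<or> q j \<le> p i" if "i < n" "j < n" "i \<noteq> j" for i j
      using * that unfolding nonoverlapping_def by auto
    have s1: "(\<Sum>k<n. min (q k) c - min (p k) c) \<le> (\<Sum>k<n. q k - p k)"
      unfolding min_def by (intro sum_mono) (smt (verit) le lessThan_iff)
    have s2: "(\<Sum>k<n. max (q k) c - max (p k) c) \<le> (\<Sum>k<n. q k - p k)"
      unfolding max_def by (intro sum_mono) (smt (verit) le lessThan_iff)
    have "nonoverlapping a c n (\<lambda>k. min (p k) c) (\<lambda>k. min (q k) c)"
      unfolding nonoverlapping_def min_def using le sep ac by (smt (verit))
    then have 1: "(\<Sum>k<n. norm (f (min (q k) c) - f (min (p k) c))) < e/2"
      using s s1 by (intro ac_modulusD[OF d1]) auto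
    have "nonoverlapping c b n (\<lambda>k. max (p k) c) (\<lambda>k. max (q k) c)"
      unfolding nonoverlapping_def max_def using le sep ac by (smt (verit))
    then have 2: "(\<Sum>k<n. norm (f (max (q k) c) - f (max (p k) c))) < e/2"
      using s s2 by (intro ac_modulusD[OF d2]) auto
    have "(\<Sum>k<n. norm (f (q k) - f (p k))) \<le> (\<Sum>k<n. norm (f (min (q k) c) - f (min (p k) c)) + norm (f (max (q k) c) - f (max (p k) c)))"
    proof (rule sum_mono)
      fix k assume "k \<in> {..<n}"
      then have "p k \<le> q k" using le by auto
      then consider "q k \<le> c" | "c \<le> p k" | "p k \<le> c" "c \<le> q k" by linarith
      then show "norm (f (q k) - f (p k)) \<le> norm (f (min (q k) c) - f (min (p k) c)) + norm (f (max (q k) c) - f (max (p k) c))"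
      proof cases
        case 3
        have "f (q k) - f (p k) = (f c - f (p k)) + (f (q k) - f c)" by simp
        then have "norm (f (q k) - f (p k)) \<le> norm (f c - f (p k)) + norm (f (q k) - f c)"
          by (metis norm_triangle_ineq)
        with 3 show ?thesis by (simp add: min_absorb2 min_absorb1 max_absorb1 max_absorb2)
      qed (use \<open>p k \<le> q k\<close> in \<open>auto simp: min_def max_def\<close>)
    qed
    also have "\<dots> < e" using 1 2 by (simp add: sum.distrib)
    finally show ?thesis .
  qed
  then have "ac_modulus a b f e (min d1 d2)"
    using ac_modulus_pos[OF d1] ac_modulus_pos[OF d2] by (simp add: ac_modulus_def)
  then show "\<exists>d. ac_modulus a b f e d" by blast
qed

lemma abs_cont_on_cong:
  assumes "abs_cont_on a b f" "\<And>x. x \<in> {a..b} \<Longrightarrow> f x = g x"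
  shows "abs_cont_on a b g"
  by (rule abs_cont_on_dominated[OF assms(1) assms(1), of 1]) (use assms(2) in auto)

section \<open>Vitali coverings and increments of absolutely continuous functions\<close>

lemma Vitali_finite_intervals:
  fixes E U :: "real set"
  assumes U: "open U" "E \<subseteq> U" and E: "E \<in> lmeasurable" and \<epsilon>: "\<epsilon> > 0"
    and fine: "\<And>x d. x \<in> E \<Longrightarrow> d > 0 \<Longrightarrow> \<exists>c r. c < r \<and> x \<in> {c..r} \<and> r - c < d \<and> \<Phi> c r"
  obtains D where "finite D" "\<And>c r. (c,r) \<in> D \<Longrightarrow> c < r \<and> {c..r} \<subseteq> U \<and> \<Phi> c r"
    "pairwise (\<lambda>i j. disjnt {fst i..snd i} {fst j..snd j}) D"
    "measure lebesgue (E - (\<Union>i\<in>D. {fst i..snd i})) < \<epsilon>"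
proof -
  \<comment> \<open>On the line closed intervals are closed balls, so the covering theorem for balls
    applies after passing to midpoint and radius. The countable disjoint family is cut down to a
    finite one by approximating the measure of its union, at the price of
    \<open>\<epsilon>\<close>.\<close>
  define \<K> where "\<K> = {i::real\<times>real. fst i < snd i \<and> {fst i..snd i} \<subseteq> U \<and> \<Phi> (fst i) (snd i)}"
  define mid where "mid = (\<lambda>i::real\<times>real. (fst i + snd i)/2)"
  define rad where "rad = (\<lambda>i::real\<times>real. (snd i - fst i)/2)"
  have cb: "cball (mid i) (rad i) = {fst i..snd i}" for i
    unfolding cball_eq_atLeastAtMost mid_def rad_def by (auto simp: field_simps)
  obtain C where C: "countable C" "C \<subseteq> \<K>"
     "pairwise (\<lambda>i j. disjnt (cball (mid i) (rad i)) (cball (mid j) (rad j))) C"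
     "negligible (E - (\<Union>i \<in> C. cball (mid i) (rad i)))"
  proof (rule Vitali_covering_theorem_cballs[of \<K> rad E mid])
    show "0 < rad i" if "i \<in> \<K>" for i using that by (simp add: \<K>_def rad_def)
    fix x d :: real assume x: "x \<in> E" and d: "d > 0"
    obtain s where s: "s > 0" "ball x s \<subseteq> U" using U x open_contains_ball by blast
    obtain c r where cr: "c < r" "x \<in> {c..r}" "r - c < min d s" "\<Phi> c r"
      using fine[OF x, of "min d s"] d s by auto
    have "{c..r} \<subseteq> ball x s" using cr by (auto simp: dist_real_def)
    then have "(c,r) \<in> \<K>" using cr s unfolding \<K>_def by auto
    moreover have "x \<in> cball (mid (c,r)) (rad (c,r))" unfolding cb using cr by simp
    moreover have "rad (c,r) < d" using cr by (simp add: rad_def)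
    ultimately show "\<exists>i. i \<in> \<K> \<and> x \<in> cball (mid i) (rad i) \<and> rad i < d" by blast
  qed
  note C' = C[unfolded cb]
  have lm: "E \<inter> {fst i..snd i} \<in> lmeasurable" for i :: "real \<times> real"
    using E by (intro fmeasurable_Int_fmeasurable) auto
  define \<D> where "\<D> = (\<lambda>i. E \<inter> {fst i..snd i}) ` C"
  obtain D' where D': "D' \<subseteq> \<D>" "finite D'" "measure lebesgue (\<Union>\<D>) - \<epsilon> < measure lebesgue (\<Union>D')"
  proof (rule measure_countable_Union_approachable[of \<D> \<epsilon> "measure lebesgue E"])
    show "countable \<D>" using C by (simp add: \<D>_def)
    fix T assume "T \<subseteq> \<D>" "finite T"
    then have "\<Union>T \<subseteq> E" "\<Union>T \<in> lmeasurable" using lm by (auto simp: \<D>_def intro!: fmeasurable.finite_Union)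
    then show "measure lebesgue (\<Union>T) \<le> measure lebesgue E"
      using E by (intro measure_mono_fmeasurable) auto
  qed (use \<epsilon> lm in \<open>auto simp: \<D>_def\<close>)
  obtain D where D: "D \<subseteq> C" "finite D" "D' = (\<lambda>i. E \<inter> {fst i..snd i}) ` D"
    using D' unfolding \<D>_def by (meson finite_subset_image)
  have UD': "\<Union>D' = E \<inter> (\<Union>i\<in>D. {fst i..snd i})" using D by auto
  have U\<D>: "\<Union>\<D> = E \<inter> (\<Union>i\<in>C. {fst i..snd i})" by (auto simp: \<D>_def)
  have mE: "measure lebesgue (\<Union>\<D>) = measure lebesgue E"
  proof -
    have "\<Union>\<D> = E - (E - (\<Union>i\<in>C. {fst i..snd i}))" unfolding U\<D> by blast
    then show ?thesis using measure_Diff_null_set[of E lebesgue "E - (\<Union>i\<in>C. {fst i..snd i})"]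
      using C'(4) E by (simp add: negligible_iff_null_sets)
  qed
  have "measure lebesgue (E - (\<Union>i\<in>D. {fst i..snd i})) = measure lebesgue E - measure lebesgue (\<Union>D')"
  proof -
    have "E - (\<Union>i\<in>D. {fst i..snd i}) = E - \<Union>D'" unfolding UD' by blast
    moreover have "\<Union>D' \<subseteq> E" unfolding UD' by blast
    moreover have "\<Union>D' \<in> sets lebesgue" unfolding UD' using E D(2) by (intro sets.Int sets.finite_UN) auto
    ultimately show ?thesis using measurable_measure_Diff[of E lebesgue "\<Union>D'"] E by simp
  qed
  then have "measure lebesgue (E - (\<Union>i\<in>D. {fst i..snd i})) < \<epsilon>" using D'(3) mE by simp
  moreover have "pairwise (\<lambda>i j. disjnt {fst i..snd i} {fst j..snd j}) D"
    using C'(3) D(1) pairwise_subset by blast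
  moreover have "c < r \<and> {c..r} \<subseteq> U \<and> \<Phi> c r" if "(c,r) \<in> D" for c r
  proof -
    have "(c,r) \<in> \<K>" using that D C by blast
    then show ?thesis by (simp add: \<K>_def)
  qed
  ultimately show thesis using that[of D] D by blast
qed

lemma sum_division_increment:
  fixes f :: "real \<Rightarrow> real"
  assumes D: "D division_of {a..b}" and ab: "a \<le> b"
  shows "(\<Sum>K\<in>D. f (Sup K) - f (Inf K)) = f b - f a"
proof -
  have K: "\<exists>c d. K = {c..d} \<and> c \<le> d" if "K \<in> D" for K
    using division_ofD(3,4)[OF D that] by (force simp: box_real)
  let ?p = "(\<lambda>K. (Inf K, K)) ` D"
  have "?p tagged_division_of {a..b}"
  proof (rule tagged_division_ofI)
    show "finite ?p" using D by auto
    fix x K assume "(x, K) \<in> ?p"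
    then have *: "K \<in> D" "x = Inf K" by auto
    then show "x \<in> K" using K[OF *(1)] by auto
    show "K \<subseteq> {a..b}" using D * by auto
    show "\<exists>a b. K = cbox a b" using D * by blast
  next
    fix x1 K1 x2 K2 assume "(x1, K1) \<in> ?p" "(x2, K2) \<in> ?p" "(x1, K1) \<noteq> (x2, K2)"
    then have "K1 \<in> D" "K2 \<in> D" "K1 \<noteq> K2" by auto
    then show "interior K1 \<inter> interior K2 = {}" using division_ofD(5)[OF D] by blast
  next
    have "{K. \<exists>x. (x, K) \<in> ?p} = D" by auto
    then show "\<Union>{K. \<exists>x. (x, K) \<in> ?p} = {a..b}" using division_ofD(6)[OF D] by simp
  qed
  from additive_tagged_division_1[OF ab this, of f]
  show ?thesis by (subst (asm) sum.reindex) (auto simp: inj_on_def)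
qed

lemma sum_content_division:
  fixes S :: "real set"
  assumes "D division_of S"
  shows "sum (measure lborel) D = measure lebesgue S"
proof -
  have "measure lborel K = measure lebesgue K" if "K \<in> D" for K
    using division_ofD(4)[OF assms that] by (auto simp: measure_completion)
  then show ?thesis using content_division[OF assms] by simp
qed

text \<open>Vitali selects disjoint steep intervals inside the members of \<open>D\<close> that
  exhaust \<open>E\<close> up to small measure. They contribute at least \<open>R\<close> times
  their length; what remains of \<open>D\<close> is short, so absolute continuity makes its
  increment small, whatever its sign.\<close>

lemma increments_ge_slope:
  fixes f :: "real \<Rightarrow> real"
  assumes ac: "abs_cont_on A B f" and E: "E \<in> lmeasurable"
    and slope: "\<And>x d. x \<in> E \<Longrightarrow> d > 0 \<Longrightarrow> \<exists>c r. c < r \<and> x \<in> {c..r} \<and> r - c < d \<and> R * (r - c) < f r - f c"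
    and e: "e > 0"
  shows "\<exists>d>0. \<forall>D. D division_of (\<Union>D) \<longrightarrow> \<Union>D \<subseteq> {A..B} \<longrightarrow> measure lebesgue (\<Union>D - E) < d \<longrightarrow>
       R * sum (measure lborel) D - e \<le> (\<Sum>K\<in>D. f (Sup K) - f (Inf K))"
proof -
  obtain d0 where d0: "ac_modulus A B f (e/2) d0" using ac e unfolding abs_cont_on_iff by (meson half_gt_zero)
  \<comment> \<open>Of the length of \<open>D\<close> less than \<open>d\<close> lies off
    \<open>E\<close> and less than \<open>d\<close> is missed by the Vitali family, so the
    uncontrolled pieces have length below \<open>2 * d\<close>. Their increment and the loss
    \<open>R * TR\<close> must each stay within \<open>e/2\<close>, whence the two terms.\<close>
  define d where "d = min (d0/2) (e / (4 * (\<bar>R\<bar> + 1)))"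
  have d: "d > 0" "2 * d \<le> d0" "2 * d * \<bar>R\<bar> \<le> e/2"
  proof -
    show "d > 0" using ac_modulus_pos[OF d0] e by (auto simp: d_def)
    show "2 * d \<le> d0" by (auto simp: d_def)
    have "2 * d * \<bar>R\<bar> \<le> 2 * (e / (4 * (\<bar>R\<bar> + 1))) * \<bar>R\<bar>"
      by (intro mult_right_mono) (auto simp: d_def)
    also have "\<dots> \<le> e/2" using e by (simp add: field_simps)
    finally show "2 * d * \<bar>R\<bar> \<le> e/2" .
  qed
  show ?thesis
  proof (intro exI[of _ d] conjI allI impI)
    fix D assume D: "D division_of (\<Union>D)" and sub: "\<Union>D \<subseteq> {A..B}" and mD: "measure lebesgue (\<Union>D - E) < d"
    have finD: "finite D" using D by auto
    have Kab: "\<exists>c d. K = {c..d} \<and> c \<le> d" if "K \<in> D" for K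
      using division_ofD(3,4)[OF D that] by (force simp: box_real)
    define U where "U = (\<Union>K\<in>D. interior K)"
    have mU: "U \<in> lmeasurable" "\<Union>D \<in> lmeasurable"
      using Kab finD by (fastforce simp: U_def intro!: fmeasurable.finite_Union fmeasurable.finite_UN)+
    obtain P where P: "finite P" "\<And>c r. (c,r) \<in> P \<Longrightarrow> c < r \<and> {c..r} \<subseteq> U \<and> (R * (r - c) < f r - f c \<and> (\<exists>K\<in>D. {c..r} \<subseteq> K))"
        "pairwise (\<lambda>i j. disjnt {fst i..snd i} {fst j..snd j}) P"
        "measure lebesgue (E \<inter> U - (\<Union>i\<in>P. {fst i..snd i})) < d"
    proof (rule Vitali_finite_intervals[of U "E \<inter> U" d "\<lambda>c r. R * (r - c) < f r - f c \<and> (\<exists>K\<in>D. {c..r} \<subseteq> K)"])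
      show "open U" by (auto simp: U_def)
      show "E \<inter> U \<in> lmeasurable" using E mU by auto
      fix x s :: real assume x: "x \<in> E \<inter> U" and s: "s > 0"
      then obtain K where K: "K \<in> D" "x \<in> interior K" by (auto simp: U_def)
      then obtain s' where s': "s' > 0" "ball x s' \<subseteq> K" using mem_interior by blast
      obtain c r where cr: "c < r" "x \<in> {c..r}" "r - c < min s s'" "R * (r - c) < f r - f c"
        using slope[of x "min s s'"] x s s' by auto
      have "{c..r} \<subseteq> ball x s'" using cr by (auto simp: dist_real_def)
      then show "\<exists>c r. c < r \<and> x \<in> {c..r} \<and> r - c < s \<and> R * (r - c) < f r - f c \<and> (\<exists>K\<in>D. {c..r} \<subseteq> K)"
        using cr s' K by (metis min_less_iff_conj subset_trans)
    qed (use d in auto)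
    define Q where "Q K = (\<lambda>i. {fst i..snd i}) ` {i\<in>P. {fst i..snd i} \<subseteq> K}" for K :: "real set"
    have finQ: "finite (Q K)" for K using P(1) by (simp add: Q_def)
    have Qi: "\<exists>c r. J = {c..r} \<and> c < r \<and> R * (r - c) < f r - f c" if "J \<in> Q K" for J K
      using that P(2) unfolding Q_def by (force)
    have Qdiv: "Q K division_of \<Union>(Q K)" for K
    proof (rule division_ofI)
      fix J J' assume J: "J \<in> Q K" "J' \<in> Q K" "J \<noteq> J'"
      then obtain i j where ij: "i \<in> P" "j \<in> P" "J = {fst i..snd i}" "J' = {fst j..snd j}"
        unfolding Q_def by blast
      then have "J \<inter> J' = {}" using P(3) J unfolding pairwise_def disjnt_def by metis
      then show "interior J \<inter> interior J' = {}" using interior_subset by blast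
    qed (use finQ Qi in \<open>force simp: box_real\<close>)+
    \<comment> \<open>The steep intervals inside \<open>K\<close> are completed to a division of
      \<open>K\<close>; the added pieces \<open>q K - Q K\<close> are those left to absolute
      continuity.\<close>
    have "\<exists>q. Q K \<subseteq> q \<and> q division_of K" if KD: "K \<in> D" for K
    proof -
      obtain c r where K: "K = cbox c r" using Kab[OF KD] by (auto simp: box_real)
      have "\<Union>(Q K) \<subseteq> cbox c r" unfolding K[symmetric] Q_def by auto
      from partial_division_extend_interval[OF Qdiv this] show ?thesis unfolding K by metis
    qed
    then obtain q where q: "\<And>K. K \<in> D \<Longrightarrow> Q K \<subseteq> q K" "\<And>K. K \<in> D \<Longrightarrow> q K division_of K" by metis
    have finq: "finite (q K)" if "K \<in> D" for K using q(2)[OF that] by auto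
    have qab: "\<exists>c d. L = {c..d} \<and> c \<le> d" if "L \<in> q K" "K \<in> D" for K L
      using division_ofD(3,4)[OF q(2)[OF that(2)] that(1)] by (force simp: box_real)
    have incr: "f (Sup K) - f (Inf K) = (\<Sum>L\<in>q K. f (Sup L) - f (Inf L))" if "K \<in> D" for K
      using sum_division_increment[of "q K" "Inf K" "Sup K" f] q(2)[OF that] Kab[OF that] by auto
    have cont: "measure lborel K = (\<Sum>L\<in>q K. measure lborel L)" if "K \<in> D" for K
      using additive_content_division[of "q K" "Inf K" "Sup K"] q(2)[OF that] Kab[OF that] by (auto simp: box_real)
    define TJ where "TJ = (\<Sum>K\<in>D. sum (measure lborel) (Q K))"
    define TR where "TR = (\<Sum>K\<in>D. sum (measure lborel) (q K - Q K))"
    have split: "(\<Sum>L\<in>q K. F L) = (\<Sum>L\<in>Q K. F L) + (\<Sum>L\<in>q K - Q K. F L)" if "K \<in> D" for K and F :: "real set \<Rightarrow> real"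
      using sum.subset_diff[OF q(1)[OF that] finq[OF that], of F] by simp
    have T: "sum (measure lborel) D = TJ + TR"
      unfolding TJ_def TR_def sum.distrib[symmetric] by (rule sum.cong) (auto simp: cont split)
    have TR: "TR < 2 * d"
    proof -
      have "sum (measure lborel) D = measure lebesgue (\<Union>D)"
        by (rule sum_content_division[OF D])
      also have "\<dots> \<le> measure lebesgue ((\<Union>D - E) \<union> (\<Union>K\<in>D. frontier K) \<union> (E \<inter> U - (\<Union>i\<in>P. {fst i..snd i})) \<union> (\<Union>i\<in>P. {fst i..snd i}))"
      proof (rule measure_mono_fmeasurable)
        show "\<Union>D \<subseteq> (\<Union>D - E) \<union> (\<Union>K\<in>D. frontier K) \<union> (E \<inter> U - (\<Union>i\<in>P. {fst i..snd i})) \<union> (\<Union>i\<in>P. {fst i..snd i})"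
          using closure_subset unfolding U_def frontier_def by fastforce
        show "(\<Union>D - E) \<union> (\<Union>K\<in>D. frontier K) \<union> (E \<inter> U - (\<Union>i\<in>P. {fst i..snd i})) \<union> (\<Union>i\<in>P. {fst i..snd i}) \<in> lmeasurable"
          using mU E P(1) finD Kab
          by (intro fmeasurable.Un fmeasurable.Diff fmeasurable_Int_fmeasurable fmeasurable.finite_UN) 
             (auto simp: frontier_def intro!: fmeasurable_Diff dest!: Kab)
      qed (use mU in auto)
      also have "\<dots> \<le> measure lebesgue (\<Union>D - E) + measure lebesgue (\<Union>K\<in>D. frontier K) + measure lebesgue (E \<inter> U - (\<Union>i\<in>P. {fst i..snd i})) + measure lebesgue (\<Union>i\<in>P. {fst i..snd i})"
      proof -
        have m: "\<Union>D - E \<in> sets lebesgue" "(\<Union>K\<in>D. frontier K) \<in> sets lebesgue" "E \<inter> U - (\<Union>i\<in>P. {fst i..snd i}) \<in> sets lebesgue" "(\<Union>i\<in>P. {fst i..snd i}) \<in> sets lebesgue"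
          using mU E P(1) finD by (auto intro!: sets.finite_UN)
        show ?thesis
          using measure_Un_le[OF m(1,2)] measure_Un_le[OF sets.Un[OF m(1,2)] m(3)]
            measure_Un_le[OF sets.Un[OF sets.Un[OF m(1,2)] m(3)] m(4)] by linarith
      qed
      also have "measure lebesgue (\<Union>K\<in>D. frontier K) = 0"
      proof -
        have "negligible (\<Union>K\<in>D. frontier K)"
        proof (rule negligible_Union)
          fix T assume "T \<in> frontier ` D"
          then show "negligible T" using Kab negligible_convex_frontier by (metis convex_real_interval(5) imageE)
        qed (use finD in auto)
        then show ?thesis by (simp add: negligible_imp_measure0)
      qed
      also have "measure lebesgue (\<Union>i\<in>P. {fst i..snd i}) \<le> TJ"
      proof -
        have "(\<Union>i\<in>P. {fst i..snd i}) \<subseteq> (\<Union>K\<in>D. \<Union>(Q K))"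
        proof (rule UN_least)
          fix i assume i: "i \<in> P"
          then obtain K where "K \<in> D" "{fst i..snd i} \<subseteq> K" using P(2)[of "fst i" "snd i"] by auto
          then show "{fst i..snd i} \<subseteq> (\<Union>K\<in>D. \<Union>(Q K))" using i unfolding Q_def by blast
        qed
        moreover have mQ: "\<Union>(Q K) \<in> lmeasurable" for K
          using finQ Qi by (auto intro!: fmeasurable.finite_Union)
        ultimately have "measure lebesgue (\<Union>i\<in>P. {fst i..snd i}) \<le> measure lebesgue (\<Union>K\<in>D. \<Union>(Q K))"
          using finD P(1) by (intro measure_mono_fmeasurable) (auto intro!: sets.finite_UN fmeasurable.finite_UN)
        also have "\<dots> \<le> (\<Sum>K\<in>D. measure lebesgue (\<Union>(Q K)))"
          using mQ finD by (intro measure_UNION_le) auto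
        also have "\<dots> = TJ" unfolding TJ_def using sum_content_division[OF Qdiv] by simp
        finally show ?thesis .
      qed
      finally show ?thesis using mD P(4) T by linarith
    qed
    have TR0: "TR \<ge> 0" unfolding TR_def by (intro sum_nonneg) auto
    have rem: "\<bar>\<Sum>K\<in>D. \<Sum>L\<in>q K - Q K. f (Sup L) - f (Inf L)\<bar> < e/2"
    proof -
      define I where "I = Sigma D (\<lambda>K. q K - Q K)"
      have "(\<Sum>i\<in>I. norm (f (Sup (snd i)) - f (Inf (snd i)))) < e/2"
      proof (rule ac_modulus_sum[OF d0])
        show "finite I" using finD finq by (auto simp: I_def)
        fix i assume i: "i \<in> I"
        then obtain K L where KL: "i = (K,L)" "K \<in> D" "L \<in> q K" by (auto simp: I_def)
        obtain c r where cr: "L = {c..r}" "c \<le> r" using qab KL by blast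
        have "L \<subseteq> {A..B}" using division_ofD(2)[OF q(2)] KL sub by blast
        then show "A \<le> Inf (snd i) \<and> Inf (snd i) \<le> Sup (snd i) \<and> Sup (snd i) \<le> B"
          using cr KL by auto
      next
        fix i j assume i: "i \<in> I" "j \<in> I" "i \<noteq> j"
        then obtain K L K' L' where KL: "i = (K,L)" "K \<in> D" "L \<in> q K" "j = (K',L')" "K' \<in> D" "L' \<in> q K'"
          by (auto simp: I_def)
        obtain c r where cr: "L = {c..r}" "c \<le> r" using qab KL by blast
        obtain c' r' where cr': "L' = {c'..r'}" "c' \<le> r'" using qab KL by blast
        have "interior L \<inter> interior L' = {}"
        proof (cases "K = K'")
          case True
          then show ?thesis using KL i division_ofD(5)[OF q(2)] by blast
        next
          case False
          then have "interior K \<inter> interior K' = {}" using KL division_ofD(5)[OF D] by blast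
          moreover have "L \<subseteq> K" "L' \<subseteq> K'" using KL division_ofD(2)[OF q(2)] by blast+
          ultimately show ?thesis using interior_mono by blast
        qed
        then show "{Inf (snd i)<..<Sup (snd i)} \<inter> {Inf (snd j)<..<Sup (snd j)} = {}"
          using cr cr' KL by auto
      next
        have "(\<Sum>i\<in>I. Sup (snd i) - Inf (snd i)) = (\<Sum>i\<in>I. measure lborel (snd i))"
          by (rule sum.cong) (use qab in \<open>fastforce simp: I_def\<close>)+
        also have "\<dots> = TR" unfolding I_def TR_def using finD finq by (subst sum.Sigma) (auto simp: case_prod_beta)
        finally show "(\<Sum>i\<in>I. Sup (snd i) - Inf (snd i)) < d0" using TR d by simp
      qed
      moreover have "(\<Sum>K\<in>D. \<Sum>L\<in>q K - Q K. f (Sup L) - f (Inf L)) = (\<Sum>i\<in>I. f (Sup (snd i)) - f (Inf (snd i)))"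
        unfolding I_def using finD finq by (subst sum.Sigma) (auto simp: case_prod_beta)
      moreover have "\<bar>\<Sum>i\<in>I. f (Sup (snd i)) - f (Inf (snd i))\<bar> \<le> (\<Sum>i\<in>I. norm (f (Sup (snd i)) - f (Inf (snd i))))"
        by (simp add: sum_abs)
      ultimately show ?thesis by linarith
    qed
    have "(\<Sum>K\<in>D. f (Sup K) - f (Inf K)) = (\<Sum>K\<in>D. \<Sum>L\<in>Q K. f (Sup L) - f (Inf L)) + (\<Sum>K\<in>D. \<Sum>L\<in>q K - Q K. f (Sup L) - f (Inf L))"
      unfolding sum.distrib[symmetric] by (rule sum.cong) (auto simp: incr split)
    moreover have "(\<Sum>K\<in>D. \<Sum>L\<in>Q K. f (Sup L) - f (Inf L)) \<ge> R * TJ"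
      unfolding TJ_def sum_distrib_left
    proof (intro sum_mono)
      fix K L assume "L \<in> Q K"
      from Qi[OF this] show "R * measure lborel L \<le> f (Sup L) - f (Inf L)" by auto
    qed
    moreover have "R * TJ = R * sum (measure lborel) D - R * TR" using T by (simp add: algebra_simps)
    moreover have "R * TR \<le> e/2"
    proof -
      have "R * TR \<le> \<bar>R\<bar> * (2*d)" using TR TR0 by (intro mult_mono) auto
      then show ?thesis using d(3) by (simp add: mult.commute mult.left_commute)
    qed
    ultimately show "R * sum (measure lborel) D - e \<le> (\<Sum>K\<in>D. f (Sup K) - f (Inf K))"
      using rem by linarith
  qed (rule d(1))
qed

section \<open>Dini derivates and almost everywhere differentiability\<close>

lemma frequently_at_real:
  "(\<exists>\<^sub>F y in at (x::real). P y) \<longleftrightarrow> (\<forall>d>0. \<exists>y. y \<noteq> x \<and> \<bar>y - x\<bar> < d \<and> P y)"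
  by (auto simp: frequently_def eventually_at dist_real_def)

lemma frequently_slope_interval:
  fixes f :: "real \<Rightarrow> real"
  assumes "\<exists>\<^sub>F y in at x. R < (f y - f x) / (y - x)" "d > 0"
  shows "\<exists>c r. c < r \<and> x \<in> {c..r} \<and> r - c < d \<and> R * (r - c) < f r - f c"
proof -
  obtain y where y: "y \<noteq> x" "\<bar>y - x\<bar> < d" "R < (f y - f x) / (y - x)"
    using assms unfolding frequently_at_real by blast
  show ?thesis
  proof (cases "y < x")
    case True
    have "R * (x - y) < f x - f y" using y True by (simp add: field_simps)
    then show ?thesis using y True by (intro exI[of _ y] exI[of _ x]) auto
  next
    case False
    then have "R * (y - x) < f y - f x" using y by (simp add: field_simps)
    then show ?thesis using y False by (intro exI[of _ x] exI[of _ y]) auto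
  qed
qed

text \<open>Frequent quotients above \<open>R\<close> express, up to equality, that the two-sided
  upper Dini derivate exceeds \<open>R\<close>, without extended limits. Applied to
  \<open>- f\<close> and \<open>- r\<close> the same notion says that the lower derivate is below
  \<open>r\<close>.\<close>

definition slope_gt :: "real \<Rightarrow> real \<Rightarrow> (real \<Rightarrow> real) \<Rightarrow> real \<Rightarrow> real set" where
  "slope_gt a b f R = {x \<in> {a<..<b}. \<exists>\<^sub>F y in at x. R < (f y - f x) / (y - x)}"

text \<open>For fixed \<open>y\<close> the condition on \<open>x\<close> is open by continuity of
  \<open>f\<close>, so the set is the countable intersection of the open sets
  \<open>W n\<close>.\<close>

lemma slope_gt_lmeasurable:
  assumes f: "continuous_on {a<..<b} f"
  shows "slope_gt a b f R \<in> lmeasurable"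
proof -
  define W where "W n = (\<Union>y\<in>{a<..<b}. ({a<..<b} \<inter> {x. x \<noteq> y \<and> \<bar>y - x\<bar> < 1 / real (Suc n)}) \<inter> (\<lambda>x. (f y - f x) / (y - x)) -` {R<..})" for n
  have opW: "open (W n)" for n
    unfolding W_def
  proof (intro open_UN ballI)
    fix y assume "y \<in> {a<..<b}"
    have "{x. x \<noteq> y \<and> \<bar>y - x\<bar> < 1 / real (Suc n)} = ball y (1 / real (Suc n)) - {y}"
      by (auto simp: dist_real_def)
    then have op: "open ({a<..<b} \<inter> {x. x \<noteq> y \<and> \<bar>y - x\<bar> < 1 / real (Suc n)})"
      by (simp only:) (intro open_Int open_Diff open_ball closed_singleton open_greaterThanLessThan)
    show "open (({a<..<b} \<inter> {x. x \<noteq> y \<and> \<bar>y - x\<bar> < 1 / real (Suc n)}) \<inter> (\<lambda>x. (f y - f x) / (y - x)) -` {R<..})"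
      by (rule continuous_open_preimage[OF _ op])
         (auto intro!: continuous_intros continuous_on_subset[OF f])
  qed
  have "slope_gt a b f R = (\<Inter>n. W n)"
  proof (intro equalityI subsetI)
    fix x assume x: "x \<in> slope_gt a b f R"
    then have ab: "a < x" "x < b" by (auto simp: slope_gt_def)
    show "x \<in> (\<Inter>n. W n)"
    proof
      fix n
      obtain y where "y \<noteq> x" "\<bar>y - x\<bar> < Min {1 / real (Suc n), x - a, b - x}" "R < (f y - f x) / (y - x)"
        using x ab unfolding slope_gt_def frequently_at_real
        by (auto dest!: spec[of _ "Min {1 / real (Suc n), x - a, b - x}"])
      then show "x \<in> W n" unfolding W_def using ab by (intro UN_I[of y]) auto
    qed
  next
    fix x assume x: "x \<in> (\<Inter>n. W n)"
    have "\<exists>y. y \<noteq> x \<and> \<bar>y - x\<bar> < d \<and> R < (f y - f x) / (y - x)" if d: "d > 0" for d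
    proof -
      obtain n where n: "1 / real (Suc n) < d" using reals_Archimedean[OF d] by (auto simp: inverse_eq_divide)
      have "x \<in> W n" using x by blast
      then obtain y where "x \<noteq> y" "\<bar>y - x\<bar> < 1 / real (Suc n)" "R < (f y - f x) / (y - x)"
        unfolding W_def by blast
      then show ?thesis using n by (intro exI[of _ y]) auto
    qed
    moreover have "x \<in> {a<..<b}" using x unfolding W_def by blast
    ultimately show "x \<in> slope_gt a b f R" unfolding slope_gt_def frequently_at_real by blast
  qed
  then have "slope_gt a b f R \<in> sets lebesgue" using opW by (auto intro!: sets.countable_INT)
  moreover have "bounded (slope_gt a b f R)"
    by (rule bounded_subset[of "{a..b}"]) (auto simp: slope_gt_def)
  ultimately show ?thesis by (rule bounded_set_imp_lmeasurable[rotated])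
qed

text \<open>An open superset of \<open>E\<close> of almost the same measure limits the waste, and a
  Vitali family inside it limits what is missed. Here the fine cover carries no condition: short
  intervals starting at the point will do.\<close>

lemma fine_division_near:
  fixes E :: "real set"
  assumes E: "E \<in> lmeasurable" "E \<subseteq> V" "open V" and \<epsilon>: "\<epsilon> > 0"
  obtains D where "D division_of \<Union>D" "\<Union>D \<subseteq> V" "measure lebesgue (\<Union>D - E) < \<epsilon>"
    "measure lebesgue E < sum (measure lborel) D + \<epsilon>"
proof -
  obtain U where U: "open U" "E \<subseteq> U" "U - E \<in> lmeasurable" "emeasure lebesgue (U - E) < ennreal \<epsilon>"
    using sets_lebesgue_outer_open[OF fmeasurableD[OF E(1)] \<epsilon>] by metis
  have mU: "measure lebesgue (U - E) < \<epsilon>"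
    using U(3,4) by (metis emeasure_eq_measure2 ennreal_leI not_less)
  define U' where "U' = U \<inter> V"
  have U': "open U'" "E \<subseteq> U'" using U E by (auto simp: U'_def)
  obtain P where P: "finite P" "\<And>c r. (c,r) \<in> P \<Longrightarrow> c < r \<and> {c..r} \<subseteq> U' \<and> True"
      "pairwise (\<lambda>i j. disjnt {fst i..snd i} {fst j..snd j}) P"
      "measure lebesgue (E - (\<Union>i\<in>P. {fst i..snd i})) < \<epsilon>"
  proof (rule Vitali_finite_intervals[OF U'(1,2) E(1) \<epsilon>, of "\<lambda>c r. True"])
    fix x d :: real assume "d > 0"
    then show "\<exists>c r. c < r \<and> x \<in> {c..r} \<and> r - c < d \<and> True"
      by (intro exI[of _ x] exI[of _ "x + d/2"]) auto
  qed auto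
  define D where "D = (\<lambda>i. {fst i..snd i}) ` P"
  have D: "D division_of \<Union>D"
  proof (rule division_ofI)
    fix J J' assume J: "J \<in> D" "J' \<in> D" "J \<noteq> J'"
    then obtain i j where ij: "i \<in> P" "j \<in> P" "J = {fst i..snd i}" "J' = {fst j..snd j}"
      unfolding D_def by blast
    then have "J \<inter> J' = {}" using P(3) J unfolding pairwise_def disjnt_def by metis
    then show "interior J \<inter> interior J' = {}" using interior_subset by blast
  next
    fix K assume "K \<in> D"
    then obtain i where "i \<in> P" "K = {fst i..snd i}" unfolding D_def by blast
    then show "K \<noteq> {}" "\<exists>a b. K = cbox a b" using P(2)[of "fst i" "snd i"] by (auto simp: box_real)
  qed (use P in \<open>auto simp: D_def\<close>)
  have sub: "\<Union>D \<subseteq> U'"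
  proof
    fix x assume "x \<in> \<Union>D"
    then obtain i where i: "i \<in> P" "x \<in> {fst i..snd i}" unfolding D_def by blast
    then have "{fst i..snd i} \<subseteq> U'" using P(2)[of "fst i" "snd i"] by simp
    then show "x \<in> U'" using i by blast
  qed
  have mD: "\<Union>D \<in> lmeasurable" using P(1) by (auto simp: D_def intro!: fmeasurable.finite_UN)
  have "measure lebesgue (\<Union>D - E) \<le> measure lebesgue (U - E)"
    using sub mD U E by (intro measure_mono_fmeasurable) (auto simp: U'_def)
  then have 1: "measure lebesgue (\<Union>D - E) < \<epsilon>" using mU by simp
  have "measure lebesgue E \<le> measure lebesgue ((E - \<Union>D) \<union> \<Union>D)"
    using E mD by (intro measure_mono_fmeasurable) (auto intro!: fmeasurable_Diff)
  also have "\<dots> \<le> measure lebesgue (E - \<Union>D) + measure lebesgue (\<Union>D)"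
    using E mD by (intro measure_Un_le) auto
  also have "E - \<Union>D = E - (\<Union>i\<in>P. {fst i..snd i})" by (simp add: D_def)
  finally have 2: "measure lebesgue E < sum (measure lborel) D + \<epsilon>"
    using P(4) sum_content_division[OF D] by simp
  show thesis using that[OF D _ 1 2] sub by (auto simp: U'_def)
qed

text \<open>On a division \<open>D\<close> close to the set, \<open>f\<close> increases by at least
  R |D| - e and by at most r |D| + e, so |D| is at most 2 e / (R - r). The choice of
  \<open>e\<close> turns this into \<open>e0/2\<close>; the other half pays for the approximation of
  the set by \<open>D\<close>.\<close>

lemma negligible_slope_gap:
  fixes f :: "real \<Rightarrow> real"
  assumes ac: "abs_cont_on a b f" and rR: "r < R"
  shows "negligible (slope_gt a b f R \<inter> slope_gt a b (\<lambda>x. - f x) (- r))"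
proof -
  define E where "E = slope_gt a b f R \<inter> slope_gt a b (\<lambda>x. - f x) (- r)"
  have cont: "continuous_on {a<..<b} f"
    using abs_cont_on_imp_continuous_on[OF ac] by (rule continuous_on_subset) auto
  have E: "E \<in> lmeasurable" unfolding E_def
    using cont by (intro fmeasurable_Int_fmeasurable slope_gt_lmeasurable fmeasurableD continuous_intros)
  have ac': "abs_cont_on a b (\<lambda>x. - f x)"
    by (rule abs_cont_on_dominated[OF ac ac, of 1]) (auto simp: abs_minus_commute)
  have "measure lebesgue E \<le> 0"
  proof (rule field_le_epsilon)
    fix e0 :: real assume e0: "e0 > 0"
    define e where "e = (R - r) * e0 / 4"
    have e: "e > 0" using e0 rR by (simp add: e_def)
    have sl: "\<exists>c s. c < s \<and> x \<in> {c..s} \<and> s - c < d \<and> R * (s - c) < f s - f c" if "x \<in> E" "d > 0" for x d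
      using that by (intro frequently_slope_interval) (auto simp: E_def slope_gt_def)
    obtain d1 where d1: "d1 > 0" "\<forall>D. D division_of (\<Union>D) \<longrightarrow> \<Union>D \<subseteq> {a..b} \<longrightarrow> measure lebesgue (\<Union>D - E) < d1 \<longrightarrow>
       R * sum (measure lborel) D - e \<le> (\<Sum>K\<in>D. f (Sup K) - f (Inf K))"
      using increments_ge_slope[OF ac E sl e] by blast
    have sl': "\<exists>c s. c < s \<and> x \<in> {c..s} \<and> s - c < d \<and> (-r) * (s - c) < (\<lambda>x. - f x) s - (\<lambda>x. - f x) c" if "x \<in> E" "d > 0" for x d
      using that unfolding E_def slope_gt_def by (intro frequently_slope_interval) blast+
    obtain d2 where d2: "d2 > 0" "\<forall>D. D division_of (\<Union>D) \<longrightarrow> \<Union>D \<subseteq> {a..b} \<longrightarrow> measure lebesgue (\<Union>D - E) < d2 \<longrightarrow>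
       (-r) * sum (measure lborel) D - e \<le> (\<Sum>K\<in>D. - f (Sup K) - - f (Inf K))"
      using increments_ge_slope[OF ac' E sl' e] by blast
    have pos: "Min {d1, d2, e0/2} > 0" using d1 d2 e0 by simp
    have "E \<subseteq> {a<..<b}" by (auto simp: E_def slope_gt_def)
    then obtain D where D: "D division_of \<Union>D" "\<Union>D \<subseteq> {a<..<b}" "measure lebesgue (\<Union>D - E) < Min {d1, d2, e0/2}"
      "measure lebesgue E < sum (measure lborel) D + Min {d1, d2, e0/2}"
      by (rule fine_division_near[OF E _ open_greaterThanLessThan pos])
    have sub: "\<Union>D \<subseteq> {a..b}" using D(2) by force
    have "(R - r) * sum (measure lborel) D \<le> 2 * e"
      using d1(2)[rule_format, OF D(1) sub] d2(2)[rule_format, OF D(1) sub] D(3)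
      by (simp add: sum_subtractf algebra_simps)
    also have "2 * e = (R - r) * (e0 / 2)" by (simp add: e_def)
    finally have "sum (measure lborel) D \<le> e0 / 2" using rR by (simp only: mult_le_cancel_left_pos diff_gt_0_iff_gt)
    then show "measure lebesgue E \<le> 0 + e0" using D(4) by simp
  qed
  then have "measure lebesgue E = 0" using measure_nonneg[of lebesgue E] by simp
  then show ?thesis using E unfolding E_def[symmetric] by (simp add: negligible_iff_measure)
qed

text \<open>On a piece shorter than \<open>d0\<close> the modulus for 1 caps every total increment
  by 1, while slopes above n force at least n |D| - 1; hence |D| is at most 2/n. Negligibility is
  local, and a ball of radius \<open>d0/3\<close> is shorter than \<open>d0\<close>.\<close>

lemma negligible_slope_unbounded:
  fixes f :: "real \<Rightarrow> real"
  assumes ac: "abs_cont_on a b f"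
  shows "negligible {x. \<forall>n::nat. x \<in> slope_gt a b f (real n)}"
  unfolding locally_negligible_alt[of "{x. \<forall>n::nat. x \<in> slope_gt a b f (real n)}"]
proof
  define S where "S = {x. \<forall>n::nat. x \<in> slope_gt a b f (real n)}"
  fix x assume x: "x \<in> S"
  have cont: "continuous_on {a<..<b} f"
    using abs_cont_on_imp_continuous_on[OF ac] by (rule continuous_on_subset) auto
  obtain d0 where d0: "ac_modulus a b f 1 d0" using ac unfolding abs_cont_on_iff by (meson zero_less_one)
  have d0p: "d0 > 0" using ac_modulus_pos[OF d0] .
  define E where "E = S \<inter> ball x (d0/3)"
  have "S = (\<Inter>n. slope_gt a b f (real n))" by (auto simp: S_def)
  then have "S \<in> sets lebesgue" using slope_gt_lmeasurable[OF cont] by (auto intro!: sets.countable_INT)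
  then have E: "E \<in> lmeasurable" unfolding E_def by (metis Int_commute fmeasurable_Int_fmeasurable lmeasurable_ball)
  have "measure lebesgue E \<le> 0"
  proof (rule field_le_epsilon)
    fix e0 :: real assume e0: "e0 > 0"
    obtain n :: nat where n: "4 / e0 < real n" using reals_Archimedean2 by blast
    have n0: "real n > 0" using n e0 by (meson divide_pos_pos less_trans zero_less_numeral)
    have sl: "\<exists>c s. c < s \<and> y \<in> {c..s} \<and> s - c < d \<and> real n * (s - c) < f s - f c" if "y \<in> E" "d > 0" for y d
      using that by (intro frequently_slope_interval) (auto simp: E_def S_def slope_gt_def)
    obtain d1 where d1: "d1 > 0" "\<forall>D. D division_of (\<Union>D) \<longrightarrow> \<Union>D \<subseteq> {a..b} \<longrightarrow> measure lebesgue (\<Union>D - E) < d1 \<longrightarrow>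
       real n * sum (measure lborel) D - 1 \<le> (\<Sum>K\<in>D. f (Sup K) - f (Inf K))"
      using increments_ge_slope[OF ac E sl zero_less_one] by blast
    have pos: "min d1 (e0/2) > 0" using d1 e0 by simp
    have EV: "E \<subseteq> {a<..<b} \<inter> ball x (d0/3)" by (auto simp: E_def S_def slope_gt_def)
    have opV: "open ({a<..<b} \<inter> ball x (d0/3))" by (intro open_Int open_greaterThanLessThan open_ball)
    obtain D where D: "D division_of \<Union>D" "\<Union>D \<subseteq> {a<..<b} \<inter> ball x (d0/3)" "measure lebesgue (\<Union>D - E) < min d1 (e0/2)"
      "measure lebesgue E < sum (measure lborel) D + min d1 (e0/2)"
      by (rule fine_division_near[OF E EV opV pos])
    have sub: "\<Union>D \<subseteq> {a..b}" using D(2) by force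
    have Kab: "\<exists>c d. K = {c..d} \<and> c \<le> d" if "K \<in> D" for K
      using division_ofD(3,4)[OF D(1) that] by (force simp: box_real)
    have "(\<Sum>K\<in>D. norm (f (Sup K) - f (Inf K))) < 1"
    proof (rule ac_modulus_sum[OF d0])
      show "finite D" using D(1) by auto
      show "a \<le> Inf K \<and> Inf K \<le> Sup K \<and> Sup K \<le> b" if "K \<in> D" for K
      proof -
        have "K \<subseteq> {a..b}" using sub that by blast
        then show ?thesis using Kab[OF that] by auto
      qed
      show "{Inf K<..<Sup K} \<inter> {Inf K'<..<Sup K'} = {}" if K: "K \<in> D" "K' \<in> D" "K \<noteq> K'" for K K'
        using division_ofD(5)[OF D(1) K] Kab[OF K(1)] Kab[OF K(2)] by auto
      have "(\<Sum>K\<in>D. Sup K - Inf K) = sum (measure lborel) D"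
        by (rule sum.cong) (use Kab in fastforce)+
      also have "\<dots> = measure lebesgue (\<Union>D)" by (rule sum_content_division[OF D(1)])
      also have "\<dots> \<le> measure lebesgue (ball x (d0/3))"
      proof (rule measure_mono_fmeasurable)
        have "K \<in> sets lebesgue" if "K \<in> D" for K using Kab[OF that] by auto
        then show "\<Union>D \<in> sets lebesgue" using \<open>finite D\<close> by (intro sets.finite_Union) auto
      qed (use D(2) in auto)
      also have "\<dots> < d0" using d0p by (simp add: ball_eq_greaterThanLessThan measure_completion)
      finally show "(\<Sum>K\<in>D. Sup K - Inf K) < d0" .
    qed
    moreover have "(\<Sum>K\<in>D. f (Sup K) - f (Inf K)) \<le> (\<Sum>K\<in>D. norm (f (Sup K) - f (Inf K)))"
      by (intro sum_mono) auto
    ultimately have "real n * sum (measure lborel) D \<le> 2"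
      using d1(2)[rule_format, OF D(1) sub] D(3) by simp
    then have "sum (measure lborel) D \<le> 2 / real n" using n0 by (simp add: field_simps)
    also have "\<dots> \<le> e0 / 2" using n n0 e0 by (simp add: field_simps)
    finally show "measure lebesgue E \<le> 0 + e0" using D(4) by simp
  qed
  then have "measure lebesgue E = 0" using measure_nonneg[of lebesgue E] by simp
  then have "negligible E" using E by (simp add: negligible_iff_measure)
  then show "\<exists>U. openin (top_of_set S) U \<and> x \<in> U \<and> negligible U"
    using x d0p unfolding E_def by (intro exI[of _ "S \<inter> ball x (d0/3)"]) auto
qed

text \<open>\<open>Sup B\<close> is the lower limit of the difference quotients. A rational pair
  squeezed between it and any larger number shows that the upper limit is no larger. Only rational
  pairs are tested, which keeps the exceptional sets countable in number.\<close>

lemma slope_converges: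
  fixes f :: "real \<Rightarrow> real"
  assumes x: "x \<in> {a<..<b}"
    and up: "x \<notin> slope_gt a b f U" and lo: "x \<notin> slope_gt a b (\<lambda>x. - f x) L"
    and gap: "\<And>r R. r \<in> \<rat> \<Longrightarrow> R \<in> \<rat> \<Longrightarrow> r < R \<Longrightarrow> x \<notin> slope_gt a b f R \<inter> slope_gt a b (\<lambda>x. - f x) (- r)"
  shows "f differentiable (at x)"
proof -
  define q where "q y = (f y - f x) / (y - x)" for y
  have q': "(- f y - - f x) / (y - x) = - q y" for y by (simp add: q_def diff_divide_distrib)
  have ev_up: "x \<notin> slope_gt a b f R \<longleftrightarrow> (\<forall>\<^sub>F y in at x. q y \<le> R)" for R
    using x by (auto simp: slope_gt_def frequently_def q_def not_less)
  have ev_lo: "x \<notin> slope_gt a b (\<lambda>x. - f x) (- r) \<longleftrightarrow> (\<forall>\<^sub>F y in at x. r \<le> q y)" for r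
  proof -
    have "(- r < (- f y - - f x) / (y - x)) = (q y < r)" for y using q'[of y] by linarith
    then have "(\<exists>\<^sub>F y in at x. - r < (- f y - - f x) / (y - x)) \<longleftrightarrow> (\<exists>\<^sub>F y in at x. q y < r)" by presburger
    then show ?thesis using x by (simp add: slope_gt_def not_frequently not_less)
  qed
  define B where "B = {r. \<forall>\<^sub>F y in at x. r \<le> q y}"
  have BU: "r \<le> U" if "r \<in> B" for r
  proof -
    have "\<forall>\<^sub>F y in at x. r \<le> q y \<and> q y \<le> U" using that up unfolding ev_up B_def by (auto intro: eventually_conj)
    then have "\<exists>y. r \<le> q y \<and> q y \<le> U" by (rule eventually_happens'[rotated]) simp
    then obtain y where "r \<le> q y \<and> q y \<le> U" by blast
    then show ?thesis by linarith
  qed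
  have Bne: "- L \<in> B" using lo ev_lo[of "-L"] by (simp add: B_def)
  have bdd: "bdd_above B" using BU by (rule bdd_aboveI)
  define l where "l = Sup B"
  have "(q \<longlongrightarrow> l) (at x)"
  proof (rule order_tendstoI)
    fix c assume "c < l"
    then obtain r where "r \<in> B" "c < r" unfolding l_def using less_cSup_iff[of B c] Bne bdd by blast
    then show "\<forall>\<^sub>F y in at x. c < q y" unfolding B_def by (auto elim!: eventually_mono)
  next
    fix c assume c: "l < c"
    obtain r where r: "r \<in> \<rat>" "l < r" "r < c" using Rats_dense_in_real[OF c] by blast
    obtain R where R: "R \<in> \<rat>" "r < R" "R < c" using Rats_dense_in_real[OF r(3)] by blast
    have "r \<notin> B" using r bdd cSup_upper[of r B] unfolding l_def by force
    then have "x \<in> slope_gt a b (\<lambda>x. - f x) (- r)" using ev_lo[of r] by (auto simp: B_def)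
    then have "x \<notin> slope_gt a b f R" using gap[OF r(1) R(1,2)] by blast
    then have "\<forall>\<^sub>F y in at x. q y \<le> R" using ev_up by blast
    then show "\<forall>\<^sub>F y in at x. q y < c" using R by (auto elim!: eventually_mono)
  qed
  then have "(f has_field_derivative l) (at x)" unfolding has_field_derivative_iff q_def .
  then show ?thesis using field_differentiable_def field_differentiable_imp_differentiable by blast
qed

proposition abs_cont_on_differentiable_real:
  fixes f :: "real \<Rightarrow> real"
  assumes ac: "abs_cont_on a b f"
  shows "negligible {x \<in> {a<..<b}. \<not> f differentiable (at x)}"
proof -
  have ac': "abs_cont_on a b (\<lambda>x. - f x)"
    by (rule abs_cont_on_dominated[OF ac ac, of 1]) (auto simp: abs_minus_commute)
  define N where "N = {x. \<forall>n::nat. x \<in> slope_gt a b f (real n)} \<union> {x. \<forall>n::nat. x \<in> slope_gt a b (\<lambda>x. - f x) (real n)}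
    \<union> (\<Union>i\<in>{(r,R). r \<in> \<rat> \<and> R \<in> \<rat> \<and> r < R}. slope_gt a b f (snd i) \<inter> slope_gt a b (\<lambda>x. - f x) (- fst i))"
  have "countable {(r,R). r \<in> \<rat> \<and> R \<in> \<rat> \<and> r < (R::real)}"
    by (rule countable_subset[of _ "\<rat> \<times> \<rat>"]) (auto intro: countable_rat)
  then have "negligible N" unfolding N_def
    using negligible_slope_unbounded[OF ac] negligible_slope_unbounded[OF ac'] negligible_slope_gap[OF ac]
    by (intro negligible_Un negligible_countable_Union) auto
  moreover have "{x \<in> {a<..<b}. \<not> f differentiable (at x)} \<subseteq> N"
  proof (rule subsetI, rule ccontr)
    fix x assume x: "x \<in> {x \<in> {a<..<b}. \<not> f differentiable (at x)}" and n: "x \<notin> N"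
    obtain m n where "x \<notin> slope_gt a b f (real m)" "x \<notin> slope_gt a b (\<lambda>x. - f x) (real n)"
      using n unfolding N_def by blast
    then have "f differentiable (at x)"
      by (rule slope_converges[rotated]) (use x n in \<open>auto simp: N_def\<close>)
    then show False using x by blast
  qed
  ultimately show ?thesis by (rule negligible_subset)
qed

proposition abs_cont_on_differentiable:
  fixes f :: "real \<Rightarrow> 'a::euclidean_space"
  assumes ac: "abs_cont_on a b f"
  shows "negligible {x \<in> {a<..<b}. \<not> f differentiable (at x)}"
proof -
  have "abs_cont_on a b (\<lambda>x. f x \<bullet> i)" if "i \<in> Basis" for i
    by (rule abs_cont_on_dominated[OF ac ac, of 1])
       (use that in \<open>auto simp: inner_diff_left[symmetric] intro: order_trans[OF Basis_le_norm]\<close>)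
  then have "negligible (\<Union>i\<in>Basis. {x \<in> {a<..<b}. \<not> (\<lambda>x. f x \<bullet> i) differentiable (at x)})"
    using abs_cont_on_differentiable_real by (intro negligible_Union finite_imageI finite_Basis) blast
  then show ?thesis
    by (rule negligible_subset) (auto simp: differentiable_componentwise_within[of f])
qed

text \<open>The gauge treats the points of \<open>N\<close> separately: elsewhere differentiability
  controls each Riemann term, while intervals tagged in \<open>N\<close> lie in an open set of
  measure below the modulus \<open>d\<close>, so absolute continuity makes their increments small.
  Integrability of \<open>g\<close> comes out together with the value of the integral.\<close>

proposition abs_cont_on_has_integral_derivative:
  fixes f :: "real \<Rightarrow> 'a::euclidean_space"
  assumes ac: "abs_cont_on a b f" and ab: "a \<le> b" and N: "negligible N"
    and der: "\<And>x. x \<in> {a..b} - N \<Longrightarrow> (f has_vector_derivative g x) (at x within {a..b})"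
  shows "(g has_integral (f b - f a)) {a..b}"
proof -
  define g' where "g' x = (if x \<in> N then 0 else g x)" for x
  have "(g' has_integral (f b - f a)) (cbox a b)"
    unfolding has_integral[of g']
  proof (intro allI impI)
    fix e :: real assume e: "e > 0"
    define e1 where "e1 = e / (2 * (b - a + 1))"
    have e1: "e1 > 0" "e1 * (b - a) < e / 2" using e ab by (auto simp: e1_def field_simps)
    obtain d where d: "ac_modulus a b f (e/2) d" using ac e unfolding abs_cont_on_iff by (meson half_gt_zero)
    have "N \<in> sets lebesgue" using N negligible_imp_sets by blast
    then obtain U where U: "open U" "N \<subseteq> U" "U - N \<in> lmeasurable" "emeasure lebesgue (U - N) < ennreal d"
      using sets_lebesgue_outer_open ac_modulus_pos[OF d] by metis
    have U1: "U \<in> lmeasurable" using U N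
      by (metis borel_open measurable_Diff_null_set negligible_iff_null_sets sets_completionI_sets sets_lborel)
    have U2: "measure lebesgue U < d"
      using U N by (metis emeasure_eq_measure2 ennreal_leI measure_Diff_null_set negligible_iff_null_sets not_less sets_completionI_sets sets_lborel borel_open)
    have "\<exists>s>0. x \<in> {a..b} \<longrightarrow> (if x \<in> N then ball x s \<subseteq> U else
        (\<forall>y\<in>{a..b}. \<bar>y - x\<bar> < s \<longrightarrow> norm (f y - f x - (y - x) *\<^sub>R g x) \<le> e1 * \<bar>y - x\<bar>))" for x
    proof (cases "x \<in> {a..b} - N")
      case True
      from der[OF this] e1(1) show ?thesis using True
        unfolding has_vector_derivative_def has_derivative_within_alt by simp
    next
      case False
      show ?thesis
      proof (cases "x \<in> N")
        case True
        then obtain s where "s > 0" "ball x s \<subseteq> U" using U open_contains_ball by blast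
        then show ?thesis using True by auto
      next
        case F: False
        then show ?thesis using False by (intro exI[of _ 1]) auto
      qed
    qed
    then obtain s where s: "\<And>x. s x > 0" "\<And>x. x \<in> {a..b} \<Longrightarrow> x \<in> N \<Longrightarrow> ball x (s x) \<subseteq> U"
       "\<And>x y. x \<in> {a..b} \<Longrightarrow> x \<notin> N \<Longrightarrow> y \<in> {a..b} \<Longrightarrow> \<bar>y - x\<bar> < s x \<Longrightarrow> norm (f y - f x - (y - x) *\<^sub>R g x) \<le> e1 * \<bar>y - x\<bar>"
      by metis
    show "\<exists>\<gamma>. gauge \<gamma> \<and> (\<forall>\<D>. \<D> tagged_division_of cbox a b \<and> \<gamma> fine \<D> \<longrightarrow>
        norm ((\<Sum>(x, K)\<in>\<D>. measure lborel K *\<^sub>R g' x) - (f b - f a)) < e)"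
    proof (intro exI conjI allI impI)
      show "gauge (\<lambda>x. ball x (s x))" using s(1) by (simp add: gauge_def)
      fix p assume "p tagged_division_of cbox a b \<and> (\<lambda>x. ball x (s x)) fine p"
      then have p: "p tagged_division_of {a..b}" and fine: "\<And>x K. (x,K) \<in> p \<Longrightarrow> K \<subseteq> ball x (s x)"
        by (auto simp: fine_def box_real)
      have finp: "finite p" using p by auto
      have pK: "\<exists>u v. K = {u..v} \<and> a \<le> u \<and> u \<le> x \<and> x \<le> v \<and> v \<le> b" if "(x,K) \<in> p" for x K
        using tagged_division_ofD(2-4)[OF p that] by (force simp: box_real)
      define I where "I = {i\<in>p. fst i \<in> N}"
      have fI: "finite I" using finp by (auto simp: I_def)
      define q where "q i = f (Sup (snd i)) - f (Inf (snd i))" for i :: "real \<times> real set"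
      have dis: "{Inf (snd i)<..<Sup (snd i)} \<inter> {Inf (snd j)<..<Sup (snd j)} = {}" if ij: "i \<in> p" "j \<in> p" "i \<noteq> j" for i j
      proof -
        obtain x K y L where e: "i = (x,K)" "j = (y,L)" by (metis surj_pair)
        have "interior K \<inter> interior L = {}" using tagged_division_ofD(5)[OF p] ij e by blast
        then show ?thesis using pK[of x K] pK[of y L] ij e by auto
      qed
      have sN: "(\<Sum>i\<in>I. norm (q i)) < e/2"
        unfolding q_def
      proof (rule ac_modulus_sum[OF d fI])
        fix i assume "i \<in> I"
        then show "a \<le> Inf (snd i) \<and> Inf (snd i) \<le> Sup (snd i) \<and> Sup (snd i) \<le> b"
          using pK[of "fst i" "snd i"] by (auto simp: I_def)
      next
        have "(\<Sum>i\<in>I. Sup (snd i) - Inf (snd i)) = (\<Sum>i\<in>I. measure lebesgue {Inf (snd i)<..<Sup (snd i)})"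
        proof (rule sum.cong)
          fix i assume "i \<in> I"
          then show "Sup (snd i) - Inf (snd i) = measure lebesgue {Inf (snd i)<..<Sup (snd i)}"
            using pK[of "fst i" "snd i"] by (auto simp: I_def measure_completion)
        qed auto
        also have "\<dots> = measure lebesgue (\<Union>i\<in>I. {Inf (snd i)<..<Sup (snd i)})"
        proof (rule measure_finite_Union[symmetric])
          show "disjoint_family_on (\<lambda>i. {Inf (snd i)<..<Sup (snd i)}) I"
            using dis unfolding disjoint_family_on_def I_def by blast
          show "emeasure lebesgue {Inf (snd i)<..<Sup (snd i)} \<noteq> \<infinity>" for i :: "real \<times> real set"
            using fmeasurableD2[OF lmeasurable_box[of "Inf (snd i)" "Sup (snd i)"]] by (simp add: box_real)
        qed (use fI in auto)
        also have "\<dots> \<le> measure lebesgue U"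
        proof (rule measure_mono_fmeasurable)
          show "(\<Union>i\<in>I. {Inf (snd i)<..<Sup (snd i)}) \<subseteq> U"
          proof (rule UN_least)
            fix i assume i: "i \<in> I"
            then obtain u v where uv: "snd i = {u..v}" "a \<le> u" "u \<le> fst i" "fst i \<le> v" "v \<le> b"
              using pK[of "fst i" "snd i"] by (auto simp: I_def)
            have "snd i \<subseteq> ball (fst i) (s (fst i))" using fine[of "fst i" "snd i"] i by (auto simp: I_def)
            also have "\<dots> \<subseteq> U" using s(2)[of "fst i"] i uv by (auto simp: I_def)
            finally show "{Inf (snd i)<..<Sup (snd i)} \<subseteq> U" using uv by auto
          qed
        qed (use U1 fI in auto)
        finally show "(\<Sum>i\<in>I. Sup (snd i) - Inf (snd i)) < d" using U2 by simp
      qed (use dis in \<open>auto simp: I_def\<close>)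
      \<comment> \<open>The tag lies in the interval, so the first-order errors at its two endpoints
        add up to \<open>e1\<close> times its length.\<close>
      have sO: "norm (measure lborel K *\<^sub>R g' x - q (x,K)) \<le> e1 * measure lborel K" if xK: "(x,K) \<in> p - I" for x K
      proof -
        obtain u v where uv: "K = {u..v}" "a \<le> u" "u \<le> x" "x \<le> v" "v \<le> b"
          using pK[of x K] xK by auto
        have x: "x \<notin> N" "x \<in> {a..b}" using xK uv by (auto simp: I_def)
        have "u \<in> ball x (s x)" "v \<in> ball x (s x)" using fine[of x K] xK uv by (auto simp: subset_iff)
        then have 1: "norm (f v - f x - (v - x) *\<^sub>R g x) \<le> e1 * (v - x)" "norm (f u - f x - (u - x) *\<^sub>R g x) \<le> e1 * (x - u)"
          using s(3)[OF x(2,1), of v] s(3)[OF x(2,1), of u] uv by (auto simp: dist_real_def abs_minus_commute)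
        have "measure lborel K *\<^sub>R g' x - q (x,K) = (f u - f x - (u - x) *\<^sub>R g x) - (f v - f x - (v - x) *\<^sub>R g x)"
          using uv x by (simp add: q_def g'_def algebra_simps)
        then have "norm (measure lborel K *\<^sub>R g' x - q (x,K)) \<le> norm (f u - f x - (u - x) *\<^sub>R g x) + norm (f v - f x - (v - x) *\<^sub>R g x)"
          by (metis norm_triangle_ineq4)
        also have "\<dots> \<le> e1 * (v - u)" using 1 by (simp add: algebra_simps)
        finally show ?thesis using uv by simp
      qed
      have "(\<Sum>(x, K)\<in>p. measure lborel K *\<^sub>R g' x) - (f b - f a) = (\<Sum>i\<in>p. measure lborel (snd i) *\<^sub>R g' (fst i) - q i)"
        using additive_tagged_division_1[OF ab p, of f] by (simp add: sum_subtractf q_def case_prod_beta)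
      also have "\<dots> = (\<Sum>i\<in>p - I. measure lborel (snd i) *\<^sub>R g' (fst i) - q i) + (\<Sum>i\<in>I. - q i)"
      proof -
        have "(\<Sum>i\<in>I. measure lborel (snd i) *\<^sub>R g' (fst i) - q i) = (\<Sum>i\<in>I. - q i)"
          by (rule sum.cong) (auto simp: I_def g'_def)
        then show ?thesis using sum.subset_diff[OF _ finp, of I "\<lambda>i. measure lborel (snd i) *\<^sub>R g' (fst i) - q i"]
          by (auto simp: I_def)
      qed
      finally have eq: "(\<Sum>(x, K)\<in>p. measure lborel K *\<^sub>R g' x) - (f b - f a) =
          (\<Sum>i\<in>p - I. measure lborel (snd i) *\<^sub>R g' (fst i) - q i) + (\<Sum>i\<in>I. - q i)" .
      have b1: "norm (\<Sum>i\<in>I. - q i) \<le> (\<Sum>i\<in>I. norm (q i))" by (rule sum_norm_le) auto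
      have "norm (\<Sum>i\<in>p - I. measure lborel (snd i) *\<^sub>R g' (fst i) - q i) \<le> (\<Sum>i\<in>p - I. e1 * measure lborel (snd i))"
      proof (rule sum_norm_le)
        fix i assume "i \<in> p - I"
        then show "norm (measure lborel (snd i) *\<^sub>R g' (fst i) - q i) \<le> e1 * measure lborel (snd i)"
          using sO[of "fst i" "snd i"] by simp
      qed
      also have "\<dots> \<le> (\<Sum>i\<in>p. e1 * measure lborel (snd i))"
        by (rule sum_mono2) (use finp e1 in auto)
      also have "\<dots> = e1 * (b - a)"
        using additive_content_tagged_division[of p a b] p ab
        by (simp add: sum_distrib_left[symmetric] case_prod_beta box_real)
      finally have b2: "norm (\<Sum>i\<in>p - I. measure lborel (snd i) *\<^sub>R g' (fst i) - q i) \<le> e1 * (b - a)" .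
      show "norm ((\<Sum>(x, K)\<in>p. measure lborel K *\<^sub>R g' x) - (f b - f a)) < e"
        unfolding eq using norm_triangle_ineq[of "\<Sum>i\<in>p - I. measure lborel (snd i) *\<^sub>R g' (fst i) - q i" "\<Sum>i\<in>I. - q i"]
          b1 b2 sN e1(2) by linarith
    qed
  qed
  then show ?thesis
    unfolding box_real by (rule has_integral_spike[OF N, rotated]) (auto simp: g'_def)
qed

section \<open>Optimality classes and potential zones\<close>

text \<open>Expanding the square gives |x - y|^2 = |x|^2 - 2 \<open>aff y x\<close>: nearest sites
  are the maximizers of these affine functions, and their envelope \<open>gK\<close> differs from
  \<open>fK\<close> by |x|^2 / 2.\<close>

definition aff :: "'a::euclidean_space \<Rightarrow> 'a \<Rightarrow> real" where
  "aff y x = x \<bullet> y - (norm y)\<^sup>2 / 2"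

definition gK :: "'a::euclidean_space set \<Rightarrow> 'a \<Rightarrow> real" where
  "gK K x = Max ((\<lambda>y. aff y x) ` K)"

text \<open>The part of \<open>A\<close> exposed by the direction \<open>v\<close>. For
  \<open>A = opt K x\<close> it is the optimality class found just beyond \<open>x\<close> in
  direction \<open>v\<close>.\<close>

definition amax :: "'a::euclidean_space set \<Rightarrow> 'a \<Rightarrow> 'a set" where
  "amax A v = {a \<in> A. \<forall>b\<in>A. v \<bullet> b \<le> v \<bullet> a}"

lemma aff_add: "aff y (x + v) = aff y x + v \<bullet> y"
  by (simp add: aff_def inner_add_left)

lemma dist_sq_aff: "(dist x y)\<^sup>2 = (norm x)\<^sup>2 - 2 * aff y x"
  by (simp add: dist_norm power2_norm_eq_inner aff_def inner_diff_left inner_diff_right inner_commute)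

lemma dist_le_iff_aff: "dist x y \<le> dist x z \<longleftrightarrow> aff z x \<le> aff y x"
proof -
  have "dist x y \<le> dist x z \<longleftrightarrow> (dist x y)\<^sup>2 \<le> (dist x z)\<^sup>2"
    by (metis abs_le_square_iff abs_of_nonneg zero_le_dist)
  then show ?thesis by (simp add: dist_sq_aff)
qed

lemma amax_scale: "c > 0 \<Longrightarrow> amax A (c *\<^sub>R v) = amax A v"
  by (auto simp: amax_def)

lemma amax_subset: "amax A v \<subseteq> A"
  by (auto simp: amax_def)

lemma amax_nonempty:
  assumes "finite A" "A \<noteq> {}"
  shows "amax A v \<noteq> {}"
proof -
  have "Max ((\<lambda>a. v \<bullet> a) ` A) \<in> (\<lambda>a. v \<bullet> a) ` A" using assms by (intro Max_in) auto
  then obtain a where a: "a \<in> A" "Max ((\<lambda>a. v \<bullet> a) ` A) = v \<bullet> a" by blast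
  have "v \<bullet> b \<le> v \<bullet> a" if "b \<in> A" for b using assms that unfolding a(2)[symmetric] by simp
  then have "a \<in> amax A v" using a by (simp add: amax_def)
  then show ?thesis by blast
qed

text \<open>A maximizer for \<open>v\<close> beats each of the finitely many nonmaximizers strictly,
  and strict inequalities persist for nearby directions.\<close>

lemma amax_usc:
  assumes "finite A" "A \<noteq> {}"
  shows "\<forall>\<^sub>F w in nhds v. amax A w \<subseteq> amax A v"
proof -
  obtain a where a: "a \<in> amax A v" using amax_nonempty[OF assms] by blast
  have "\<forall>\<^sub>F w in nhds v. \<forall>b\<in>A - amax A v. w \<bullet> b < w \<bullet> a"
  proof (rule eventually_ball_finite)
    show "\<forall>b\<in>A - amax A v. \<forall>\<^sub>F w in nhds v. w \<bullet> b < w \<bullet> a"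
    proof
      fix b assume b: "b \<in> A - amax A v"
      then obtain c where c: "c \<in> A" "v \<bullet> b < v \<bullet> c" by (auto simp: amax_def not_le)
      then have "v \<bullet> b < v \<bullet> a" using a by (fastforce simp: amax_def)
      moreover have "((\<lambda>w. w \<bullet> a - w \<bullet> b) \<longlongrightarrow> v \<bullet> a - v \<bullet> b) (nhds v)"
        by (intro tendsto_intros filterlim_ident)
      ultimately have "\<forall>\<^sub>F w in nhds v. 0 < w \<bullet> a - w \<bullet> b"
        by (intro order_tendstoD(1)) auto
      then show "\<forall>\<^sub>F w in nhds v. w \<bullet> b < w \<bullet> a" by (auto elim!: eventually_mono)
    qed
  qed (use assms in auto)
  then show ?thesis
  proof (rule eventually_mono)
    fix w assume *: "\<forall>b\<in>A - amax A v. w \<bullet> b < w \<bullet> a"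
    show "amax A w \<subseteq> amax A v"
    proof
      fix b assume b: "b \<in> amax A w"
      have "a \<in> A" using a amax_subset by blast
      then have "w \<bullet> a \<le> w \<bullet> b" "b \<in> A" using b by (auto simp: amax_def)
      then show "b \<in> amax A v" using * by (meson DiffI not_le)
    qed
  qed
qed

section \<open>Subgradients of the envelope, optimality classes and phases\<close>

locale sites =
  fixes K :: "'a::euclidean_space set"
  assumes finK: "finite K" and neK: "K \<noteq> {}"
begin

lemma opt_iff: "y \<in> opt K x \<longleftrightarrow> y \<in> K \<and> (\<forall>z\<in>K. aff z x \<le> aff y x)"
proof -
  have "dist x y = distK K x \<longleftrightarrow> (\<forall>z\<in>K. dist x y \<le> dist x z)" if "y \<in> K"
  proof -
    have le: "distK K x \<le> dist x z" if "z \<in> K" for z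
      unfolding distK_def using finK that by simp
    have "distK K x \<in> (\<lambda>y. dist x y) ` K"
      unfolding distK_def using finK neK by (intro Min_in) auto
    then obtain z where "z \<in> K" "distK K x = dist x z" by blast
    then show ?thesis using le that by force
  qed
  then show ?thesis unfolding opt_def by (auto simp: dist_le_iff_aff)
qed

lemma opt_subset: "opt K x \<subseteq> K" by (auto simp: opt_def)

lemma finite_opt: "finite (opt K x)" using finK opt_subset finite_subset by blast

lemma gK_ge: "y \<in> K \<Longrightarrow> aff y x \<le> gK K x"
  unfolding gK_def using finK by simp

lemma opt_gK: "y \<in> opt K x \<longleftrightarrow> y \<in> K \<and> aff y x = gK K x"
proof -
  have "gK K x \<in> (\<lambda>y. aff y x) ` K" unfolding gK_def using finK neK by (intro Max_in) auto
  then obtain z where z: "z \<in> K" "gK K x = aff z x" by blast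
  then show ?thesis unfolding opt_iff using gK_ge by (metis order_antisym_conv)
qed

lemma opt_nonempty: "opt K x \<noteq> {}"
proof -
  have "gK K x \<in> (\<lambda>y. aff y x) ` K" unfolding gK_def using finK neK by (intro Max_in) auto
  then show ?thesis using opt_gK by fastforce
qed

lemma fK_gK: "fK K x = gK K x - (norm x)\<^sup>2 / 2"
proof -
  obtain y where y: "y \<in> opt K x" using opt_nonempty by blast
  then have "distK K x = dist x y" by (auto simp: opt_def)
  then have "(distK K x)\<^sup>2 = (norm x)\<^sup>2 - 2 * gK K x" using y by (simp add: dist_sq_aff opt_gK)
  then show ?thesis by (simp add: fK_def field_simps)
qed

abbreviation hull_opt :: "'a \<Rightarrow> 'a set" where "hull_opt x \<equiv> convex hull (opt K x)"

lemma hull_opt_props: "closed (hull_opt x)" "convex (hull_opt x)" "hull_opt x \<noteq> {}" "hull_opt x \<subseteq> convex hull K"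
proof -
  show "closed (hull_opt x)" by (simp add: finite_opt finite_imp_compact_convex_hull compact_imp_closed)
  show "hull_opt x \<subseteq> convex hull K" by (intro hull_mono opt_subset)
qed (use opt_nonempty in auto)

text \<open>Active sites are subgradients, and subgradients form a convex set. Conversely, if
  \<open>e\<close> lies outside the hull, move a little along \<open>v\<close>, from its projection
  towards \<open>e\<close>: the tangent plane of slope \<open>e\<close> rises faster than every
  active function, and the inactive ones are still lower by continuity, which violates the
  subgradient inequality.\<close>

lemma hull_opt_iff: "e \<in> hull_opt x \<longleftrightarrow> (\<forall>y. gK K x + e \<bullet> (y - x) \<le> gK K y)"
proof
  assume e: "e \<in> hull_opt x"
  let ?S = "{e. \<forall>y. gK K x + e \<bullet> (y - x) \<le> gK K y}"
  have "hull_opt x \<subseteq> ?S"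
  proof (rule hull_minimal)
    show "opt K x \<subseteq> ?S"
    proof clarify
      fix b y assume b: "b \<in> opt K x"
      then have "gK K x + b \<bullet> (y - x) = aff b x + b \<bullet> (y - x)" by (simp add: opt_gK)
      also have "\<dots> = aff b y" using aff_add[of b x "y - x"] by (simp add: inner_commute)
      also have "\<dots> \<le> gK K y" using b by (intro gK_ge) (simp add: opt_gK)
      finally show "gK K x + b \<bullet> (y - x) \<le> gK K y" .
    qed
    have "?S = (\<Inter>y. {e. (y - x) \<bullet> e \<le> gK K y - gK K x})" by (auto simp: inner_commute algebra_simps)
    then show "convex ?S" by (simp only:) (intro convex_INT convex_halfspace_le)
  qed
  then show "\<forall>y. gK K x + e \<bullet> (y - x) \<le> gK K y" using e by blast
next
  assume e: "\<forall>y. gK K x + e \<bullet> (y - x) \<le> gK K y"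
  show "e \<in> hull_opt x"
  proof (rule ccontr)
    assume ne: "e \<notin> hull_opt x"
    define c where "c = closest_point (hull_opt x) e"
    define v where "v = e - c"
    have c: "c \<in> hull_opt x" unfolding c_def by (intro closest_point_in_set hull_opt_props)
    have v0: "v \<noteq> 0" using c ne by (auto simp: v_def)
    have sep: "v \<bullet> b < v \<bullet> e" if "b \<in> opt K x" for b
    proof -
      have "b \<in> hull_opt x" using that by (simp add: hull_inc)
      then have "(e - c) \<bullet> (b - c) \<le> 0" unfolding c_def
        using hull_opt_props by (intro closest_point_dot) auto
      moreover have "v \<bullet> v > 0" using v0 by simp
      ultimately show ?thesis by (simp add: v_def inner_diff_right)
    qed
    have "\<forall>\<^sub>F t in at_right 0. \<forall>y\<in>K. aff y (x + t *\<^sub>R v) < gK K x + t * (v \<bullet> e)"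
    proof (rule eventually_ball_finite[OF finK], rule ballI)
      fix y assume y: "y \<in> K"
      show "\<forall>\<^sub>F t in at_right 0. aff y (x + t *\<^sub>R v) < gK K x + t * (v \<bullet> e)"
      proof (cases "y \<in> opt K x")
        case True
        then show ?thesis using sep[OF True] opt_gK
          by (auto simp: eventually_at_filter aff_add mult_strict_left_mono)
      next
        case False
        then have lt: "aff y x < gK K x" using y gK_ge[OF y, of x] opt_gK by force
        have "((\<lambda>t. gK K x + t * (v \<bullet> e) - aff y (x + t *\<^sub>R v)) \<longlongrightarrow> gK K x + 0 * (v \<bullet> e) - aff y x) (at_right 0)"
          unfolding aff_add by (auto intro!: tendsto_eq_intros)
        then have "\<forall>\<^sub>F t in at_right 0. 0 < gK K x + t * (v \<bullet> e) - aff y (x + t *\<^sub>R v)"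
          using lt by (intro order_tendstoD(1)) auto
        then show ?thesis by (auto elim!: eventually_mono)
      qed
    qed
    then obtain t where t: "\<forall>y\<in>K. aff y (x + t *\<^sub>R v) < gK K x + t * (v \<bullet> e)"
      using eventually_happens'[OF trivial_limit_at_right_real] by blast
    obtain y where "y \<in> opt K (x + t *\<^sub>R v)" using opt_nonempty by blast
    then have "gK K (x + t *\<^sub>R v) < gK K x + t * (v \<bullet> e)" using t opt_gK by force
    moreover have "gK K x + e \<bullet> (t *\<^sub>R v) \<le> gK K (x + t *\<^sub>R v)" using e[rule_format, of "x + t *\<^sub>R v"] by simp
    ultimately show False by (simp add: inner_commute)
  qed
qed

text \<open>Adding |x|^2 / 2 turns the semiconvex inequality for \<open>fK\<close> into the ordinary
  subgradient inequality for \<open>gK\<close>, with \<open>\<xi>\<close> translated by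
  \<open>x\<close>.\<close>

lemma subdiffK_eq: "subdiffK K x = (\<lambda>e. e - x) ` hull_opt x"
proof -
  have "\<xi> \<in> subdiffK K x \<longleftrightarrow> \<xi> + x \<in> hull_opt x" for \<xi>
  proof -
    have "(fK K x + \<xi> \<bullet> (y - x) - (1/2) * (norm (y - x))\<^sup>2 \<le> fK K y) \<longleftrightarrow> (gK K x + (\<xi> + x) \<bullet> (y - x) \<le> gK K y)" for y
    proof -
      have "(norm y)\<^sup>2 - (norm x)\<^sup>2 - (norm (y - x))\<^sup>2 = 2 * (x \<bullet> (y - x))"
        by (simp add: power2_norm_eq_inner inner_diff_left inner_diff_right inner_commute)
      then show ?thesis unfolding fK_gK by (simp add: inner_add_left) linarith
    qed
    then show ?thesis unfolding subdiffK_def hull_opt_iff by simp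
  qed
  then have "subdiffK K x = {\<xi>. \<xi> + x \<in> hull_opt x}" by blast
  also have "\<dots> = (\<lambda>e. e - x) ` hull_opt x"
    by (force simp: image_iff)
  finally show ?thesis .
qed

lemma eta_in_hull: "etaK K x \<in> hull_opt x"
  unfolding etaK_def by (intro closest_point_in_set hull_opt_props)

lemma eta_le: "e \<in> hull_opt x \<Longrightarrow> norm (x - etaK K x) \<le> norm (x - e)"
  unfolding etaK_def using closest_point_le[of "hull_opt x" e x] hull_opt_props by (simp add: dist_norm)

lemma eta_unique:
  assumes "e \<in> hull_opt x" "\<And>z. z \<in> hull_opt x \<Longrightarrow> norm (x - e) \<le> norm (x - z)"
  shows "etaK K x = e"
  unfolding etaK_def using assms hull_opt_props
  by (intro closest_point_unique[symmetric]) (auto simp: dist_norm)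

lemma ext_grad_eq: "ext_grad K x = etaK K x - x"
proof -
  have "etaK K x - x = closest_point (subdiffK K x) 0"
  proof (rule closest_point_unique)
    show "convex (subdiffK K x)" "closed (subdiffK K x)"
      unfolding subdiffK_eq using hull_opt_props(1,2)[of x]
      by (simp_all add: closed_translation_subtract)
    show "etaK K x - x \<in> subdiffK K x" unfolding subdiffK_eq using eta_in_hull by blast
    show "\<forall>z\<in>subdiffK K x. dist 0 (etaK K x - x) \<le> dist 0 z"
      unfolding subdiffK_eq using eta_le by (auto simp: dist_norm norm_minus_commute)
  qed
  then show ?thesis by (simp add: ext_grad_def)
qed

lemma hull_orth:
  assumes v: "\<And>a b. a \<in> A \<Longrightarrow> b \<in> A \<Longrightarrow> v \<bullet> a = v \<bullet> b"
    and "w \<in> convex hull A" "z \<in> convex hull A"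
  shows "v \<bullet> w = v \<bullet> z"
proof (cases "A = {}")
  case False
  then obtain a where a: "a \<in> A" by blast
  have "convex hull A \<subseteq> {x. v \<bullet> x = v \<bullet> a}"
    by (rule hull_minimal) (use v[OF _ a] in \<open>auto simp: convex_hyperplane\<close>)
  then have "v \<bullet> w = v \<bullet> a" "v \<bullet> z = v \<bullet> a" using assms by blast+
  then show ?thesis by simp
qed (use assms in auto)

text \<open>The inner product with \<open>v\<close> is constant on the hull, so a shift by
  \<open>v\<close> changes the squared distance to all its points by the same amount.\<close>

lemma closest_shift:
  assumes v: "\<And>a b. a \<in> A \<Longrightarrow> b \<in> A \<Longrightarrow> v \<bullet> a = v \<bullet> b"
    and w: "w \<in> convex hull A" and z: "z \<in> convex hull A"
    and le: "norm (x - z) \<le> norm (x - w)"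
  shows "norm (x + v - z) \<le> norm (x + v - w)"
proof -
  have "v \<bullet> w = v \<bullet> z" using hull_orth[OF v w z] .
  moreover have "(norm (x + v - p))\<^sup>2 = (norm (x - p))\<^sup>2 + 2 * (v \<bullet> x) - 2 * (v \<bullet> p) + (norm v)\<^sup>2" for p
    by (simp add: power2_norm_eq_inner inner_diff_left inner_diff_right inner_add_left inner_add_right inner_commute)
  moreover have "(norm (x - z))\<^sup>2 \<le> (norm (x - w))\<^sup>2" using le by (simp add: power_mono)
  ultimately have "(norm (x + v - z))\<^sup>2 \<le> (norm (x + v - w))\<^sup>2" by simp
  then show ?thesis by (rule power2_le_imp_le) simp
qed

text \<open>The affine functions of two sites in the common class agree at \<open>x\<close> and at
  \<open>y\<close>, so \<open>x - y\<close> is orthogonal to the differences of these sites and does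
  not affect the projection onto their hull. Thus \<open>etaK\<close> depends on the optimality
  class only, and there are finitely many of these.\<close>

lemma eta_cong:
  assumes "opt K x = opt K y"
  shows "etaK K x = etaK K y"
proof -
  define v where "v = x - y"
  have v: "v \<bullet> a = v \<bullet> b" if "a \<in> opt K x" "b \<in> opt K x" for a b
  proof -
    have "aff a x = aff b x" "aff a y = aff b y" using that opt_gK[of _ x] opt_gK[of _ y] unfolding assms by metis+
    then show ?thesis by (simp add: aff_def v_def inner_diff_left)
  qed
  have "norm (y + v - etaK K y) \<le> norm (y + v - z)" if "z \<in> hull_opt x" for z
  proof (rule closest_shift[OF v that])
    show "etaK K y \<in> hull_opt x" using eta_in_hull[of y] assms by simp
    show "norm (y - etaK K y) \<le> norm (y - z)" using that assms by (intro eta_le) simp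
  qed
  then show ?thesis using eta_in_hull[of y] assms by (intro eta_unique) (auto simp: v_def)
qed

lemma finite_calE: "finite (calE K)"
proof -
  have "range (etaK K) \<subseteq> (\<lambda>B. etaK K (SOME x. opt K x = B)) ` Pow K"
  proof clarify
    fix x
    have "opt K (SOME z. opt K z = opt K x) = opt K x" by (rule someI) simp
    then have "etaK K x = etaK K (SOME z. opt K z = opt K x)" by (intro eta_cong) simp
    then show "etaK K x \<in> (\<lambda>B. etaK K (SOME x. opt K x = B)) ` Pow K" using opt_subset by blast
  qed
  then show ?thesis unfolding calE_def using finK finite_subset by blast
qed

text \<open>The points at which \<open>e\<close> is a subgradient of \<open>gK K\<close>.\<close>

definition phase :: "'a \<Rightarrow> 'a set" where
  "phase e = {x. e \<in> hull_opt x}"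

text \<open>Once \<open>gK K x\<close> is written as a maximum over \<open>z\<close>, every instance
  of the subgradient inequality becomes affine in \<open>x\<close>. Closedness and convexity of
  \<open>phase e\<close> are read off from this.\<close>

lemma phase_halfspaces: "phase e = (\<Inter>y. \<Inter>z\<in>K. {x. (z - e) \<bullet> x \<le> gK K y - e \<bullet> y + (norm z)\<^sup>2 / 2})"
proof -
  have "e \<in> hull_opt x \<longleftrightarrow> (\<forall>y. \<forall>z\<in>K. (z - e) \<bullet> x \<le> gK K y - e \<bullet> y + (norm z)\<^sup>2 / 2)" for x
  proof -
    obtain b where b: "b \<in> opt K x" using opt_nonempty by blast
    have "(gK K x + e \<bullet> (y - x) \<le> gK K y) \<longleftrightarrow> (\<forall>z\<in>K. aff z x + e \<bullet> (y - x) \<le> gK K y)" for y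
      using b gK_ge[of _ x] opt_gK by (smt (verit))
    moreover have "aff z x + e \<bullet> (y - x) \<le> gK K y \<longleftrightarrow> (z - e) \<bullet> x \<le> gK K y - e \<bullet> y + (norm z)\<^sup>2 / 2" for y z
      by (simp add: aff_def inner_diff_left inner_diff_right inner_commute) linarith
    ultimately show ?thesis unfolding hull_opt_iff by simp
  qed
  then show ?thesis unfolding phase_def by blast
qed

lemma closed_phase: "closed (phase e)"
  unfolding phase_halfspaces by (intro closed_INT ballI closed_halfspace_le)

lemma convex_phase: "convex (phase e)"
  unfolding phase_halfspaces by (intro convex_INT convex_halfspace_le)

lemma phase_eta: "x \<in> phase (etaK K x)"
  unfolding phase_def using eta_in_hull by simp

text \<open>Sites outside the class are strictly worse at \<open>x\<close>, hence also nearby; sites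
  inside are tied at \<open>x\<close>, so after a small step only the inner product with the step
  decides. This is the conical structure of the zones around \<open>x\<close>.\<close>

lemma opt_local: "\<forall>\<^sub>F v in nhds 0. opt K (x + v) = amax (opt K x) v"
proof -
  obtain a where a: "a \<in> opt K x" using opt_nonempty by blast
  have "\<forall>\<^sub>F v in nhds 0. \<forall>y\<in>K - opt K x. aff y (x + v) < aff a (x + v)"
  proof (rule eventually_ball_finite)
    show "\<forall>y\<in>K - opt K x. \<forall>\<^sub>F v in nhds 0. aff y (x + v) < aff a (x + v)"
    proof
      fix y assume y: "y \<in> K - opt K x"
      then have lt: "aff y x < aff a x" using a gK_ge[of y x] opt_gK by force
      have "((\<lambda>v. aff a (x + v) - aff y (x + v)) \<longlongrightarrow> aff a x - aff y x) (nhds 0)"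
        unfolding aff_add by (auto intro!: tendsto_eq_intros filterlim_ident)
      then have "\<forall>\<^sub>F v in nhds 0. 0 < aff a (x + v) - aff y (x + v)"
        using lt by (intro order_tendstoD(1)) auto
      then show "\<forall>\<^sub>F v in nhds 0. aff y (x + v) < aff a (x + v)" by (auto elim!: eventually_mono)
    qed
  qed (use finK in auto)
  then show ?thesis
  proof (rule eventually_mono)
    fix v assume *: "\<forall>y\<in>K - opt K x. aff y (x + v) < aff a (x + v)"
    have eq: "aff b x = gK K x" "b \<in> K" if "b \<in> opt K x" for b using that opt_gK by auto
    show "opt K (x + v) = amax (opt K x) v"
    proof (intro equalityI subsetI)
      fix b assume b: "b \<in> opt K (x + v)"
      have bx: "b \<in> opt K x" using * b eq(2)[OF a] unfolding opt_iff[of b "x+v"] by (meson DiffI not_le)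
      have "v \<bullet> z \<le> v \<bullet> b" if "z \<in> opt K x" for z
      proof -
        have "aff z (x + v) \<le> aff b (x + v)" using b eq(2)[OF that] unfolding opt_iff[of b "x+v"] by blast
        then show ?thesis using eq(1)[OF that] eq(1)[OF bx] by (simp add: aff_add)
      qed
      then show "b \<in> amax (opt K x) v" using bx by (simp add: amax_def)
    next
      fix b assume b: "b \<in> amax (opt K x) v"
      then have bx: "b \<in> opt K x" using amax_subset by blast
      have le: "aff z (x + v) \<le> aff b (x + v)" if "z \<in> opt K x" for z
      proof -
        have "v \<bullet> z \<le> v \<bullet> b" using b that by (simp add: amax_def)
        then show ?thesis using eq(1)[OF that] eq(1)[OF bx] by (simp add: aff_add)
      qed
      have "aff z (x + v) \<le> aff b (x + v)" if "z \<in> K" for z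
      proof (cases "z \<in> opt K x")
        case False
        then have "aff z (x + v) < aff a (x + v)" using * that by blast
        then show ?thesis using le[OF a] by linarith
      qed (rule le)
      then show "b \<in> opt K (x + v)" unfolding opt_iff using bx eq by blast
    qed
  qed
qed

text \<open>The label of the zone entered by the ray from \<open>x\<close> in direction \<open>v\<close>.\<close>

definition eta_dir :: "'a \<Rightarrow> 'a \<Rightarrow> 'a" where
  "eta_dir x v = closest_point (convex hull (amax (opt K x) v)) x"

lemma hull_amax_props:
  "closed (convex hull (amax (opt K x) v))" "convex hull (amax (opt K x) v) \<noteq> {}"
  "convex hull (amax (opt K x) v) \<subseteq> hull_opt x"
proof -
  have fin: "finite (amax (opt K x) v)" by (rule finite_subset[OF amax_subset finite_opt])
  then show "closed (convex hull (amax (opt K x) v))"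
    by (simp add: finite_imp_compact_convex_hull compact_imp_closed)
  show "convex hull (amax (opt K x) v) \<noteq> {}" using amax_nonempty[OF finite_opt opt_nonempty] by simp
  show "convex hull (amax (opt K x) v) \<subseteq> hull_opt x" by (intro hull_mono amax_subset)
qed

lemma eta_dir_in: "eta_dir x v \<in> convex hull (amax (opt K x) v)"
  unfolding eta_dir_def by (intro closest_point_in_set hull_amax_props)

text \<open>Uniqueness of the projection onto a closed convex set. The strictness is what later
  separates the zone of a ray from the other labels by a positive gap.\<close>

lemma eta_dir_less:
  assumes "e \<in> convex hull (amax (opt K x) v)" "e \<noteq> eta_dir x v"
  shows "norm (x - eta_dir x v) < norm (x - e)"
proof (rule ccontr)
  assume "\<not> ?thesis"
  then have le: "norm (x - e) \<le> norm (x - eta_dir x v)" by simp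
  have "e = closest_point (convex hull (amax (opt K x) v)) x"
  proof (rule closest_point_unique)
    show "\<forall>z\<in>convex hull (amax (opt K x) v). dist x e \<le> dist x z"
      using le closest_point_le[OF hull_amax_props(1), of _ x v x] unfolding eta_dir_def dist_norm
      by (meson order_trans)
  qed (use assms hull_amax_props in auto)
  then show False using assms by (simp add: eta_dir_def)
qed

text \<open>By scale invariance of \<open>amax\<close> all short steps along the ray have the same
  optimality class. At \<open>s = 0\<close> membership survives because the exposed part is a subset
  of \<open>opt K x\<close>.\<close>

lemma phase_ray: "\<exists>r>0. \<forall>s\<in>{0..r}. x + s *\<^sub>R v \<in> phase (eta_dir x v)"
proof -
  have "((\<lambda>s. s *\<^sub>R v) \<longlongrightarrow> 0 *\<^sub>R v) (at_right 0)" by (intro tendsto_intros)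
  then have "filterlim (\<lambda>s. s *\<^sub>R v) (nhds 0) (at_right 0)" by simp
  then have "\<forall>\<^sub>F s in at_right 0. opt K (x + s *\<^sub>R v) = amax (opt K x) (s *\<^sub>R v)"
    using opt_local by (rule filterlim_iff[THEN iffD1, rule_format])
  then obtain r where r: "r > 0" "\<And>s. 0 < s \<Longrightarrow> s < r \<Longrightarrow> opt K (x + s *\<^sub>R v) = amax (opt K x) (s *\<^sub>R v)"
    by (auto simp: eventually_at_right_field)
  have "x + s *\<^sub>R v \<in> phase (eta_dir x v)" if "s \<in> {0..r/2}" for s
  proof (cases "s = 0")
    case True
    then show ?thesis unfolding phase_def using eta_dir_in[of x v] hull_amax_props(3)[of x v] by auto
  next
    case False
    then have "0 < s" "s < r" using that r(1) by auto
    then have "opt K (x + s *\<^sub>R v) = amax (opt K x) v" using r(2) amax_scale by metis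
    then show ?thesis unfolding phase_def using eta_dir_in by auto
  qed
  then show ?thesis using r by (intro exI[of _ "r/2"]) auto
qed

end

section \<open>The action and its comparison principle\<close>

locale potential = sites K for K :: "'a::euclidean_space set" +
  fixes h h' :: "real \<Rightarrow> real"
  assumes h_deriv: "\<And>s. s \<ge> 0 \<Longrightarrow> (h has_real_derivative h' s) (at s within {0..})"
    and h'_cont: "continuous_on {0..} h'"
    and h_nonneg: "\<And>s. s \<ge> 0 \<Longrightarrow> h s \<ge> 0"
    and h_strict: "strict_mono_on {0..} h"
begin

definition V :: "'a \<Rightarrow> real" where "V x = h ((norm (x - etaK K x))\<^sup>2)"

text \<open>The continuously differentiable potential obtained by keeping the label \<open>e\<close>
  at every point; \<open>V\<close> switches between finitely many such functions.\<close>

definition H :: "'a \<Rightarrow> 'a \<Rightarrow> real" where "H e x = h ((norm (x - e))\<^sup>2)"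

lemma V_nonneg: "0 \<le> V x" unfolding V_def by (intro h_nonneg) simp

lemma h_mono: "0 \<le> s \<Longrightarrow> s \<le> t \<Longrightarrow> h s \<le> h t"
  using h_strict by (meson atLeast_iff monotone_onD order_trans strict_mono_on_imp_mono_on)

lemma V_le: "x \<in> phase e \<Longrightarrow> V x \<le> H e x"
  unfolding V_def H_def phase_def using eta_le[of e x] by (intro h_mono) (auto intro: power_mono)

lemma V_eq_H: "etaK K x = e \<Longrightarrow> V x = H e x"
  by (simp add: V_def H_def)

lemma V_ext_grad: "h ((norm (ext_grad K x))\<^sup>2) = V x"
  by (simp add: ext_grad_eq V_def norm_minus_commute)

lemma h_cont: "continuous_on {0..} h"
  using h_deriv by (meson atLeast_iff DERIV_continuous continuous_on_eq_continuous_within)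

lemma hull_K_bounded: obtains R where "R > 0" "\<And>e. e \<in> convex hull K \<Longrightarrow> norm e \<le> R"
  using bounded_convex_hull[OF finite_imp_bounded[OF finK]] unfolding bounded_pos by blast

lemma eta_hull_K: "etaK K x \<in> convex hull K"
  using eta_in_hull hull_opt_props(4) by blast

lemma eta_dir_hull_K: "eta_dir x v \<in> convex hull K"
  using eta_dir_in hull_amax_props(3) hull_opt_props(4) by blast

text \<open>On the bounded range of arguments \<open>h\<close> is Lipschitz by compactness, and |a^2
  - b^2| = |a - b| (a + b) with a + b at most 4 R. One constant serves all labels \<open>e\<close>,
  because the zones met by a curve are not known in advance.\<close>

lemma H_lipschitz_bounded:
  "\<exists>C\<ge>0. \<forall>e x y. norm e \<le> R \<longrightarrow> norm x \<le> R \<longrightarrow> norm y \<le> R \<longrightarrow> \<bar>H e x - H e y\<bar> \<le> C * norm (x - y)"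
proof -
  define M0 where "M0 = (2 * R)\<^sup>2"
  have "compact (h' ` {0..M0})"
    by (intro compact_continuous_image continuous_on_subset[OF h'_cont]) auto
  then obtain B where B: "B > 0" "\<And>s. s \<in> {0..M0} \<Longrightarrow> norm (h' s) \<le> B"
    using compact_imp_bounded bounded_pos by (metis image_eqI)
  have hl: "norm (h s - h t) \<le> B * norm (s - t)" if "s \<in> {0..M0}" "t \<in> {0..M0}" for s t
  proof (rule field_differentiable_bound[of "{0..M0}" h h'])
    fix z assume "z \<in> {0..M0}"
    then show "(h has_real_derivative h' z) (at z within {0..M0})"
      by (intro DERIV_subset[OF h_deriv]) auto
  qed (use B that in auto)
  show ?thesis
  proof (intro exI[of _ "B * (4 * \<bar>R\<bar>)"] conjI allI impI)
    fix e x y :: 'a assume n: "norm e \<le> R" "norm x \<le> R" "norm y \<le> R"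
    have le: "norm (x - e) \<le> 2 * R" "norm (y - e) \<le> 2 * R"
      using n norm_triangle_ineq4[of x e] norm_triangle_ineq4[of y e] by linarith+
    then have "\<bar>H e x - H e y\<bar> \<le> B * \<bar>(norm (x - e))\<^sup>2 - (norm (y - e))\<^sup>2\<bar>"
      using hl[of "(norm (x - e))\<^sup>2" "(norm (y - e))\<^sup>2"] power_mono[OF le(1), of 2] power_mono[OF le(2), of 2]
      unfolding H_def M0_def by simp
    also have "(norm (x - e))\<^sup>2 - (norm (y - e))\<^sup>2 = (norm (x - e) - norm (y - e)) * (norm (x - e) + norm (y - e))"
      by (simp add: power2_eq_square algebra_simps)
    also have "\<bar>\<dots>\<bar> \<le> norm (x - y) * (4 * \<bar>R\<bar>)"
      unfolding abs_mult using norm_triangle_ineq3[of "x - e" "y - e"] le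
      by (intro mult_mono) auto
    finally show "\<bar>H e x - H e y\<bar> \<le> B * (4 * \<bar>R\<bar>) * norm (x - y)"
      using B(1) by (simp add: mult.assoc mult.commute mult.left_commute)
  qed (use B in auto)
qed

text \<open>Since \<open>etaK\<close> factors through the finitely many classes, it is a finite sum
  of constants times indicators, and each class is attained on a finite intersection of closed sets
  and complements of closed sets. As \<open>V\<close> may jump, its integrability along a continuous
  curve rests on measurability and boundedness.\<close>

lemma eta_borel: "etaK K \<in> borel_measurable borel"
proof -
  define F where "F B = etaK K (SOME x. opt K x = B)" for B
  have F: "etaK K x = F (opt K x)" for x
    unfolding F_def by (intro eta_cong) (metis (mono_tags) someI_ex)
  have m: "{x. opt K x = B} \<in> sets borel" if "B \<in> Pow K" for B
  proof -
    define C where "C y = {x. \<forall>z\<in>K. aff z x \<le> aff y x}" for y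
    have cl: "closed (C y)" for y
    proof -
      have "C y = (\<Inter>z\<in>K. {x. aff z x \<le> aff y x})" by (auto simp: C_def)
      then show ?thesis
        unfolding aff_def by (simp only:) (intro closed_INT ballI closed_Collect_le continuous_intros)
    qed
    have op: "y \<in> opt K x \<longleftrightarrow> y \<in> K \<and> x \<in> C y" for x y unfolding opt_iff C_def by simp
    have eq: "{x. opt K x = B} = (\<Inter>y\<in>K. if y \<in> B then C y else - C y)"
    proof (intro set_eqI)
      fix x
      have "opt K x = B \<longleftrightarrow> (\<forall>y\<in>K. (x \<in> C y) = (y \<in> B))" using that op[of _ x] by blast
      then show "x \<in> {x. opt K x = B} \<longleftrightarrow> x \<in> (\<Inter>y\<in>K. if y \<in> B then C y else - C y)"
        by (auto split: if_splits)
    qed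
    show ?thesis unfolding eq using finK neK cl by (intro sets.finite_INT) auto
  qed
  have "etaK K = (\<lambda>x. \<Sum>B\<in>Pow K. indicat_real {x. opt K x = B} x *\<^sub>R F B)"
  proof
    fix x
    have "(\<Sum>B\<in>Pow K. indicat_real {x. opt K x = B} x *\<^sub>R F B) = (\<Sum>B\<in>Pow K. if B = opt K x then F B else 0)"
      by (rule sum.cong) auto
    also have "\<dots> = etaK K x" using finK opt_subset F[of x] by simp
    finally show "etaK K x = (\<Sum>B\<in>Pow K. indicat_real {x. opt K x = B} x *\<^sub>R F B)" by simp
  qed
  then show ?thesis using m
    by (simp only:) (intro borel_measurable_sum borel_measurable_scaleR borel_measurable_indicator borel_measurable_const)
qed

lemma V_borel: "V \<in> borel_measurable borel"
proof -
  have "continuous_on UNIV (\<lambda>x::'a. h ((norm x)\<^sup>2))"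
    by (rule continuous_on_compose2[OF h_cont]) (auto intro!: continuous_intros)
  then have "(\<lambda>x::'a. h ((norm x)\<^sup>2)) \<in> borel_measurable borel" by (rule borel_measurable_continuous_onI)
  then have "(\<lambda>x. h ((norm (x - etaK K x))\<^sup>2)) \<in> borel_measurable borel"
    using eta_borel by (intro measurable_compose[of "\<lambda>x. x - etaK K x" borel borel "\<lambda>x. h ((norm x)\<^sup>2)"]) auto
  then show ?thesis unfolding V_def[abs_def] .
qed

lemma V_bounded: obtains C where "C > 0" "\<And>x. norm x \<le> R \<Longrightarrow> V x \<le> C"
proof -
  obtain R0 where R0: "R0 > 0" "\<And>e. e \<in> convex hull K \<Longrightarrow> norm e \<le> R0" using hull_K_bounded by blast
  have "V x \<le> h ((\<bar>R\<bar> + R0)\<^sup>2) + 1" if "norm x \<le> R" for x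
  proof -
    have "norm (x - etaK K x) \<le> \<bar>R\<bar> + R0"
      using norm_triangle_ineq4[of x "etaK K x"] R0(2)[OF eta_hull_K, of x] that by linarith
    then have "V x \<le> h ((\<bar>R\<bar> + R0)\<^sup>2)" unfolding V_def by (intro h_mono power_mono) auto
    then show ?thesis by simp
  qed
  moreover have "h ((\<bar>R\<bar> + R0)\<^sup>2) + 1 > 0" using h_nonneg[of "(\<bar>R\<bar> + R0)\<^sup>2"] by simp
  ultimately show thesis using that by blast
qed

lemma V_integrable:
  fixes \<sigma> :: "real \<Rightarrow> 'a"
  assumes "continuous_on {s..t} \<sigma>"
  shows "(\<lambda>r. V (\<sigma> r)) integrable_on {s..t}"
proof -
  have "bounded (\<sigma> ` {s..t})" using assms by (intro compact_imp_bounded compact_continuous_image) auto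
  then obtain R where R: "\<And>r. r \<in> {s..t} \<Longrightarrow> norm (\<sigma> r) \<le> R" unfolding bounded_iff by (metis imageI)
  obtain C where C: "C > 0" "\<And>x. norm x \<le> R \<Longrightarrow> V x \<le> C" using V_bounded by blast
  show ?thesis
  proof (rule measurable_bounded_by_integrable_imp_integrable[of _ _ "\<lambda>_. C"])
    have "\<sigma> \<in> borel_measurable (lebesgue_on {s..t})"
      using assms by (intro continuous_imp_measurable_on_sets_lebesgue) auto
    then show "(\<lambda>r. V (\<sigma> r)) \<in> borel_measurable (lebesgue_on {s..t})"
      using V_borel by (rule measurable_compose)
    show "norm (V (\<sigma> r)) \<le> C" if "r \<in> {s..t}" for r
      using C(2)[OF R[OF that]] V_nonneg[of "\<sigma> r"] by simp
  qed auto
qed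

end

section \<open>Passing between the extended-valued action and real integrals\<close>

lemma nn_integral_indicator_integral:
  fixes F :: "real \<Rightarrow> real"
  assumes "F integrable_on S" "\<And>x. x \<in> S \<Longrightarrow> 0 \<le> F x"
  shows "(\<integral>\<^sup>+ t. indicator S t * ennreal (F t) \<partial>lborel) = ennreal (integral S F)"
  using nn_integral_has_integral_lebesgue'[OF assms(2) integrable_integral[OF assms(1)]]
  by (simp add: mult.commute)

lemma integrable_on_nn_integral_finite:
  fixes F :: "real \<Rightarrow> real"
  assumes m: "F \<in> borel_measurable (lebesgue_on S)" and S: "S \<in> sets lebesgue"
    and nn: "\<And>x. x \<in> S \<Longrightarrow> 0 \<le> F x"
    and fin: "(\<integral>\<^sup>+ t. indicator S t * ennreal (F t) \<partial>lborel) < \<infinity>"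
  shows "F integrable_on S"
proof -
  define G where "G x = (if x \<in> S then F x else 0)" for x
  have Gm: "G \<in> borel_measurable lebesgue"
    using m S unfolding G_def by (simp add: borel_measurable_if)
  have "(\<integral>\<^sup>+ t. ennreal (G t) \<partial>lebesgue) = (\<integral>\<^sup>+ t. indicator S t * ennreal (F t) \<partial>lborel)"
    unfolding nn_integral_completion by (intro nn_integral_cong) (auto simp: G_def)
  then have "(\<integral>\<^sup>+ t. ennreal (G t) \<partial>lebesgue) < \<infinity>" using fin by simp
  then obtain r where r: "(\<integral>\<^sup>+ t. ennreal (G t) \<partial>lebesgue) = ennreal r" "0 \<le> r"
    by (cases "\<integral>\<^sup>+ t. ennreal (G t) \<partial>lebesgue" rule: ennreal_cases) auto
  have "(G has_integral r) UNIV"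
    using has_integral_iff_nn_integral_lebesgue[of G r] Gm r nn by (auto simp: G_def)
  then have "(F has_integral r) S" unfolding G_def has_integral_restrict_UNIV .
  then show ?thesis by blast
qed

lemma abs_cont_on_ae_derivative:
  fixes f :: "real \<Rightarrow> 'a::euclidean_space"
  assumes ac: "abs_cont_on a b f"
  obtains N where "negligible N" "a \<in> N" "b \<in> N"
    "\<And>t. t \<in> {a..b} - N \<Longrightarrow> (f has_vector_derivative vector_derivative f (at t within {a..b})) (at t)"
proof
  let ?N = "{x \<in> {a<..<b}. \<not> f differentiable (at x)} \<union> {a, b}"
  show "negligible ?N" using abs_cont_on_differentiable[OF ac] by (intro negligible_Un) auto
  fix t assume t: "t \<in> {a..b} - ?N"
  then have "t \<in> {a<..<b}" by auto
  then have "at t within {a..b} = at t" by (intro at_within_Icc_at) auto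
  then show "(f has_vector_derivative vector_derivative f (at t within {a..b})) (at t)"
    using t \<open>t \<in> {a<..<b}\<close> vector_derivative_works[of f "at t"] by auto
qed auto

lemma vector_derivative_integral:
  fixes f :: "real \<Rightarrow> 'a::euclidean_space"
  assumes ac: "abs_cont_on a b f" and st: "a \<le> s" "s \<le> t" "t \<le> b"
  shows "((\<lambda>r. vector_derivative f (at r within {a..b})) has_integral f t - f s) {s..t}"
proof -
  obtain N where N: "negligible N" "\<And>t. t \<in> {a..b} - N \<Longrightarrow> (f has_vector_derivative vector_derivative f (at t within {a..b})) (at t)"
    using abs_cont_on_ae_derivative[OF ac] by metis
  show ?thesis
  proof (rule abs_cont_on_has_integral_derivative[OF abs_cont_on_subinterval[OF ac st(1,3)] st(2) N(1)])
    fix x assume "x \<in> {s..t} - N"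
    then show "(f has_vector_derivative vector_derivative f (at x within {a..b})) (at x within {s..t})"
      using N(2)[of x] st by (auto intro: has_vector_derivative_at_within)
  qed
qed

section \<open>Local minimizers and competitors on a subinterval\<close>

locale minimizer = potential K h h' for K :: "'a::euclidean_space set" and h h' +
  fixes \<delta> \<rho> :: real and x0 x\<delta> :: 'a and \<gamma> :: "real \<Rightarrow> 'a"
  assumes \<delta>: "\<delta> > 0" and \<rho>: "\<rho> > 0" and finite_action: "actI K h \<delta> x0 x\<delta> \<gamma> < \<infinity>"
    and least: "\<And>\<sigma>. \<lbrakk>continuous_on {0..\<delta>} \<sigma>; \<And>t. t \<in> {0..\<delta>} \<Longrightarrow> dist (\<sigma> t) (\<gamma> t) \<le> \<rho>\<rbrakk>
      \<Longrightarrow> actI K h \<delta> x0 x\<delta> \<gamma> \<le> actI K h \<delta> x0 x\<delta> \<sigma>"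
begin

definition vel :: "real \<Rightarrow> 'a" where "vel t = vector_derivative \<gamma> (at t within {0..\<delta>})"

lemma \<gamma>_ac: "abs_cont_on 0 \<delta> \<gamma>" and \<gamma>_ends: "\<gamma> 0 = x0" "\<gamma> \<delta> = x\<delta>"
  using finite_action unfolding actI_def by (auto split: if_splits)

lemma \<gamma>_cont: "continuous_on {0..\<delta>} \<gamma>"
  by (rule abs_cont_on_imp_continuous_on[OF \<gamma>_ac])

lemma vel_integral: "0 \<le> s \<Longrightarrow> s \<le> t \<Longrightarrow> t \<le> \<delta> \<Longrightarrow> (vel has_integral \<gamma> t - \<gamma> s) {s..t}"
  unfolding vel_def by (rule vector_derivative_integral[OF \<gamma>_ac])

lemma vel_measurable: "vel \<in> borel_measurable (lebesgue_on {0..\<delta>})"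
  using vel_integral[of 0 \<delta>] \<delta> by (intro integrable_imp_measurable) auto

lemma V\<gamma>_integrable: "0 \<le> s \<Longrightarrow> t \<le> \<delta> \<Longrightarrow> (\<lambda>r. V (\<gamma> r)) integrable_on {s..t}"
  by (intro V_integrable continuous_on_subset[OF \<gamma>_cont]) auto

lemma action_eq: "actI K h \<delta> x0 x\<delta> \<gamma> = (\<integral>\<^sup>+ t. indicator {0..\<delta>} t * ennreal ((norm (vel t))\<^sup>2 + V (\<gamma> t)) \<partial>lborel)"
  using \<gamma>_ac \<gamma>_ends unfolding actI_def vel_def V_ext_grad by simp

lemma density_integrable: "(\<lambda>t. (norm (vel t))\<^sup>2 + V (\<gamma> t)) integrable_on {0..\<delta>}"
proof (rule integrable_on_nn_integral_finite)
  have "(\<lambda>t. V (\<gamma> t)) \<in> borel_measurable (lebesgue_on {0..\<delta>})"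
    using V\<gamma>_integrable[of 0 \<delta>] by (intro integrable_imp_measurable) auto
  then show "(\<lambda>t. (norm (vel t))\<^sup>2 + V (\<gamma> t)) \<in> borel_measurable (lebesgue_on {0..\<delta>})"
    using vel_measurable by measurable
  show "(\<integral>\<^sup>+ t. indicator {0..\<delta>} t * ennreal ((norm (vel t))\<^sup>2 + V (\<gamma> t)) \<partial>lborel) < \<infinity>"
    using finite_action action_eq by simp
qed (auto simp: V_nonneg)

lemma vel_sq_integrable: "0 \<le> s \<Longrightarrow> t \<le> \<delta> \<Longrightarrow> (\<lambda>r. (norm (vel r))\<^sup>2) integrable_on {s..t}"
proof -
  assume "0 \<le> s" "t \<le> \<delta>"
  have "(\<lambda>r. ((norm (vel r))\<^sup>2 + V (\<gamma> r)) - V (\<gamma> r)) integrable_on {0..\<delta>}"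
    by (intro integrable_diff density_integrable V\<gamma>_integrable) auto
  then show ?thesis using \<open>0 \<le> s\<close> \<open>t \<le> \<delta>\<close> by (simp add: integrable_subinterval_real)
qed

text \<open>The competitor lives on [s, t] and is spliced into \<open>\<gamma>\<close>; outside, the
  two densities agree and cancel. Its velocity is prescribed off a null set only, which leaves the
  integrals unchanged.\<close>

lemma comparison:
  assumes st: "0 \<le> s" "s < t" "t \<le> \<delta>"
    and ac: "abs_cont_on s t \<sigma>" and ends: "\<sigma> s = \<gamma> s" "\<sigma> t = \<gamma> t"
    and near: "\<And>r. r \<in> {s..t} \<Longrightarrow> dist (\<sigma> r) (\<gamma> r) \<le> \<rho>"
    and N: "negligible N" and der: "\<And>r. r \<in> {s<..<t} - N \<Longrightarrow> (\<sigma> has_vector_derivative k r) (at r)"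
    and k: "(\<lambda>r. (norm (k r))\<^sup>2) integrable_on {s..t}"
  shows "integral {s..t} (\<lambda>r. (norm (vel r))\<^sup>2) + integral {s..t} (\<lambda>r. V (\<gamma> r))
    \<le> integral {s..t} (\<lambda>r. (norm (k r))\<^sup>2) + integral {s..t} (\<lambda>r. V (\<sigma> r))"
proof -
  define \<tau> where "\<tau> r = (if r \<in> {s..t} then \<sigma> r else \<gamma> r)" for r
  have "abs_cont_on 0 s \<tau>"
    by (rule abs_cont_on_cong[OF abs_cont_on_subinterval[OF \<gamma>_ac]]) (use st ends in \<open>auto simp: \<tau>_def\<close>)
  moreover have "abs_cont_on s t \<tau>"
    by (rule abs_cont_on_cong[OF ac]) (auto simp: \<tau>_def)
  moreover have "abs_cont_on t \<delta> \<tau>"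
    by (rule abs_cont_on_cong[OF abs_cont_on_subinterval[OF \<gamma>_ac]]) (use st ends in \<open>auto simp: \<tau>_def\<close>)
  ultimately have ac\<tau>: "abs_cont_on 0 \<delta> \<tau>"
    using st by (meson abs_cont_on_join less_imp_le order_trans)
  have ends\<tau>: "\<tau> 0 = x0" "\<tau> \<delta> = x\<delta>" using st ends \<gamma>_ends by (auto simp: \<tau>_def)
  have cont\<tau>: "continuous_on {0..\<delta>} \<tau>" by (rule abs_cont_on_imp_continuous_on[OF ac\<tau>])
  have le: "actI K h \<delta> x0 x\<delta> \<gamma> \<le> actI K h \<delta> x0 x\<delta> \<tau>"
    by (rule least[OF cont\<tau>]) (use near \<rho> in \<open>auto simp: \<tau>_def\<close>)
  define G where "G r = (norm (vel r))\<^sup>2 + V (\<gamma> r)" for r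
  define U where "U r = ((norm (k r))\<^sup>2 + V (\<sigma> r)) - G r" for r
  have cont\<sigma>: "continuous_on {s..t} \<sigma>" by (rule abs_cont_on_imp_continuous_on[OF ac])
  have GI: "G integrable_on {0..\<delta>}" unfolding G_def by (rule density_integrable)
  have Gst: "(G has_integral integral {s..t} (\<lambda>r. (norm (vel r))\<^sup>2) + integral {s..t} (\<lambda>r. V (\<gamma> r))) {s..t}"
    unfolding G_def using st by (intro has_integral_add integrable_integral vel_sq_integrable V\<gamma>_integrable) auto
  define D where "D = (integral {s..t} (\<lambda>r. (norm (k r))\<^sup>2) + integral {s..t} (\<lambda>r. V (\<sigma> r)))
      - (integral {s..t} (\<lambda>r. (norm (vel r))\<^sup>2) + integral {s..t} (\<lambda>r. V (\<gamma> r)))"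
  have "(U has_integral D) {s..t}" unfolding U_def D_def
    by (intro has_integral_diff Gst has_integral_add integrable_integral k V_integrable cont\<sigma>)
  then have "((\<lambda>r. if r \<in> {s..t} then U r else 0) has_integral D) {0..\<delta>}"
    using st by (subst has_integral_restrict) auto
  then have FI: "((\<lambda>r. G r + (if r \<in> {s..t} then U r else 0)) has_integral integral {0..\<delta>} G + D) {0..\<delta>}"
    by (intro has_integral_add integrable_integral GI)
  define F where "F r = (if r \<in> {s..t} then (norm (k r))\<^sup>2 + V (\<sigma> r) else G r)" for r
  have Feq: "G r + (if r \<in> {s..t} then U r else 0) = F r" for r by (simp add: F_def U_def)
  have FI': "(F has_integral integral {0..\<delta>} G + D) {0..\<delta>}" using FI unfolding Feq .
  have Fnn: "0 \<le> F r" for r by (simp add: F_def G_def V_nonneg)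
  obtain N0 where N0: "negligible N0" "0 \<in> N0" "\<delta> \<in> N0"
    "\<And>t. t \<in> {0..\<delta>} - N0 \<Longrightarrow> (\<gamma> has_vector_derivative vel t) (at t)"
    using abs_cont_on_ae_derivative[OF \<gamma>_ac] unfolding vel_def by metis
  have d\<tau>: "vector_derivative \<tau> (at r within {0..\<delta>}) = (if r \<in> {s..t} then k r else vel r)"
    if r: "r \<in> {0..\<delta>}" "r \<notin> N0 \<union> N \<union> {s,t}" for r
  proof -
    have r0: "0 < r" "r < \<delta>" using r N0(2,3) by (cases "r = 0"; cases "r = \<delta>"; force)+
    have "(\<tau> has_vector_derivative (if r \<in> {s..t} then k r else vel r)) (at r)"
    proof (cases "r \<in> {s..t}")
      case True
      then have "(\<sigma> has_vector_derivative k r) (at r)" using der[of r] r by auto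
      then have "(\<tau> has_vector_derivative k r) (at r)"
        by (rule has_vector_derivative_transform_within_open[of _ _ _ "{s<..<t}"])
           (use True r in \<open>auto simp: \<tau>_def\<close>)
      then show ?thesis using True by simp
    next
      case False
      have "(\<gamma> has_vector_derivative vel r) (at r)" using N0(4)[of r] r by auto
      then have "(\<tau> has_vector_derivative vel r) (at r)"
        by (rule has_vector_derivative_transform_within_open[of _ _ _ "- {s..t}"])
           (use False in \<open>auto simp: \<tau>_def\<close>)
      then show ?thesis unfolding if_not_P[OF False] .
    qed
    moreover have "at r within {0..\<delta>} = at r" using r0 by (rule at_within_Icc_at)
    ultimately show ?thesis by (simp add: vector_derivative_at)
  qed
  have "actI K h \<delta> x0 x\<delta> \<tau> = (\<integral>\<^sup>+ r. indicator {0..\<delta>} r * ennreal ((norm (vector_derivative \<tau> (at r within {0..\<delta>})))\<^sup>2 + V (\<tau> r)) \<partial>lebesgue)"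
    using ac\<tau> ends\<tau> unfolding actI_def V_ext_grad nn_integral_completion by simp
  also have "\<dots> = (\<integral>\<^sup>+ r. indicator {0..\<delta>} r * ennreal (F r) \<partial>lebesgue)"
  proof (rule nn_integral_cong_AE)
    have "negligible (N0 \<union> N \<union> {s,t})" using N0 N by (intro negligible_Un) auto
    then have "AE r in lebesgue. r \<notin> N0 \<union> N \<union> {s,t}"
      by (intro AE_not_in) (simp add: negligible_iff_null_sets)
    then show "AE r in lebesgue. indicator {0..\<delta>} r * ennreal ((norm (vector_derivative \<tau> (at r within {0..\<delta>})))\<^sup>2 + V (\<tau> r)) = indicator {0..\<delta>} r * ennreal (F r)"
    proof (rule AE_mp, intro AE_I2 impI)
      fix r assume r: "r \<notin> N0 \<union> N \<union> {s,t}"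
      show "indicator {0..\<delta>} r * ennreal ((norm (vector_derivative \<tau> (at r within {0..\<delta>})))\<^sup>2 + V (\<tau> r)) = indicator {0..\<delta>} r * ennreal (F r)"
      proof (cases "r \<in> {0..\<delta>}")
        case True
        show ?thesis unfolding d\<tau>[OF True r] by (simp add: F_def G_def \<tau>_def)
      qed simp
    qed
  qed
  also have "\<dots> = ennreal (integral {0..\<delta>} G + D)"
    unfolding nn_integral_completion
    using nn_integral_indicator_integral[of F "{0..\<delta>}"] FI' Fnn integral_unique[OF FI'] by auto
  finally have "ennreal (integral {0..\<delta>} G) \<le> ennreal (integral {0..\<delta>} G + D)"
    using le action_eq nn_integral_indicator_integral[OF GI] unfolding G_def by (simp add: V_nonneg)
  \<comment> \<open>\<open>ennreal\<close> sends negative reals to 0, so the inequality of the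
    actions yields one between real numbers only once this sign is known.\<close>
  moreover have "0 \<le> integral {0..\<delta>} G + D" using FI' Fnn has_integral_nonneg by blast
  ultimately have "integral {0..\<delta>} G \<le> integral {0..\<delta>} G + D" by (simp add: ennreal_le_iff)
  then show ?thesis by (simp add: D_def)
qed

end

section \<open>Broken lines and chords as competitors\<close>

definition poly_curve :: "real \<Rightarrow> real \<Rightarrow> 'a::real_vector \<Rightarrow> 'a \<Rightarrow> 'a \<Rightarrow> real \<Rightarrow> 'a" where
  "poly_curve s m a w w' r = (if r \<le> m then a + (r - s) *\<^sub>R w else a + (m - s) *\<^sub>R w + (r - m) *\<^sub>R w')"

lemma poly_curve_same: "poly_curve s m a w w r = a + (r - s) *\<^sub>R w"
  by (simp add: poly_curve_def algebra_simps)

lemma convex_comb_shift: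
  fixes a w :: "'a::real_vector"
  assumes "L \<noteq> 0"
  shows "(1 - d / L) *\<^sub>R a + (d / L) *\<^sub>R (a + L *\<^sub>R w) = a + d *\<^sub>R w"
proof -
  have "(1 - d / L) *\<^sub>R a + (d / L) *\<^sub>R (a + L *\<^sub>R w) = a + (d / L * L) *\<^sub>R w"
    by (simp add: scaleR_add_right scaleR_diff_left)
  then show ?thesis using assms by simp
qed

lemma abs_cont_on_linear:
  fixes w :: "'a::real_normed_vector"
  shows "abs_cont_on s t (\<lambda>r. a + (r - m) *\<^sub>R w)"
proof (rule abs_cont_on_lipschitz)
  show "(norm w)-lipschitz_on {s..t} (\<lambda>r. a + (r - m) *\<^sub>R w)"
    by (rule lipschitz_onI) (auto simp: dist_norm algebra_simps simp flip: scaleR_diff_left)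
qed

text \<open>The bound is tested on the open interval only: later it holds between two times at which
  the zone changes and may fail at these times.\<close>

lemma integral_const_le:
  fixes f :: "real \<Rightarrow> real"
  assumes f: "f integrable_on {s..t}" and le: "s \<le> t" and c: "\<And>r. r \<in> {s<..<t} \<Longrightarrow> c \<le> f r"
  shows "c * (t - s) \<le> integral {s..t} f"
proof -
  have "integral {s<..<t} (\<lambda>_. c) \<le> integral {s<..<t} f"
    using f c by (intro integral_le) (auto simp: integrable_on_open_interval_real)
  moreover have "integral {s<..<t} (\<lambda>_. c) = c * (t - s)"
    using le by (simp add: integral_open_interval_real[symmetric])
  ultimately show ?thesis by (simp add: integral_open_interval_real)
qed

lemma integral_le_const:
  fixes f :: "real \<Rightarrow> real"
  assumes f: "f integrable_on {s..t}" and le: "s \<le> t" and c: "\<And>r. r \<in> {s<..<t} \<Longrightarrow> f r \<le> c"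
  shows "integral {s..t} f \<le> c * (t - s)"
proof -
  have "- c * (t - s) \<le> integral {s..t} (\<lambda>r. - f r)"
    using f c by (intro integral_const_le le integrable_neg) auto
  then show ?thesis by simp
qed

lemma integral_sq_dev:
  fixes g :: "real \<Rightarrow> 'a::euclidean_space"
  assumes g: "(g has_integral d) {s..t}" and g2: "(\<lambda>r. (norm (g r))\<^sup>2) integrable_on {s..t}" and st: "s < t"
  shows "((\<lambda>r. (norm (g r - v))\<^sup>2) has_integral integral {s..t} (\<lambda>r. (norm (g r))\<^sup>2) - 2 * (v \<bullet> d) + (t - s) * (norm v)\<^sup>2) {s..t}"
proof -
  have eq: "(norm (g r - v))\<^sup>2 = (norm (g r))\<^sup>2 - 2 * (v \<bullet> g r) + (norm v)\<^sup>2" for r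
    by (simp add: power2_norm_eq_inner inner_diff_left inner_diff_right inner_commute)
  have "((\<lambda>r. v \<bullet> g r) has_integral v \<bullet> d) {s..t}"
    using has_integral_linear[OF g bounded_linear_inner_right[of v]] by (simp add: o_def)
  then have "((\<lambda>r. 2 * (v \<bullet> g r)) has_integral 2 * (v \<bullet> d)) {s..t}" by (rule has_integral_mult_right)
  moreover have "((\<lambda>r. (norm v)\<^sup>2) has_integral (t - s) * (norm v)\<^sup>2) {s..t}"
    using has_integral_const_real[of "(norm v)\<^sup>2" s t] st by simp
  ultimately show ?thesis unfolding eq
    by (intro has_integral_add has_integral_diff integrable_integral g2)
qed

context minimizer
begin

definition Kin :: "real \<Rightarrow> real \<Rightarrow> real" where
  "Kin s t = integral {s..t} (\<lambda>r. (norm (vel r))\<^sup>2)"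

lemma Kin_add: "0 \<le> s \<Longrightarrow> s \<le> r \<Longrightarrow> r \<le> t \<Longrightarrow> t \<le> \<delta> \<Longrightarrow> Kin s t = Kin s r + Kin r t"
  unfolding Kin_def by (intro Henstock_Kurzweil_Integration.integral_combine[symmetric] vel_sq_integrable) auto

text \<open>The variance identity: \<open>v\<close> is the mean velocity, and the variance of the
  velocity is the kinetic energy minus that of the chord. Its nonnegativity is the Cauchy-Schwarz
  bound \<open>Kin_ge\<close>.\<close>

lemma vel_dev:
  assumes "0 \<le> s" "s < t" "t \<le> \<delta>"
  defines "v \<equiv> (1 / (t - s)) *\<^sub>R (\<gamma> t - \<gamma> s)"
  shows "((\<lambda>r. (norm (vel r - v))\<^sup>2) has_integral Kin s t - (norm (\<gamma> t - \<gamma> s))\<^sup>2 / (t - s)) {s..t}"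
proof -
  have "(vel has_integral \<gamma> t - \<gamma> s) {s..t}" using assms by (intro vel_integral) auto
  then have "((\<lambda>r. (norm (vel r - v))\<^sup>2) has_integral Kin s t - 2 * (v \<bullet> (\<gamma> t - \<gamma> s)) + (t - s) * (norm v)\<^sup>2) {s..t}"
    unfolding Kin_def using assms by (intro integral_sq_dev vel_sq_integrable) auto
  moreover have "v \<bullet> (\<gamma> t - \<gamma> s) = (norm (\<gamma> t - \<gamma> s))\<^sup>2 / (t - s)"
    by (simp add: v_def power2_norm_eq_inner)
  moreover have "(t - s) * (norm v)\<^sup>2 = (norm (\<gamma> t - \<gamma> s))\<^sup>2 / (t - s)"
    using assms(2) by (simp add: v_def power_divide power2_eq_square)
  ultimately show ?thesis by simp
qed

lemma Kin_ge: "0 \<le> s \<Longrightarrow> s < t \<Longrightarrow> t \<le> \<delta> \<Longrightarrow> (norm (\<gamma> t - \<gamma> s))\<^sup>2 \<le> (t - s) * Kin s t"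
  using has_integral_nonneg[OF vel_dev[of s t]] by (simp add: field_simps)

lemma dist_in_half_ball: "x \<in> ball y (\<rho>/2) \<Longrightarrow> z \<in> ball y (\<rho>/2) \<Longrightarrow> dist x z \<le> \<rho>"
  for x y z :: 'a
  using dist_triangle[of x z y] by (simp add: dist_commute[of x y])

text \<open>By convexity both legs stay in the ball, and two points of a ball of radius
  \<open>\<rho>/2\<close> are at distance at most \<open>\<rho>\<close>, so the broken line is
  admissible.\<close>

lemma comparison_poly:
  assumes st: "0 \<le> s" "s < m" "m < t" "t \<le> \<delta>" and e: "\<gamma> t = \<gamma> s + (m - s) *\<^sub>R w + (t - m) *\<^sub>R w'"
    and b: "\<And>r. r \<in> {s..t} \<Longrightarrow> \<gamma> r \<in> ball y (\<rho>/2)" and bm: "\<gamma> s + (m - s) *\<^sub>R w \<in> ball y (\<rho>/2)"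
  shows "Kin s t + integral {s..t} (\<lambda>r. V (\<gamma> r)) \<le> (m - s) * (norm w)\<^sup>2 + (t - m) * (norm w')\<^sup>2
         + integral {s..t} (\<lambda>r. V (poly_curve s m (\<gamma> s) w w' r))"
proof -
  let ?p = "poly_curve s m (\<gamma> s) w w'"
  define k where "k r = (if r \<le> m then w else w')" for r
  have ac: "abs_cont_on s t ?p"
  proof (rule abs_cont_on_join[of s m _ t])
    show "abs_cont_on s m ?p"
      by (rule abs_cont_on_cong[OF abs_cont_on_linear[of s m "\<gamma> s" s w]]) (auto simp: poly_curve_def)
    show "abs_cont_on m t ?p"
      by (rule abs_cont_on_cong[OF abs_cont_on_linear[of m t "\<gamma> s + (m - s) *\<^sub>R w" m w']]) (auto simp: poly_curve_def)
  qed (use st in auto)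
  have pb: "?p r \<in> ball y (\<rho>/2)" if r: "r \<in> {s..t}" for r
  proof (cases "r \<le> m")
    case True
    have u: "0 \<le> (r - s) / (m - s)" "(r - s) / (m - s) \<le> 1" using st r True by auto
    have "(1 - (r - s) / (m - s)) *\<^sub>R \<gamma> s + ((r - s) / (m - s)) *\<^sub>R (\<gamma> s + (m - s) *\<^sub>R w) \<in> ball y (\<rho>/2)"
      by (rule convexD[OF convex_ball]) (use b[of s] bm st r True u in auto)
    moreover have "(1 - (r - s) / (m - s)) *\<^sub>R \<gamma> s + ((r - s) / (m - s)) *\<^sub>R (\<gamma> s + (m - s) *\<^sub>R w) = ?p r"
      using st True convex_comb_shift[of "m - s" "r - s" "\<gamma> s" w] by (simp add: poly_curve_def)
    ultimately show ?thesis by simp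
  next
    case False
    have u: "0 \<le> (r - m) / (t - m)" "(r - m) / (t - m) \<le> 1" using st r False by auto
    have "(1 - (r - m) / (t - m)) *\<^sub>R (\<gamma> s + (m - s) *\<^sub>R w) + ((r - m) / (t - m)) *\<^sub>R \<gamma> t \<in> ball y (\<rho>/2)"
      by (rule convexD[OF convex_ball]) (use b[of t] bm st r False u in auto)
    moreover have "(1 - (r - m) / (t - m)) *\<^sub>R p + ((r - m) / (t - m)) *\<^sub>R (p + (t - m) *\<^sub>R w') = p + (r - m) *\<^sub>R w'" for p
      using st by (intro convex_comb_shift) simp
    ultimately show ?thesis using False e by (simp add: poly_curve_def)
  qed
  have kI: "((\<lambda>r. (norm (k r))\<^sup>2) has_integral (m - s) * (norm w)\<^sup>2 + (t - m) * (norm w')\<^sup>2) {s..t}"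
  proof (rule has_integral_combine[of s m t])
    show "((\<lambda>r. (norm (k r))\<^sup>2) has_integral (m - s) * (norm w)\<^sup>2) {s..m}"
    proof (rule has_integral_eq[of _ "\<lambda>r. (norm w)\<^sup>2"])
      show "((\<lambda>r. (norm w)\<^sup>2) has_integral (m - s) * (norm w)\<^sup>2) {s..m}"
        using has_integral_const_real[of "(norm w)\<^sup>2" s m] st by simp
    qed (simp add: k_def)
    show "((\<lambda>r. (norm (k r))\<^sup>2) has_integral (t - m) * (norm w')\<^sup>2) {m..t}"
    proof (rule has_integral_spike[of "{m}" _ _ "\<lambda>r. (norm w')\<^sup>2"])
      show "((\<lambda>r. (norm w')\<^sup>2) has_integral (t - m) * (norm w')\<^sup>2) {m..t}"
        using has_integral_const_real[of "(norm w')\<^sup>2" m t] st by simp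
    qed (auto simp: k_def)
  qed (use st in auto)
  have der: "(?p has_vector_derivative k r) (at r)" if r: "r \<in> {s<..<t} - {m}" for r
  proof (cases "r \<le> m")
    case True
    have "((\<lambda>r. \<gamma> s + (r - s) *\<^sub>R w) has_vector_derivative w) (at r)"
      by (auto intro!: derivative_eq_intros)
    then have "(?p has_vector_derivative w) (at r)"
      by (rule has_vector_derivative_transform_within_open[of _ _ _ "{..<m}"])
         (use True r in \<open>auto simp: poly_curve_def\<close>)
    then show ?thesis using True by (simp add: k_def)
  next
    case False
    have "((\<lambda>r. \<gamma> s + (m - s) *\<^sub>R w + (r - m) *\<^sub>R w') has_vector_derivative w') (at r)"
      by (auto intro!: derivative_eq_intros)
    then have "(?p has_vector_derivative w') (at r)"
      by (rule has_vector_derivative_transform_within_open[of _ _ _ "{m<..}"])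
         (use False r in \<open>auto simp: poly_curve_def\<close>)
    then show ?thesis using False by (simp add: k_def)
  qed
  have "integral {s..t} (\<lambda>r. (norm (vel r))\<^sup>2) + integral {s..t} (\<lambda>r. V (\<gamma> r))
    \<le> integral {s..t} (\<lambda>r. (norm (k r))\<^sup>2) + integral {s..t} (\<lambda>r. V (?p r))"
  proof (rule comparison[of s t ?p "{m}" k])
    show "?p s = \<gamma> s" "?p t = \<gamma> t" using st e by (auto simp: poly_curve_def)
    show "dist (?p r) (\<gamma> r) \<le> \<rho>" if "r \<in> {s..t}" for r using dist_in_half_ball[OF pb[OF that] b[OF that]] .
  qed (use st ac der kI in auto)
  then show "Kin s t + integral {s..t} (\<lambda>r. V (\<gamma> r)) \<le> (m - s) * (norm w)\<^sup>2 + (t - m) * (norm w')\<^sup>2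
       + integral {s..t} (\<lambda>r. V (?p r))"
    using integral_unique[OF kI] by (simp add: Kin_def)
qed

text \<open>Moving a fraction \<open>\<epsilon>\<close> of the way to the chord changes the velocity
  to \<open>vel - \<epsilon> (vel - v)\<close>, and \<open>vel - v\<close> has integral zero against
  the constant \<open>v\<close>. The kinetic energy therefore drops by exactly
  \<open>2 * \<epsilon> - \<epsilon>^2\<close> times the variance, a gain of first order in
  \<open>\<epsilon>\<close>.\<close>

lemma comparison_chord:
  assumes st: "0 \<le> s" "s < t" "t \<le> \<delta>" and b: "\<And>r. r \<in> {s..t} \<Longrightarrow> \<gamma> r \<in> ball y (\<rho>/2)" and \<epsilon>: "0 \<le> \<epsilon>" "\<epsilon> \<le> 1"
  shows "(2 * \<epsilon> - \<epsilon>\<^sup>2) * (Kin s t - (norm (\<gamma> t - \<gamma> s))\<^sup>2 / (t - s)) + integral {s..t} (\<lambda>r. V (\<gamma> r))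
       \<le> integral {s..t} (\<lambda>r. V (\<gamma> r + \<epsilon> *\<^sub>R (\<gamma> s + ((r - s) / (t - s)) *\<^sub>R (\<gamma> t - \<gamma> s) - \<gamma> r)))"
proof -
  define v where "v = (1 / (t - s)) *\<^sub>R (\<gamma> t - \<gamma> s)"
  define l where "l r = \<gamma> s + ((r - s) / (t - s)) *\<^sub>R (\<gamma> t - \<gamma> s)" for r
  have l_eq: "l r = \<gamma> s + (r - s) *\<^sub>R v" for r by (simp add: l_def v_def)
  define \<sigma> where "\<sigma> r = \<gamma> r + \<epsilon> *\<^sub>R (l r - \<gamma> r)" for r
  define k where "k r = (1 - \<epsilon>) *\<^sub>R vel r + \<epsilon> *\<^sub>R v" for r
  have ac\<gamma>: "abs_cont_on s t \<gamma>" using abs_cont_on_subinterval[OF \<gamma>_ac] st by auto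
  have acl: "abs_cont_on s t l" unfolding l_eq[abs_def] by (rule abs_cont_on_linear)
  have \<sigma>_eq: "\<sigma> r = (1 - \<epsilon>) *\<^sub>R \<gamma> r + \<epsilon> *\<^sub>R l r" for r by (simp add: \<sigma>_def algebra_simps)
  have ac: "abs_cont_on s t \<sigma>"
  proof (rule abs_cont_on_dominated[OF ac\<gamma> acl zero_le_one])
    fix r q
    have "\<sigma> q - \<sigma> r = (1 - \<epsilon>) *\<^sub>R (\<gamma> q - \<gamma> r) + \<epsilon> *\<^sub>R (l q - l r)" by (simp add: \<sigma>_eq algebra_simps)
    then have "norm (\<sigma> q - \<sigma> r) \<le> (1 - \<epsilon>) * norm (\<gamma> q - \<gamma> r) + \<epsilon> * norm (l q - l r)"
      using \<epsilon> by (metis abs_of_nonneg diff_ge_0_iff_ge norm_scaleR norm_triangle_ineq)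
    also have "\<dots> \<le> 1 * norm (\<gamma> q - \<gamma> r) + 1 * norm (l q - l r)"
      using \<epsilon> by (intro add_mono mult_right_mono) auto
    finally show "norm (\<sigma> q - \<sigma> r) \<le> 1 * (norm (\<gamma> q - \<gamma> r) + norm (l q - l r))" by simp
  qed
  have lb: "l r \<in> ball y (\<rho>/2)" if r: "r \<in> {s..t}" for r
  proof -
    have u: "0 \<le> (r - s) / (t - s)" "(r - s) / (t - s) \<le> 1" using st r by auto
    have "(1 - (r - s) / (t - s)) *\<^sub>R \<gamma> s + ((r - s) / (t - s)) *\<^sub>R \<gamma> t \<in> ball y (\<rho>/2)"
      by (rule convexD[OF convex_ball]) (use b[of s] b[of t] st r u in auto)
    moreover have "(1 - (r - s) / (t - s)) *\<^sub>R \<gamma> s + ((r - s) / (t - s)) *\<^sub>R \<gamma> t = l r"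
      by (simp add: l_def algebra_simps)
    ultimately show ?thesis by simp
  qed
  have \<sigma>b: "\<sigma> r \<in> ball y (\<rho>/2)" if r: "r \<in> {s..t}" for r
    unfolding \<sigma>_eq by (rule convexD[OF convex_ball]) (use b[OF r] lb[OF r] \<epsilon> in auto)
  obtain N0 where N0: "negligible N0" "\<And>t. t \<in> {0..\<delta>} - N0 \<Longrightarrow> (\<gamma> has_vector_derivative vel t) (at t)"
    using abs_cont_on_ae_derivative[OF \<gamma>_ac] unfolding vel_def by metis
  have der: "(\<sigma> has_vector_derivative k r) (at r)" if r: "r \<in> {s<..<t} - N0" for r
  proof -
    have "(\<gamma> has_vector_derivative vel r) (at r)" using N0(2)[of r] r st by auto
    then show ?thesis unfolding \<sigma>_eq[abs_def] k_def l_eq by (auto intro!: derivative_eq_intros)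
  qed
  let ?E = "Kin s t - (norm (\<gamma> t - \<gamma> s))\<^sup>2 / (t - s)"
  have kI: "((\<lambda>r. (norm (k r))\<^sup>2) has_integral Kin s t - (2 * \<epsilon> - \<epsilon>\<^sup>2) * ?E) {s..t}"
  proof -
    have dev: "((\<lambda>r. (norm (vel r - v))\<^sup>2) has_integral ?E) {s..t}" unfolding v_def by (rule vel_dev[OF st])
    have 0: "((\<lambda>r. (norm (vel r))\<^sup>2) has_integral Kin s t) {s..t}"
      unfolding Kin_def using st by (intro integrable_integral vel_sq_integrable) auto
    have vI: "((\<lambda>r. v \<bullet> (vel r - v)) has_integral 0) {s..t}"
    proof -
      have "((\<lambda>r. vel r - v) has_integral (\<gamma> t - \<gamma> s) - (t - s) *\<^sub>R v) {s..t}"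
        using has_integral_const_real[of v s t] st by (intro has_integral_diff vel_integral) auto
      from has_integral_linear[OF this bounded_linear_inner_right[of v]]
      show ?thesis using st by (simp add: o_def v_def)
    qed
    have "(norm (k r))\<^sup>2 = (norm (vel r))\<^sup>2 - 2 * \<epsilon> * (v \<bullet> (vel r - v)) - (2 * \<epsilon> - \<epsilon>\<^sup>2) * (norm (vel r - v))\<^sup>2" for r
    proof -
      have k: "k r = vel r - \<epsilon> *\<^sub>R (vel r - v)" by (simp add: k_def algebra_simps)
      have "(norm (k r))\<^sup>2 = (norm (vel r))\<^sup>2 - 2 * \<epsilon> * (vel r \<bullet> (vel r - v)) + \<epsilon>\<^sup>2 * (norm (vel r - v))\<^sup>2"
        unfolding k power2_norm_eq_inner
        by (simp add: inner_diff_left inner_diff_right inner_commute power2_eq_square algebra_simps)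
      moreover have "vel r \<bullet> (vel r - v) = v \<bullet> (vel r - v) + (norm (vel r - v))\<^sup>2"
        unfolding power2_norm_eq_inner by (simp add: inner_diff_left inner_diff_right inner_commute)
      ultimately show ?thesis by algebra
    qed
    then show ?thesis
      using has_integral_diff[OF has_integral_diff[OF 0 has_integral_mult_right[OF vI, of "2 * \<epsilon>"]]
          has_integral_mult_right[OF dev, of "2 * \<epsilon> - \<epsilon>\<^sup>2"]] by simp
  qed
  have "integral {s..t} (\<lambda>r. (norm (vel r))\<^sup>2) + integral {s..t} (\<lambda>r. V (\<gamma> r))
    \<le> integral {s..t} (\<lambda>r. (norm (k r))\<^sup>2) + integral {s..t} (\<lambda>r. V (\<sigma> r))"
  proof (rule comparison[of s t \<sigma> N0 k])
    show "\<sigma> s = \<gamma> s" "\<sigma> t = \<gamma> t" using st by (auto simp: \<sigma>_def l_def)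
    show "dist (\<sigma> r) (\<gamma> r) \<le> \<rho>" if "r \<in> {s..t}" for r using dist_in_half_ball[OF \<sigma>b[OF that] b[OF that]] .
  qed (use st ac der kI N0(1) in auto)
  then show "(2 * \<epsilon> - \<epsilon>\<^sup>2) * ?E + integral {s..t} (\<lambda>r. V (\<gamma> r))
     \<le> integral {s..t} (\<lambda>r. V (\<gamma> r + \<epsilon> *\<^sub>R (\<gamma> s + ((r - s) / (t - s)) *\<^sub>R (\<gamma> t - \<gamma> s) - \<gamma> r)))"
    using integral_unique[OF kI] by (simp add: Kin_def \<sigma>_def l_def)
qed

end

section \<open>Zones met on one side of a point\<close>

lemma tendsto_mult_powr_zero:
  fixes \<alpha> :: real
  assumes "\<alpha> > 0"
  shows "((\<lambda>T. B * T powr \<alpha>) \<longlongrightarrow> 0) (at_right 0)"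
proof -
  have "((\<lambda>T::real. T powr \<alpha>) \<longlongrightarrow> 0 powr \<alpha>) (at_right 0)"
    using assms by (intro tendsto_powr2 tendsto_intros eventually_at_rightI[of 0 1]) auto
  then have "((\<lambda>T. B * T powr \<alpha>) \<longlongrightarrow> B * 0 powr \<alpha>) (at_right 0)" by (rule tendsto_mult[OF tendsto_const])
  then show ?thesis by simp
qed

text \<open>Passing from a good scale \<open>T\<close> to a good scale in [T/4, T/2] costs
  \<open>C * T powr \<alpha>\<close>, and the costs form a geometric series. Good scales need not
  fill an interval; the factor 1/4 ensures that consecutive windows [T/4, T] leave no gap. It is
  applied with \<open>\<alpha> = 1/4\<close> to obtain a one-sided velocity and with
  \<open>\<alpha> = 1\<close> to obtain derivatives inside a zone.\<close>

lemma dyadic_limit: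
  fixes u :: "real \<Rightarrow> 'a::banach"
  assumes G0: "\<And>T. T \<in> G \<Longrightarrow> 0 < T" and ne: "G \<noteq> {}" and \<alpha>: "\<alpha> > 0" and C: "C \<ge> 0"
    and step: "\<And>T. T \<in> G \<Longrightarrow> \<exists>T'\<in>G. T/4 \<le> T' \<and> T' \<le> T/2"
    and osc: "\<And>T s. T \<in> G \<Longrightarrow> T/4 \<le> s \<Longrightarrow> s \<le> T \<Longrightarrow> norm (u s - u T) \<le> C * T powr \<alpha>"
  obtains v where "\<And>T s. T \<in> G \<Longrightarrow> 0 < s \<Longrightarrow> s \<le> T \<Longrightarrow> norm (u s - v) \<le> 2 * C / (1 - (1/2) powr \<alpha>) * T powr \<alpha>"
    "\<And>\<epsilon>. \<epsilon> > 0 \<Longrightarrow> \<exists>T\<in>G. T < \<epsilon>"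
proof -
  define q where "q = (1/2::real) powr \<alpha>"
  have "(1/2::real) powr \<alpha> < 1 powr \<alpha>" using \<alpha> by (intro powr_less_mono2) auto
  then have q: "0 < q" "q < 1" by (auto simp: q_def)
  \<comment> \<open>The sum of the geometric series: \<open>B\<close> solves
    \<open>C + B * q = B\<close>, so the bound reproduces itself in the induction on scales.\<close>
  define B where "B = C / (1 - q)"
  have B: "B \<ge> 0" "C + B * q = B" using C q by (auto simp: B_def field_simps)
  have small: "\<exists>T\<in>G. T < \<epsilon>" if e: "\<epsilon> > 0" for \<epsilon>
  proof -
    obtain T0 where T0: "T0 \<in> G" using ne by blast
    have "\<exists>T\<in>G. T \<le> T0 / 2 ^ n" for n
    proof (induction n)
      case 0 then show ?case using T0 by auto
    next
      case (Suc n)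
      then obtain T where T: "T \<in> G" "T \<le> T0 / 2 ^ n" by blast
      obtain T' where "T' \<in> G" "T' \<le> T/2" using step[OF T(1)] by blast
      then show ?case using T by (intro bexI[of _ T']) auto
    qed
    moreover obtain n where "T0 / 2 ^ n < \<epsilon>"
      using real_arch_pow_inv[of "\<epsilon> / T0" "1/2"] e G0[OF T0] by (auto simp: field_simps power_divide)
    ultimately show ?thesis by (meson le_less_trans)
  qed
  have main: "norm (u s - u T) \<le> B * T powr \<alpha>" if "T \<in> G" "T / 2 ^ n \<le> s" "s \<le> T" for n T s
    using that
  proof (induction n arbitrary: T)
    case 0
    then show ?case using B by simp
  next
    case (Suc n)
    have T0: "T > 0" using G0 Suc.prems by blast
    obtain T' where T': "T' \<in> G" "T/4 \<le> T'" "T' \<le> T/2" using step[OF Suc.prems(1)] by blast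
    show ?case
    proof (cases "T/4 \<le> s")
      case True
      have "C \<le> B" using B q by (metis add_increasing2 le_add_same_cancel1 less_imp_le mult_nonneg_nonneg order_refl)
      then have "C * T powr \<alpha> \<le> B * T powr \<alpha>" by (intro mult_right_mono) auto
      then show ?thesis using osc[OF Suc.prems(1) True Suc.prems(3)] by simp
    next
      case False
      have "T' / 2 ^ n \<le> (T / 2) / 2 ^ n" using T' by (intro divide_right_mono) auto
      then have "norm (u s - u T') \<le> B * T' powr \<alpha>"
        using T' False Suc.prems(2) by (intro Suc.IH) auto
      also have "\<dots> \<le> B * (T/2) powr \<alpha>"
        using B T' G0[OF T'(1)] \<alpha> by (intro mult_left_mono powr_mono2) auto
      also have "(T/2) powr \<alpha> = q * T powr \<alpha>"
        unfolding q_def using T0 by (simp add: powr_divide)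
      finally have 1: "norm (u s - u T') \<le> B * (q * T powr \<alpha>)" .
      have 2: "norm (u T' - u T) \<le> C * T powr \<alpha>" using T' T0 by (intro osc Suc.prems) auto
      have "norm (u s - u T) \<le> norm (u s - u T') + norm (u T' - u T)"
        using norm_triangle_ineq[of "u s - u T'" "u T' - u T"] by simp
      also have "\<dots> \<le> (C + B * q) * T powr \<alpha>" using 1 2 by (simp add: algebra_simps)
      finally show ?thesis using B(2) by simp
    qed
  qed
  have osc': "norm (u s - u T) \<le> B * T powr \<alpha>" if T: "T \<in> G" "0 < s" "s \<le> T" for T s
  proof -
    obtain n where "T / 2 ^ n < s"
      using real_arch_pow_inv[of "s / T" "1/2"] T G0[OF T(1)] by (auto simp: field_simps power_divide)
    then show ?thesis using main[of T n s] T by simp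
  qed
  have "\<forall>n::nat. \<exists>T\<in>G. T < 1 / real (Suc n)" using small by simp
  then obtain S where S: "\<And>n. S n \<in> G" "\<And>n::nat. S n < 1 / real (Suc n)" by metis
  note lim0 = tendsto_mult_powr_zero[OF \<alpha>, of B]
  have Bsmall: "\<exists>T\<in>G. B * T powr \<alpha> < \<epsilon>" if e: "\<epsilon> > 0" for \<epsilon>
  proof -
    have "\<forall>\<^sub>F T in at_right 0. B * T powr \<alpha> < \<epsilon>" using order_tendstoD(2)[OF lim0 e] .
    then obtain b where "b > 0" "\<And>T. 0 < T \<Longrightarrow> T < b \<Longrightarrow> B * T powr \<alpha> < \<epsilon>"
      by (auto simp: eventually_at_right_field)
    then show ?thesis using small[of b] G0 by blast
  qed
  have ev_le: "\<exists>N. \<forall>n\<ge>N. S n \<le> T" if T: "T > 0" for T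
  proof -
    obtain N where N: "1 / real (Suc N) < T" using reals_Archimedean[OF T] by (auto simp: inverse_eq_divide)
    have "S n \<le> T" if "n \<ge> N" for n
    proof -
      have "1 / real (Suc n) \<le> 1 / real (Suc N)" using that by (intro divide_left_mono) auto
      then show ?thesis using S(2)[of n] N by linarith
    qed
    then show ?thesis by blast
  qed
  have "Cauchy (\<lambda>n. u (S n))"
  proof (rule metric_CauchyI)
    fix \<epsilon> :: real assume "\<epsilon> > 0"
    then obtain T where T: "T \<in> G" "B * T powr \<alpha> < \<epsilon>/2" using Bsmall[of "\<epsilon>/2"] by auto
    obtain N where N: "\<forall>n\<ge>N. S n \<le> T" using ev_le G0[OF T(1)] by blast
    have "dist (u (S n)) (u T) < \<epsilon>/2" if "n \<ge> N" for n
      using osc'[OF T(1) G0[OF S(1)], of n] N that T(2) by (auto simp: dist_norm)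
    then show "\<exists>M. \<forall>m\<ge>M. \<forall>n\<ge>M. dist (u (S m)) (u (S n)) < \<epsilon>"
      by (meson dist_triangle_half_l)
  qed
  then obtain v where v: "(\<lambda>n. u (S n)) \<longlonglongrightarrow> v" using Cauchy_convergent_iff convergent_def by blast
  have "norm (u s - v) \<le> 2 * B * T powr \<alpha>" if T: "T \<in> G" "0 < s" "s \<le> T" for T s
  proof -
    obtain N where N: "\<forall>n\<ge>N. S n \<le> T" using ev_le G0[OF T(1)] by blast
    have "(\<lambda>n. norm (u (S n) - u T)) \<longlonglongrightarrow> norm (v - u T)" by (intro tendsto_intros v)
    moreover have "\<exists>N. \<forall>n\<ge>N. norm (u (S n) - u T) \<le> B * T powr \<alpha>"
      using osc'[OF T(1) G0[OF S(1)]] N by blast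
    ultimately have "norm (v - u T) \<le> B * T powr \<alpha>" by (rule LIMSEQ_le_const2)
    then show ?thesis
      using osc'[OF T] norm_triangle_ineq4[of "u s - u T" "v - u T"] by simp
  qed
  then show thesis using that[of v] small by (simp add: B_def q_def)
qed

text \<open>Completing the square: the extra kinetic energy of a two-leg path over the straight one
  is a multiple of the squared distance of its corner from the matching point of the chord. It
  converts an energy excess into closeness to the chord.\<close>

lemma two_chord_excess:
  fixes z z' :: "'a::real_inner"
  assumes "0 < s" "s < T"
  shows "(norm z)\<^sup>2 / s + (norm (z' - z))\<^sup>2 / (T - s) = (norm z')\<^sup>2 / T + (norm (z - (s/T) *\<^sub>R z'))\<^sup>2 * T / (s * (T - s))"
proof -
  have "(norm (z' - z))\<^sup>2 = (norm z')\<^sup>2 - 2 * (z \<bullet> z') + (norm z)\<^sup>2"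
    by (simp add: power2_norm_eq_inner inner_diff_left inner_diff_right inner_commute)
  moreover have "(norm (z - (s/T) *\<^sub>R z'))\<^sup>2 = (norm z)\<^sup>2 - 2 * (s/T) * (z \<bullet> z') + (s/T)\<^sup>2 * (norm z')\<^sup>2"
    unfolding power2_norm_eq_inner
    by (simp add: inner_diff_left inner_diff_right inner_commute power2_eq_square algebra_simps)
  moreover have "a / s + (b - 2 * p + a) / (T - s) = b / T + (a - 2 * (s/T) * p + (s/T)\<^sup>2 * b) * T / (s * (T - s))" for a b p :: real
    using assms by (simp add: divide_simps power2_eq_square) (simp add: algebra_simps)
  ultimately show ?thesis by simp
qed

text \<open>Only data that survive time reversal are kept: an additive kinetic energy with its
  Cauchy-Schwarz bound, and minimality against broken lines. Both
  \<open>\<lambda>s. \<gamma> (\<tau> + s)\<close> and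
  \<open>\<lambda>s. \<gamma> (\<tau> - s)\<close> are instances, so the two sides of
  \<open>\<tau>\<close> share one argument.\<close>

locale one_sided = potential K h h' for K :: "'a::euclidean_space set" and h h' +
  fixes c :: "real \<Rightarrow> 'a" and T0 \<beta> C :: real and Kn :: "real \<Rightarrow> real \<Rightarrow> real"
  assumes T0: "T0 > 0" and \<beta>: "\<beta> > 0" and C: "C \<ge> 0"
    and cont: "continuous_on {0..T0} c"
    and Kn_add: "\<And>s r t. \<lbrakk>0 \<le> s; s \<le> r; r \<le> t; t \<le> T0\<rbrakk> \<Longrightarrow> Kn s t = Kn s r + Kn r t"
    and Kn_ge: "\<And>s t. \<lbrakk>0 \<le> s; s < t; t \<le> T0\<rbrakk> \<Longrightarrow> (norm (c t - c s))\<^sup>2 \<le> (t - s) * Kn s t"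
    and lip: "\<And>e y z. \<lbrakk>e \<in> convex hull K; y \<in> ball (c 0) \<beta>; z \<in> ball (c 0) \<beta>\<rbrakk> \<Longrightarrow> \<bar>H e y - H e z\<bar> \<le> C * norm (y - z)"
    and c_ball: "\<And>r. r \<in> {0..T0} \<Longrightarrow> c r \<in> ball (c 0) \<beta>"
    and cmp: "\<And>s m t w w'. \<lbrakk>0 \<le> s; s < m; m < t; t \<le> T0; c t = c s + (m - s) *\<^sub>R w + (t - m) *\<^sub>R w';
       c s + (m - s) *\<^sub>R w \<in> ball (c 0) \<beta>\<rbrakk> \<Longrightarrow>
       Kn s t + integral {s..t} (\<lambda>r. V (c r)) \<le> (m - s) * (norm w)\<^sup>2 + (t - m) * (norm w')\<^sup>2
         + integral {s..t} (\<lambda>r. V (poly_curve s m (c s) w w' r))"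
begin

abbreviation x where "x \<equiv> c 0"

lemma Kn_nonneg: "0 \<le> s \<Longrightarrow> s \<le> t \<Longrightarrow> t \<le> T0 \<Longrightarrow> 0 \<le> Kn s t"
proof (cases "s = t")
  case True
  assume "0 \<le> s" "s \<le> t" "t \<le> T0"
  then show ?thesis using Kn_add[of s s s] True by simp
next
  case False
  assume *: "0 \<le> s" "s \<le> t" "t \<le> T0"
  then have "0 \<le> (t - s) * Kn s t" using Kn_ge[of s t] False by (meson le_less order_trans zero_le_power2)
  then show ?thesis using * False by (simp add: zero_le_mult_iff)
qed

definition q where "q = sqrt (Kn 0 T0)"

lemma q_nonneg: "q \<ge> 0" using Kn_nonneg[of 0 T0] T0 by (simp add: q_def)

text \<open>Cauchy-Schwarz for the kinetic energy on [0, s]: the Hoelder exponent 1/2, which is all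
  the regularity available at this stage.\<close>

lemma dist_bound: "0 \<le> s \<Longrightarrow> s \<le> T0 \<Longrightarrow> norm (c s - x) \<le> q * sqrt s"
proof (cases "s = 0")
  case False
  assume s: "0 \<le> s" "s \<le> T0"
  have "(norm (c s - x))\<^sup>2 \<le> s * Kn 0 s" using Kn_ge[of 0 s] s False by simp
  also have "\<dots> \<le> s * Kn 0 T0"
    using Kn_add[of 0 s T0] Kn_nonneg[of s T0] s by (intro mult_left_mono) auto
  finally have "sqrt ((norm (c s - x))\<^sup>2) \<le> sqrt (s * Kn 0 T0)" by (rule real_sqrt_le_mono)
  then show ?thesis by (simp add: q_def real_sqrt_mult mult.commute)
qed (use q_nonneg in auto)

lemma dist_bound': "0 \<le> s \<Longrightarrow> s \<le> T \<Longrightarrow> T \<le> T0 \<Longrightarrow> norm (c s - x) \<le> q * sqrt T"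
  using dist_bound[of s] q_nonneg by (meson mult_left_mono order_trans real_sqrt_le_iff)

lemma Vc_integrable: "0 \<le> s \<Longrightarrow> t \<le> T0 \<Longrightarrow> (\<lambda>r. V (c r)) integrable_on {s..t}"
  by (intro V_integrable continuous_on_subset[OF cont]) auto

definition \<phi> where "\<phi> r = norm (x - etaK K (c r))"

lemma H_x: "H e x = h ((norm (x - e))\<^sup>2)" by (simp add: H_def)

lemma V_lower: "0 \<le> r \<Longrightarrow> r \<le> T \<Longrightarrow> T \<le> T0 \<Longrightarrow> h ((\<phi> r)\<^sup>2) - C * (q * sqrt T) \<le> V (c r)"
proof -
  assume r: "0 \<le> r" "r \<le> T" "T \<le> T0"
  have "\<bar>H (etaK K (c r)) (c r) - H (etaK K (c r)) x\<bar> \<le> C * norm (c r - x)"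
    using r \<beta> c_ball[of r] by (intro lip eta_hull_K) auto
  also have "\<dots> \<le> C * (q * sqrt T)" using r C by (intro mult_left_mono dist_bound') auto
  finally show ?thesis using V_eq_H[of "c r" "etaK K (c r)"] by (simp add: H_x \<phi>_def)
qed

lemma V_upper:
  assumes "y \<in> phase e" "e \<in> convex hull K" "y \<in> ball x \<beta>" "norm (y - x) \<le> d"
  shows "V y \<le> h ((norm (x - e))\<^sup>2) + C * d"
proof -
  have "V y \<le> H e y" using assms V_le by blast
  also have "\<dots> \<le> H e x + C * norm (y - x)" using lip[OF assms(2,3), of x] \<beta> by auto
  also have "C * norm (y - x) \<le> C * d" using assms C by (intro mult_left_mono)
  finally show ?thesis by (simp add: H_x)
qed

text \<open>Minimality against a broken line whose legs have the same velocity; the midpoint is only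
  a formal corner.\<close>

lemma chord:
  assumes st: "0 \<le> s" "s < t" "t \<le> T0"
  defines "l \<equiv> \<lambda>r. c s + ((r - s) / (t - s)) *\<^sub>R (c t - c s)"
  shows "Kn s t - (norm (c t - c s))\<^sup>2 / (t - s) + integral {s..t} (\<lambda>r. V (c r)) \<le> integral {s..t} (\<lambda>r. V (l r))"
    and "r \<in> {s..t} \<Longrightarrow> l r \<in> closed_segment (c s) (c t)"
    and "continuous_on {s..t} l"
proof -
  define m where "m = (s + t) / 2"
  define w where "w = (1 / (t - s)) *\<^sub>R (c t - c s)"
  have m: "s < m" "m < t" using st by (auto simp: m_def)
  have seg: "l r \<in> closed_segment (c s) (c t)" if "r \<in> {s..t}" for r
    unfolding closed_segment_def l_def using that st
    by (intro CollectI exI[of _ "(r - s) / (t - s)"]) (auto simp: algebra_simps)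
  show "r \<in> {s..t} \<Longrightarrow> l r \<in> closed_segment (c s) (c t)" by (rule seg)
  show "continuous_on {s..t} l" unfolding l_def using st by (intro continuous_intros) auto
  have eq: "poly_curve s m (c s) w w = l"
    by (rule ext) (simp add: poly_curve_same l_def w_def)
  have "l m \<in> ball x \<beta>"
    using seg[of m] m closed_segment_subset[of "c s" "ball x \<beta>" "c t"] c_ball[of s] c_ball[of t] st by auto
  then have "c s + (m - s) *\<^sub>R w \<in> ball x \<beta>" by (simp add: l_def w_def)
  moreover have "c t = c s + (m - s) *\<^sub>R w + (t - m) *\<^sub>R w"
  proof -
    have "(m - s) *\<^sub>R w + (t - m) *\<^sub>R w = (t - s) *\<^sub>R w" by (simp add: algebra_simps)
    also have "\<dots> = c t - c s" using st by (simp add: w_def)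
    finally show ?thesis by (simp add: add.assoc)
  qed
  ultimately have "Kn s t + integral {s..t} (\<lambda>r. V (c r)) \<le> (m - s) * (norm w)\<^sup>2 + (t - m) * (norm w)\<^sup>2
         + integral {s..t} (\<lambda>r. V (l r))"
    using cmp[of s m t w w] m st unfolding eq by simp
  moreover have "(m - s) * (norm w)\<^sup>2 + (t - m) * (norm w)\<^sup>2 = (norm (c t - c s))\<^sup>2 / (t - s)"
  proof -
    have "(m - s) * (norm w)\<^sup>2 + (t - m) * (norm w)\<^sup>2 = (t - s) * (norm w)\<^sup>2" by (simp add: algebra_simps)
    also have "\<dots> = (norm (c t - c s))\<^sup>2 / (t - s)" using st by (simp add: w_def power_divide power2_eq_square)
    finally show ?thesis .
  qed
  ultimately show "Kn s t - (norm (c t - c s))\<^sup>2 / (t - s) + integral {s..t} (\<lambda>r. V (c r)) \<le> integral {s..t} (\<lambda>r. V (l r))"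
    by simp
qed

text \<open>There are finitely many labels and \<open>h\<close> is strictly increasing, so the
  larger values keep a positive distance from \<open>h (w\<^sup>2)\<close>. Inserting 1 keeps the
  minimum meaningful when no label is farther than \<open>w\<close>.\<close>

lemma gap: "\<exists>\<kappa>>0. \<forall>e\<in>calE K. norm (x - e) \<le> w \<or> h (w\<^sup>2) + \<kappa> \<le> h ((norm (x - e))\<^sup>2)" if w: "w \<ge> 0"
proof -
  define S where "S = insert 1 ((\<lambda>e. h ((norm (x - e))\<^sup>2) - h (w\<^sup>2)) ` {e \<in> calE K. w < norm (x - e)})"
  have fin: "finite S" using finite_calE by (simp add: S_def)
  have pos: "0 < z" if "z \<in> S" for z
  proof -
    have "h (w\<^sup>2) < h ((norm (x - e))\<^sup>2)" if "w < norm (x - e)" for e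
    proof (rule strict_mono_onD[OF h_strict])
      show "w\<^sup>2 < (norm (x - e))\<^sup>2" using that w by (intro power_strict_mono) auto
    qed auto
    then show ?thesis using that by (auto simp: S_def)
  qed
  have "Min S > 0" using fin pos by (subst Min_gr_iff) (auto simp: S_def)
  moreover have "norm (x - e) \<le> w \<or> h (w\<^sup>2) + Min S \<le> h ((norm (x - e))\<^sup>2)" if "e \<in> calE K" for e
  proof (cases "norm (x - e) \<le> w")
    case False
    then have "Min S \<le> h ((norm (x - e))\<^sup>2) - h (w\<^sup>2)" using fin that by (intro Min_le) (auto simp: S_def)
    then show ?thesis by simp
  qed simp
  ultimately show ?thesis by blast
qed

lemma c_tendsto: "(c \<longlongrightarrow> x) (at_right 0)"
  using continuous_on_Icc_at_rightD[OF cont T0] .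

lemma opt_c: "\<forall>\<^sub>F r in at_right 0. opt K (c r) = amax (opt K x) (c r - x)"
proof -
  have "((\<lambda>r. c r - x) \<longlongrightarrow> x - x) (at_right 0)" by (intro tendsto_intros c_tendsto)
  then have "filterlim (\<lambda>r. c r - x) (nhds 0) (at_right 0)" by simp
  then have "\<forall>\<^sub>F r in at_right 0. opt K (x + (c r - x)) = amax (opt K x) (c r - x)"
    using opt_local by (rule filterlim_iff[THEN iffD1, rule_format])
  then show ?thesis by simp
qed

lemma eta_calE: "etaK K y \<in> calE K" by (simp add: calE_def)

end

section \<open>Existence of a one-sided velocity\<close>

context one_sided
begin

definition u where "u s = (1 / s) *\<^sub>R (c s - x)"

lemma c_u: "s \<noteq> 0 \<Longrightarrow> c s = x + s *\<^sub>R u s"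
  by (simp add: u_def)

text \<open>Among finitely many values of \<open>\<phi>\<close>, those that do not recur near 0
  disappear after some time; \<open>w\<close> is the least recurring one. Since \<open>h\<close> is
  increasing, it is also the cheapest.\<close>

lemma eventually_lowest_zone:
  obtains w T1 where "w \<ge> 0" "0 < T1" "T1 \<le> T0" "\<And>r. 0 < r \<Longrightarrow> r < T1 \<Longrightarrow> w \<le> \<phi> r"
    "\<And>\<epsilon>. \<epsilon> > 0 \<Longrightarrow> \<exists>r. 0 < r \<and> r < \<epsilon> \<and> \<phi> r = w"
proof -
  define \<Phi> where "\<Phi> = (\<lambda>e. norm (x - e)) ` calE K"
  have fin: "finite \<Phi>" using finite_calE by (simp add: \<Phi>_def)
  have in\<Phi>: "\<phi> r \<in> \<Phi>" for r by (auto simp: \<phi>_def \<Phi>_def eta_calE)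
  define S where "S = {w \<in> \<Phi>. \<exists>\<^sub>F r in at_right 0. \<phi> r = w}"
  have "\<forall>\<^sub>F r in at_right 0. \<forall>w\<in>\<Phi> - S. \<phi> r \<noteq> w"
    using fin by (intro eventually_ball_finite) (auto simp: S_def frequently_def)
  then have ev: "\<forall>\<^sub>F r in at_right 0. \<phi> r \<in> S" using in\<Phi> by (auto elim!: eventually_mono)
  then have ne: "S \<noteq> {}" using eventually_happens'[OF trivial_limit_at_right_real] by fastforce
  have finS: "finite S" using fin by (simp add: S_def)
  define w where "w = Min S"
  have wS: "w \<in> S" unfolding w_def using finS ne by simp
  have "\<forall>\<^sub>F r in at_right 0. w \<le> \<phi> r" using ev finS by (auto simp: w_def elim!: eventually_mono)
  then obtain b where b: "b > 0" "\<And>r. 0 < r \<Longrightarrow> r < b \<Longrightarrow> w \<le> \<phi> r" by (auto simp: eventually_at_right_field)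
  have "\<exists>r. 0 < r \<and> r < \<epsilon> \<and> \<phi> r = w" if "\<epsilon> > 0" for \<epsilon>
  proof (rule ccontr)
    assume "\<not> ?thesis"
    then have "\<forall>\<^sub>F r in at_right 0. \<phi> r \<noteq> w" using that by (auto simp: eventually_at_right_field)
    then show False using wS by (auto simp: S_def frequently_def)
  qed
  moreover have "w \<ge> 0" using wS by (auto simp: S_def \<Phi>_def)
  ultimately show thesis using that[of w "min b T0"] b T0 by auto
qed

text \<open>Let M = C q sqrt T, the error of freezing the position in the potential at
  \<open>x\<close> on [0, T]. At a time T spent in a lowest zone the chord costs at most
  \<open>h (w\<^sup>2)\<close> + M per unit time and the curve at least \<open>h (w\<^sup>2)\<close>
  - M, so the kinetic excess over the chord is at most 2 M T. The resulting oscillation bound on the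
  slopes is fed into \<open>dyadic_limit\<close>.\<close>

lemma u_converges: "\<exists>v. (u \<longlongrightarrow> v) (at_right 0)"
proof -
  obtain w T1 where w: "w \<ge> 0" "0 < T1" "T1 \<le> T0" "\<And>r. 0 < r \<Longrightarrow> r < T1 \<Longrightarrow> w \<le> \<phi> r"
    "\<And>\<epsilon>. \<epsilon> > 0 \<Longrightarrow> \<exists>r. 0 < r \<and> r < \<epsilon> \<and> \<phi> r = w"
    using eventually_lowest_zone by metis
  obtain \<kappa> where \<kappa>: "\<kappa> > 0" "\<forall>e\<in>calE K. norm (x - e) \<le> w \<or> h (w\<^sup>2) + \<kappa> \<le> h ((norm (x - e))\<^sup>2)"
    using gap[OF w(1)] by blast
  have "((\<lambda>T. 8 * C * (q * sqrt T)) \<longlongrightarrow> 8 * C * (q * sqrt 0)) (at_right 0)"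
    by (intro tendsto_intros filterlim_ident)
  then have "\<forall>\<^sub>F T in at_right 0. 8 * C * (q * sqrt T) < \<kappa>" using \<kappa>(1) by (intro order_tendstoD(2)) auto
  with opt_c have "\<forall>\<^sub>F T in at_right 0. opt K (c T) = amax (opt K x) (c T - x) \<and> 8 * C * (q * sqrt T) < \<kappa>"
    by (rule eventually_conj)
  then obtain b where b: "b > 0" "\<And>T. 0 < T \<Longrightarrow> T < b \<Longrightarrow> opt K (c T) = amax (opt K x) (c T - x) \<and> 8 * C * (q * sqrt T) < \<kappa>"
    by (auto simp: eventually_at_right_field)
  define T2 where "T2 = min b T1"
  define G where "G = {T. 0 < T \<and> T < T2 \<and> \<phi> T = w}"
  have T2: "T2 > 0" using b w by (simp add: T2_def)
  have hle: "h (w\<^sup>2) \<le> h ((\<phi> r)\<^sup>2)" if "0 < r" "r < T1" for r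
    using w(4)[OF that] w(1) by (intro h_mono power_mono) auto
  have G: "0 < T" "T < T0" "T < T1" "T < b" "\<phi> T = w" if "T \<in> G" for T
    using that w(3) by (auto simp: G_def T2_def)
  let ?M = "\<lambda>T. C * (q * sqrt T)"
  \<comment> \<open>The chord to a lowest zone stays in the closure of that zone, so it can only be beaten by O(T sqrt T).\<close>
  have up: "integral {0..T} (\<lambda>r. V (c r)) + (Kn 0 T - (norm (c T - x))\<^sup>2 / T) \<le> (h (w\<^sup>2) + ?M T) * T" if T: "T \<in> G" for T
  proof -
    note GT = G[OF T]
    define e where "e = etaK K (c T)"
    define l where "l = (\<lambda>r. x + ((r - 0) / (T - 0)) *\<^sub>R (c T - x))"
    have ch: "Kn 0 T - (norm (c T - x))\<^sup>2 / (T - 0) + integral {0..T} (\<lambda>r. V (c r)) \<le> integral {0..T} (\<lambda>r. V (l r))"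
      "\<And>r. r \<in> {0..T} \<Longrightarrow> l r \<in> closed_segment x (c T)" "continuous_on {0..T} l"
      unfolding l_def using chord[of 0 T] GT by auto
    \<comment> \<open>Near \<open>x\<close> optimality classes are contained in that of
      \<open>x\<close>, so the label at \<open>c T\<close> is a subgradient at \<open>x\<close> as
      well; both ends of the chord lie in one convex phase.\<close>
    have "hull_opt (c T) \<subseteq> hull_opt x"
      using b(2)[of T] GT amax_subset by (intro hull_mono) auto
    then have xe: "x \<in> phase e" using eta_in_hull[of "c T"] by (auto simp: phase_def e_def)
    have ce: "c T \<in> phase e" unfolding e_def by (rule phase_eta)
    have eK: "e \<in> convex hull K" unfolding e_def by (rule eta_hull_K)
    have "integral {0..T} (\<lambda>r. V (l r)) \<le> (h (w\<^sup>2) + ?M T) * (T - 0)"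
    proof (rule integral_le_const)
      show "(\<lambda>r. V (l r)) integrable_on {0..T}" using ch(3) by (rule V_integrable)
      fix r assume r: "r \<in> {0<..<T}"
      then have ls: "l r \<in> closed_segment x (c T)" using ch(2) by auto
      have lp: "l r \<in> phase e" using ls xe ce closed_segment_subset[OF _ _ convex_phase] by blast
      have lb: "l r \<in> ball x \<beta>"
        using ls closed_segment_subset[OF _ _ convex_ball, of x x \<beta> "c T"] c_ball[of T] \<beta> GT by auto
      have "l r - x = (r / T) *\<^sub>R (c T - x)" by (simp add: l_def)
      then have "norm (l r - x) = (r / T) * norm (c T - x)" using r by simp
      also have "\<dots> \<le> 1 * (q * sqrt T)" using r GT by (intro mult_mono dist_bound) auto
      finally have "norm (l r - x) \<le> q * sqrt T" by simp
      from V_upper[OF lp eK lb this] show "V (l r) \<le> h (w\<^sup>2) + ?M T"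
        using GT(5) by (simp add: \<phi>_def e_def)
    qed (use GT in auto)
    then show ?thesis using ch(1) by simp
  qed
  have low: "h (w\<^sup>2) - ?M T \<le> V (c r)" if "T \<in> G" "0 < r" "r < T" for r T
    using V_lower[of r T] hle[of r] that G[OF that(1)] by simp
  have excess: "Kn 0 T - (norm (c T - x))\<^sup>2 / T \<le> 2 * ?M T * T" if T: "T \<in> G" for T
  proof -
    have "(h (w\<^sup>2) - ?M T) * (T - 0) \<le> integral {0..T} (\<lambda>r. V (c r))"
      using G[OF T] low[OF T] by (intro integral_const_le Vc_integrable) auto
    then show ?thesis using up[OF T] by (simp add: algebra_simps)
  qed
  \<comment> \<open>Without a good time in [T/4, T/2], a quarter of the time would cost an extra
    \<open>\<kappa>\<close> per unit time, while the total saving of the chord must stay below 2 M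
    T. This forces \<open>\<kappa>\<close> to be at most 8 M, which the choice of \<open>b\<close>
    excludes.\<close>
  have step: "\<exists>T'\<in>G. T/4 \<le> T' \<and> T' \<le> T/2" if T: "T \<in> G" for T
  proof (rule ccontr)
    assume no: "\<not> ?thesis"
    note GT = G[OF T]
    have bad: "h (w\<^sup>2) + \<kappa> - ?M T \<le> V (c r)" if r: "r \<in> {T/4..T/2}" for r
    proof -
      have r0: "0 < r" "r < T" using r GT by auto
      have "\<phi> r \<noteq> w" using no r r0 GT T by (auto simp: G_def)
      then have "\<not> norm (x - etaK K (c r)) \<le> w" using w(4)[of r] r0 GT by (auto simp: \<phi>_def)
      then have "h (w\<^sup>2) + \<kappa> \<le> h ((\<phi> r)\<^sup>2)" using \<kappa>(2) eta_calE unfolding \<phi>_def by blast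
      then show ?thesis using V_lower[of r T] r0 GT by simp
    qed
    have 1: "(h (w\<^sup>2) - ?M T) * (T/4 - 0) \<le> integral {0..T/4} (\<lambda>r. V (c r))"
      using GT low[OF T] by (intro integral_const_le Vc_integrable) auto
    have 2: "(h (w\<^sup>2) + \<kappa> - ?M T) * (T/2 - T/4) \<le> integral {T/4..T/2} (\<lambda>r. V (c r))"
      using GT bad by (intro integral_const_le Vc_integrable) auto
    have 3: "(h (w\<^sup>2) - ?M T) * (T - T/2) \<le> integral {T/2..T} (\<lambda>r. V (c r))"
      using GT low[OF T] by (intro integral_const_le Vc_integrable) auto
    have "integral {0..T/4} (\<lambda>r. V (c r)) + integral {T/4..T/2} (\<lambda>r. V (c r)) = integral {0..T/2} (\<lambda>r. V (c r))"
      using GT by (intro Henstock_Kurzweil_Integration.integral_combine Vc_integrable) auto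
    moreover have "integral {0..T/2} (\<lambda>r. V (c r)) + integral {T/2..T} (\<lambda>r. V (c r)) = integral {0..T} (\<lambda>r. V (c r))"
      using GT by (intro Henstock_Kurzweil_Integration.integral_combine Vc_integrable) auto
    moreover have "0 \<le> Kn 0 T - (norm (c T - x))\<^sup>2 / T" using Kn_ge[of 0 T] GT by (simp add: field_simps)
    ultimately have "(h (w\<^sup>2) - ?M T) * (T/4 - 0) + (h (w\<^sup>2) + \<kappa> - ?M T) * (T/2 - T/4) + (h (w\<^sup>2) - ?M T) * (T - T/2)
        \<le> (h (w\<^sup>2) + ?M T) * T"
      using 1 2 3 up[OF T] by linarith
    then have "T * \<kappa> \<le> T * (8 * ?M T)" by (simp add: field_simps)
    then have "\<kappa> \<le> 8 * ?M T" using GT by (simp add: mult_le_cancel_left_pos)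
    then show False using b(2)[of T] GT by simp
  qed
  \<comment> \<open>The corner identity gives |u s - u T|^2 s <= E <= 2 M T, and with s >= T/4 this
    becomes |u s - u T|^2 <= 8 M = 8 C q sqrt T. The square root explains both \<open>B\<close> and
    the exponent 1/4.\<close>
  define B where "B = sqrt (8 * C * q)"
  have osc: "norm (u s - u T) \<le> B * T powr (1/4)" if T: "T \<in> G" and s: "T/4 \<le> s" "s \<le> T" for T s
  proof (cases "s = T")
    case True
    then show ?thesis using C q_nonneg by (simp add: B_def)
  next
    case False
    note GT = G[OF T]
    have s0: "0 < s" "s < T" using s GT False by auto
    define E where "E = Kn 0 T - (norm (c T - x))\<^sup>2 / T"
    have "(norm (c s - x))\<^sup>2 / s + (norm (c T - c s))\<^sup>2 / (T - s) \<le> Kn 0 s + Kn s T"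
      using Kn_ge[of 0 s] Kn_ge[of s T] s0 GT by (intro add_mono) (simp_all add: field_simps)
    also have "\<dots> = Kn 0 T" using Kn_add[of 0 s T] s0 GT by simp
    finally have "(norm (c s - x - (s/T) *\<^sub>R (c T - x)))\<^sup>2 * T / (s * (T - s)) \<le> E"
      using two_chord_excess[OF s0, of "c s - x" "c T - x"] unfolding E_def by simp
    then have "(norm (c s - x - (s/T) *\<^sub>R (c T - x)))\<^sup>2 * T \<le> E * (s * (T - s))"
      using s0 by (simp add: pos_divide_le_eq)
    moreover have "c s - x - (s/T) *\<^sub>R (c T - x) = s *\<^sub>R (u s - u T)"
      using s0 by (simp add: u_def scaleR_diff_right)
    ultimately have "(s * norm (u s - u T))\<^sup>2 * T \<le> E * (s * (T - s))" using s0 by simp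
    then have "s * ((norm (u s - u T))\<^sup>2 * (s * T)) \<le> s * (E * (T - s))"
      by (simp add: power_mult_distrib power2_eq_square mult_ac)
    then have "(norm (u s - u T))\<^sup>2 * (s * T) \<le> E * (T - s)" using s0 by simp
    also have "\<dots> \<le> E * T" using s0 Kn_ge[of 0 T] GT by (intro mult_left_mono) (auto simp: E_def field_simps)
    finally have "(norm (u s - u T))\<^sup>2 * s * T \<le> E * T" by (simp add: mult_ac)
    then have le: "(norm (u s - u T))\<^sup>2 * s \<le> E" using s0 by simp
    have "(norm (u s - u T))\<^sup>2 * (T/4) \<le> (norm (u s - u T))\<^sup>2 * s" using s by (intro mult_left_mono) auto
    also have "\<dots> \<le> 2 * ?M T * T" using le excess[OF T] by (simp add: E_def)
    finally have "T * (norm (u s - u T))\<^sup>2 \<le> T * (8 * ?M T)" by (simp add: mult_ac)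
    then have "(norm (u s - u T))\<^sup>2 \<le> 8 * ?M T" using GT by (simp add: mult_le_cancel_left_pos)
    then have "norm (u s - u T) \<le> sqrt (8 * ?M T)" by (simp add: real_le_rsqrt)
    also have "8 * ?M T = (8 * C * q) * sqrt T" by simp
    also have "sqrt \<dots> = B * sqrt (sqrt T)" unfolding B_def by (rule real_sqrt_mult)
    also have "sqrt (sqrt T) = T powr (1/4)" using GT by (simp add: powr_half_sqrt[symmetric] powr_powr)
    finally show ?thesis .
  qed
  have Gne: "G \<noteq> {}" using w(5)[OF T2] by (auto simp: G_def)
  define B' where "B' = 2 * B / (1 - (1/2) powr (1/4))"
  obtain v where v: "\<And>T s. T \<in> G \<Longrightarrow> 0 < s \<Longrightarrow> s \<le> T \<Longrightarrow> norm (u s - v) \<le> B' * T powr (1/4)"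
    "\<And>\<epsilon>. \<epsilon> > 0 \<Longrightarrow> \<exists>T\<in>G. T < \<epsilon>"
  proof (rule dyadic_limit[of G "1/4" B u])
    show "B \<ge> 0" using C q_nonneg by (simp add: B_def)
  qed (use G(1) Gne step osc in \<open>auto simp: B'_def\<close>)
  have lim0: "((\<lambda>T. B' * T powr (1/4)) \<longlongrightarrow> 0) (at_right 0)"
    by (rule tendsto_mult_powr_zero) simp
  have "(u \<longlongrightarrow> v) (at_right 0)"
  proof (rule tendstoI)
    fix \<epsilon> :: real assume e: "\<epsilon> > 0"
    obtain b' where b': "b' > 0" "\<And>T. 0 < T \<Longrightarrow> T < b' \<Longrightarrow> B' * T powr (1/4) < \<epsilon>"
      using order_tendstoD(2)[OF lim0 e] by (auto simp: eventually_at_right_field)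
    obtain T where T: "T \<in> G" "T < b'" using v(2)[OF b'(1)] by blast
    have "dist (u s) v < \<epsilon>" if "0 < s" "s < T" for s
      using v(1)[OF T(1), of s] b'(2)[of T] T G(1)[OF T(1)] that by (simp add: dist_norm)
    then show "\<forall>\<^sub>F s in at_right 0. dist (u s) v < \<epsilon>"
      using G(1)[OF T(1)] by (auto simp: eventually_at_right_field)
  qed
  then show ?thesis by blast
qed

end

section \<open>The zone along the limiting direction\<close>

context one_sided
begin

text \<open>Once the slopes converge to \<open>v\<close>, upper semicontinuity of
  \<open>amax\<close> puts every later label into the hull of the part of \<open>opt K x\<close>
  exposed by \<open>v\<close>, and \<open>e\<close> is the unique point of that hull closest to
  \<open>x\<close>. Every other label is dearer by a fixed \<open>\<kappa>\<close>, which dominates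
  all errors that vanish with the length of the time interval.\<close>

proposition eventually_constant_zone: "\<exists>r>0. r \<le> T0 \<and> (\<exists>e. \<forall>s\<in>{0<..<r}. etaK K (c s) = e)"
proof -
  obtain v where v: "(u \<longlongrightarrow> v) (at_right 0)" using u_converges by blast
  define e where "e = eta_dir x v"
  define h0 where "h0 = h ((norm (x - e))\<^sup>2)"
  have h00: "h0 \<ge> 0" unfolding h0_def by (intro h_nonneg) simp
  have eK: "e \<in> convex hull K" unfolding e_def by (rule eta_dir_hull_K)
  obtain \<kappa> where \<kappa>: "\<kappa> > 0" "\<forall>e'\<in>calE K. norm (x - e') \<le> norm (x - e) \<or> h0 + \<kappa> \<le> h ((norm (x - e'))\<^sup>2)"
    using gap[of "norm (x - e)"] unfolding h0_def by auto
  have "\<forall>\<^sub>F s in at_right 0. amax (opt K x) (u s) \<subseteq> amax (opt K x) v"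
    using v amax_usc[OF finite_opt opt_nonempty] by (rule filterlim_iff[THEN iffD1, rule_format])
  then have "\<forall>\<^sub>F s in at_right 0. amax (opt K x) (u s) \<subseteq> amax (opt K x) v \<and> opt K (c s) = amax (opt K x) (c s - x)"
    using opt_c by (rule eventually_conj)
  then obtain T1 where T1: "T1 > 0" "\<And>s. 0 < s \<Longrightarrow> s < T1 \<Longrightarrow> amax (opt K x) (u s) \<subseteq> amax (opt K x) v \<and> opt K (c s) = amax (opt K x) (c s - x)"
    by (auto simp: eventually_at_right_field)
  have dich: "etaK K (c s) = e \<or> h0 + \<kappa> \<le> h ((\<phi> s)\<^sup>2)" if s: "0 < s" "s < T1" for s
  proof (cases "etaK K (c s) = e")
    case False
    have "opt K (c s) = amax (opt K x) (s *\<^sub>R u s)" using T1(2)[OF s] c_u[of s] s by simp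
    also have "\<dots> = amax (opt K x) (u s)" using s(1) by (rule amax_scale)
    also have "\<dots> \<subseteq> amax (opt K x) v" using T1(2)[OF s] by blast
    finally have "hull_opt (c s) \<subseteq> convex hull (amax (opt K x) v)" by (rule hull_mono)
    then have "norm (x - e) < norm (x - etaK K (c s))"
      using eta_in_hull[of "c s"] False unfolding e_def by (intro eta_dir_less) auto
    then show ?thesis using \<kappa>(2) eta_calE[of "c s"] unfolding \<phi>_def by fastforce
  qed simp
  \<comment> \<open>Following the ray in direction v and reconnecting during the last fraction k of the time
      would be cheaper than never entering the zone of the ray.\<close>
  have accum: "\<exists>s. 0 < s \<and> s < \<epsilon> \<and> etaK K (c s) = e" if e0: "\<epsilon> > 0" for \<epsilon>
  proof (rule ccontr)
    assume no: "\<not> ?thesis"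
    obtain r0 where r0: "r0 > 0" "\<forall>s\<in>{0..r0}. x + s *\<^sub>R v \<in> phase e" using phase_ray[of x v] unfolding e_def by blast
    obtain C1 where C1: "C1 > 0" "\<And>y. norm y \<le> norm x + \<beta> \<Longrightarrow> V y \<le> C1" using V_bounded by blast
    \<comment> \<open>During the reconnection the potential is at most \<open>C1\<close>, so its
      average over [0, T] is at most \<open>C1 * k\<close>, hence at most \<open>\<kappa>/4\<close>.
      The extra kinetic energy per unit time is at most |u T - v|^2 / k, which tends to 0 with T
      because \<open>k\<close> does not depend on T.\<close>
    define k where "k = min (1/2) (\<kappa> / (4 * C1))"
    have k: "0 < k" "k < 1" "C1 * k \<le> \<kappa>/4" using \<kappa> C1 by (auto simp: k_def min_def field_simps)
    have "((\<lambda>T. C * (q * sqrt T) + (norm (u T - v))\<^sup>2 / k + C * (T * norm v)) \<longlongrightarrow> C * (q * sqrt 0) + (norm (v - v))\<^sup>2 / k + C * (0 * norm v)) (at_right 0)"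
      using k by (intro tendsto_intros v filterlim_ident) auto
    then have "\<forall>\<^sub>F T in at_right 0. C * (q * sqrt T) + (norm (u T - v))\<^sup>2 / k + C * (T * norm v) < \<kappa>/2"
      using \<kappa> by (intro order_tendstoD(2)) auto
    moreover have "\<forall>\<^sub>F T in at_right 0. T * norm v < \<beta>"
      using \<beta> by (intro order_tendstoD(2)[of _ "0 * norm v"] tendsto_intros filterlim_ident) auto
    moreover have "\<forall>\<^sub>F T in at_right 0. 0 < T \<and> T < Min {r0, T1, T0, \<epsilon>}"
      using r0 T1 T0 e0 by (intro eventually_at_rightI[of 0 "Min {r0, T1, T0, \<epsilon>}"]) auto
    ultimately have "\<forall>\<^sub>F T in at_right 0. C * (q * sqrt T) + (norm (u T - v))\<^sup>2 / k + C * (T * norm v) < \<kappa>/2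
        \<and> T * norm v < \<beta> \<and> 0 < T \<and> T < Min {r0, T1, T0, \<epsilon>}"
      by eventually_elim simp
    then obtain T where T: "C * (q * sqrt T) + (norm (u T - v))\<^sup>2 / k + C * (T * norm v) < \<kappa>/2"
        "T * norm v < \<beta>" "0 < T" "T < Min {r0, T1, T0, \<epsilon>}"
      using eventually_happens'[OF trivial_limit_at_right_real] by blast
    have Tlt: "T < r0" "T < T1" "T < T0" "T < \<epsilon>" using T(4) by auto
    define m where "m = (1 - k) * T"
    have m: "0 < m" "m < T" using k T by (auto simp: m_def field_simps)
    have Tm: "T - m = k * T" by (simp add: m_def algebra_simps)
    \<comment> \<open>The velocity that carries the broken line from \<open>x + m v\<close> to
      \<open>c T\<close> in the remaining time \<open>k * T\<close>.\<close>
    define w' where "w' = v + (1/k) *\<^sub>R (u T - v)"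
    have low: "(h0 + \<kappa> - C * (q * sqrt T)) * (T - 0) \<le> integral {0..T} (\<lambda>r. V (c r))"
    proof (rule integral_const_le)
      fix r assume r: "r \<in> {0<..<T}"
      then have "etaK K (c r) \<noteq> e" using no Tlt by auto
      then have "h0 + \<kappa> \<le> h ((\<phi> r)\<^sup>2)" using dich[of r] r Tlt by auto
      then show "h0 + \<kappa> - C * (q * sqrt T) \<le> V (c r)" using V_lower[of r T] r Tlt by simp
    qed (use T Tlt Vc_integrable in auto)
    have kin: "T * (norm (u T))\<^sup>2 \<le> Kn 0 T"
    proof -
      have "(T * norm (u T))\<^sup>2 \<le> T * Kn 0 T" using Kn_ge[of 0 T] c_u[of T] T Tlt by simp
      then have "T * (T * (norm (u T))\<^sup>2) \<le> T * Kn 0 T" by (simp add: power_mult_distrib power2_eq_square mult_ac)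
      then show ?thesis using T by simp
    qed
    have ray_ball: "x + r *\<^sub>R v \<in> ball x \<beta>" "norm (r *\<^sub>R v) \<le> T * norm v" if "0 \<le> r" "r \<le> T" for r
    proof -
      show *: "norm (r *\<^sub>R v) \<le> T * norm v" using that by (simp add: mult_right_mono)
      then show "x + r *\<^sub>R v \<in> ball x \<beta>" using T(2) by (simp add: dist_norm)
    qed
    have ends: "c T = x + (m - 0) *\<^sub>R v + (T - m) *\<^sub>R w'"
    proof -
      have "(m - 0) *\<^sub>R v + (T - m) *\<^sub>R w' = T *\<^sub>R v + T *\<^sub>R (u T - v)"
        unfolding Tm w'_def m_def using k by (simp add: algebra_simps)
      also have "\<dots> = T *\<^sub>R u T" by (simp add: algebra_simps)
      finally show ?thesis using c_u[of T] T by (simp add: add.assoc)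
    qed
    let ?p = "poly_curve 0 m x v w'"
    have cmp': "Kn 0 T + integral {0..T} (\<lambda>r. V (c r)) \<le> (m - 0) * (norm v)\<^sup>2 + (T - m) * (norm w')\<^sup>2 + integral {0..T} (\<lambda>r. V (?p r))"
      using m Tlt ends ray_ball(1)[of m] by (intro cmp) auto
    have pcont: "continuous_on {0..T} ?p"
    proof -
      have "abs_cont_on 0 T ?p"
      proof (rule abs_cont_on_join[of 0 m _ T])
        show "abs_cont_on 0 m ?p"
          by (rule abs_cont_on_cong[OF abs_cont_on_linear[of 0 m x 0 v]]) (auto simp: poly_curve_def)
        show "abs_cont_on m T ?p"
          by (rule abs_cont_on_cong[OF abs_cont_on_linear[of m T "x + (m - 0) *\<^sub>R v" m w']]) (auto simp: poly_curve_def)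
      qed (use m in auto)
      then show ?thesis by (rule abs_cont_on_imp_continuous_on)
    qed
    have I1: "integral {0..m} (\<lambda>r. V (?p r)) \<le> (h0 + C * (T * norm v)) * (m - 0)"
    proof (rule integral_le_const)
      show "(\<lambda>r. V (?p r)) integrable_on {0..m}"
        using pcont m by (intro V_integrable continuous_on_subset[OF pcont]) auto
      fix r assume r: "r \<in> {0<..<m}"
      then have p: "?p r = x + r *\<^sub>R v" by (simp add: poly_curve_def)
      show "V (?p r) \<le> h0 + C * (T * norm v)"
        unfolding p h0_def
      proof (rule V_upper[OF _ eK])
        show "x + r *\<^sub>R v \<in> phase e" using r0(2) r m Tlt by auto
        show "x + r *\<^sub>R v \<in> ball x \<beta>" "norm (x + r *\<^sub>R v - x) \<le> T * norm v" using ray_ball[of r] r m by auto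
      qed
    qed (use m in auto)
    have I2: "integral {m..T} (\<lambda>r. V (?p r)) \<le> C1 * (T - m)"
    proof (rule integral_le_const)
      show "(\<lambda>r. V (?p r)) integrable_on {m..T}"
        using pcont m by (intro V_integrable continuous_on_subset[OF pcont]) auto
      fix r assume r: "r \<in> {m<..<T}"
      have t: "0 \<le> (r - m) / (T - m)" "(r - m) / (T - m) \<le> 1" using r by auto
      have "(1 - (r - m) / (T - m)) *\<^sub>R (x + m *\<^sub>R v) + ((r - m) / (T - m)) *\<^sub>R c T \<in> ball x \<beta>"
        by (rule convexD[OF convex_ball]) (use ray_ball(1)[of m] c_ball[of T] m Tlt t in auto)
      moreover have "?p r = (1 - (r - m) / (T - m)) *\<^sub>R (x + m *\<^sub>R v) + ((r - m) / (T - m)) *\<^sub>R c T"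
        using convex_comb_shift[of "T - m" "r - m" "x + m *\<^sub>R v" w'] r m ends by (simp add: poly_curve_def)
      ultimately have "?p r \<in> ball x \<beta>" by simp
      then have "norm (?p r) \<le> norm x + \<beta>"
        using norm_triangle_ineq2[of "?p r" x] by (simp add: dist_norm norm_minus_commute)
      then show "V (?p r) \<le> C1" by (rule C1(2))
    qed (use m in auto)
    have comb: "integral {0..m} (\<lambda>r. V (?p r)) + integral {m..T} (\<lambda>r. V (?p r)) = integral {0..T} (\<lambda>r. V (?p r))"
      using m pcont by (intro Henstock_Kurzweil_Integration.integral_combine V_integrable) auto
    have "(h0 + C * (T * norm v)) * m \<le> (h0 + C * (T * norm v)) * T"
      using m h00 C T by (intro mult_left_mono add_nonneg_nonneg mult_nonneg_nonneg) auto
    then have I: "integral {0..T} (\<lambda>r. V (?p r)) \<le> (h0 + C * (T * norm v)) * T + C1 * (k * T)"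
      using I1 I2 comb Tm by simp
    have "(norm w')\<^sup>2 = (norm v)\<^sup>2 + 2 / k * (v \<bullet> (u T - v)) + (norm (u T - v))\<^sup>2 / k\<^sup>2"
      unfolding w'_def power2_norm_eq_inner
      by (simp add: inner_add_left inner_add_right inner_commute power2_eq_square)
    moreover have "(norm (u T))\<^sup>2 = (norm v)\<^sup>2 + 2 * (v \<bullet> (u T - v)) + (norm (u T - v))\<^sup>2"
      unfolding power2_norm_eq_inner
      by (simp add: inner_diff_left inner_diff_right inner_commute)
    \<comment> \<open>The terms linear in \<open>u T - v\<close> agree on both sides because the
      broken line and the chord have the same ends; only a quadratic remainder with weight 1/k - 1
      is left.\<close>
    ultimately have "m * (norm v)\<^sup>2 + k * T * (norm w')\<^sup>2 = T * ((norm (u T))\<^sup>2 - (norm (u T - v))\<^sup>2 + (norm (u T - v))\<^sup>2 / k)"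
      unfolding m_def using k by (simp add: field_simps power2_eq_square)
    also have "\<dots> \<le> T * (norm (u T))\<^sup>2 + T * ((norm (u T - v))\<^sup>2 / k)"
      using T by (simp add: algebra_simps)
    finally have "T * (h0 + \<kappa> - C * (q * sqrt T)) \<le> T * ((norm (u T - v))\<^sup>2 / k + (h0 + C * (T * norm v)) + C1 * k)"
      using cmp' low kin I unfolding Tm by (simp add: algebra_simps)
    then have "h0 + \<kappa> - C * (q * sqrt T) \<le> (norm (u T - v))\<^sup>2 / k + (h0 + C * (T * norm v)) + C1 * k"
      using T(3) by (simp add: mult_le_cancel_left_pos)
    then show False using T(1) k(3) \<kappa>(1) by linarith
  qed
  have "((\<lambda>T. 2 * C * (q * sqrt T)) \<longlongrightarrow> 2 * C * (q * sqrt 0)) (at_right 0)"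
    by (intro tendsto_intros filterlim_ident)
  then have "\<forall>\<^sub>F T in at_right 0. 2 * C * (q * sqrt T) < \<kappa>" using \<kappa>(1) by (intro order_tendstoD(2)) auto
  moreover have "\<forall>\<^sub>F T in at_right 0. 0 < T \<and> T < Min {T1, T0}"
    using T1 T0 by (intro eventually_at_rightI[of 0 "Min {T1, T0}"]) auto
  ultimately have "\<forall>\<^sub>F T in at_right 0. 2 * C * (q * sqrt T) < \<kappa> \<and> 0 < T \<and> T < Min {T1, T0}"
    by (rule eventually_conj)
  then obtain T where T: "2 * C * (q * sqrt T) < \<kappa>" "0 < T" "T < T1" "T < T0"
    using eventually_happens'[OF trivial_limit_at_right_real] by force
  obtain b where b: "0 < b" "b < T" "etaK K (c b) = e" using accum[OF T(2)] by blast
  have bad: "h0 + \<kappa> - C * (q * sqrt T) \<le> V (c r)" if "0 < r" "r \<le> T" "etaK K (c r) \<noteq> e" for r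
    using dich[of r] V_lower[of r T] that T by auto
  have good: "y \<in> phase e \<Longrightarrow> y \<in> ball x \<beta> \<Longrightarrow> norm (y - x) \<le> q * sqrt T \<Longrightarrow> V y \<le> h0 + C * (q * sqrt T)" for y
    unfolding h0_def using V_upper[OF _ eK] by blast
  \<comment> \<open>Write M for C q sqrt T, so that 2 M < \<open>\<kappa>\<close>. A point of the
    closed set \<open>phase e\<close> costs at most \<open>h0\<close> + M, a different label at
    least \<open>h0 + \<kappa>\<close> - M. Up to time \<open>T\<close> the zone is thus cut out by
    a closed condition, and an excursion has a last exit \<open>s1\<close> and a first return
    \<open>s2\<close>.\<close>
  have iff: "etaK K (c r) = e \<longleftrightarrow> c r \<in> phase e" if r: "0 < r" "r \<le> T" for r
  proof
    assume "etaK K (c r) = e" then show "c r \<in> phase e" using phase_eta[of "c r"] by simp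
  next
    assume "c r \<in> phase e"
    then have "V (c r) \<le> h0 + C * (q * sqrt T)"
      using good dist_bound'[of r T] c_ball[of r] r T by auto
    then show "etaK K (c r) = e" using bad[OF r] T(1) by fastforce
  qed
  have "etaK K (c s) = e" if s: "0 < s" "s < b" for s
  proof (rule ccontr)
    assume ns: "etaK K (c s) \<noteq> e"
    \<comment> \<open>\<open>accum\<close> supplies zone times arbitrarily close to 0, so an
      excursion through \<open>s\<close> is also bounded from the left.\<close>
    obtain a where a: "0 < a" "a < s" "etaK K (c a) = e" using accum[OF s(1)] by blast
    define Z where "Z = {r \<in> {a..b}. c r \<in> phase e}"
    have cont_ab: "continuous_on {a..b} c" using a b T by (intro continuous_on_subset[OF cont]) auto
    have clZ: "closed Z" unfolding Z_def
      using continuous_closed_preimage[OF cont_ab closed_atLeastAtMost closed_phase[of e]]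
      by (simp add: vimage_def Int_def)
    define s1 where "s1 = Sup (Z \<inter> {..s})"
    define s2 where "s2 = Inf (Z \<inter> {s..})"
    have aZ: "a \<in> Z \<inter> {..s}" using a s b iff[of a] T by (auto simp: Z_def)
    have bZ: "b \<in> Z \<inter> {s..}" using a s b iff[of b] T by (auto simp: Z_def)
    have bdd1: "bdd_above (Z \<inter> {..s})" by (rule bdd_aboveI[of _ s]) auto
    have bdd2: "bdd_below (Z \<inter> {s..})" by (rule bdd_belowI[of _ s]) auto
    have s1: "s1 \<in> Z \<inter> {..s}" unfolding s1_def using aZ bdd1 clZ
      by (intro closed_contains_Sup closed_Int) auto
    have s2: "s2 \<in> Z \<inter> {s..}" unfolding s2_def using bZ bdd2 clZ
      by (intro closed_contains_Inf closed_Int) auto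
    have sZ: "s \<notin> Z" using ns iff[of s] s b by (auto simp: Z_def)
    have lt: "s1 < s" "s < s2" using s1 s2 sZ by (auto simp: less_le)
    have rng: "0 < s1" "s2 \<le> b" "s2 \<le> T0" "s2 \<le> T" using s1 s2 a b T by (auto simp: Z_def)
    have out: "etaK K (c r) \<noteq> e" if r: "r \<in> {s1<..<s2}" for r
    proof
      assume "etaK K (c r) = e"
      then have rZ: "r \<in> Z" using iff[of r] r rng s1 s2 by (auto simp: Z_def)
      show False
      proof (cases "r \<le> s")
        case True
        then have "r \<le> s1" unfolding s1_def using rZ bdd1 by (intro cSup_upper) auto
        then show False using r by auto
      next
        case False
        then have "s2 \<le> r" unfolding s2_def using rZ bdd2 by (intro cInf_lower) auto
        then show False using r by auto
      qed
    qed
    define l where "l = (\<lambda>r. c s1 + ((r - s1) / (s2 - s1)) *\<^sub>R (c s2 - c s1))"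
    have ch: "Kn s1 s2 - (norm (c s2 - c s1))\<^sup>2 / (s2 - s1) + integral {s1..s2} (\<lambda>r. V (c r)) \<le> integral {s1..s2} (\<lambda>r. V (l r))"
      "\<And>r. r \<in> {s1..s2} \<Longrightarrow> l r \<in> closed_segment (c s1) (c s2)" "continuous_on {s1..s2} l"
      unfolding l_def using chord[of s1 s2] rng lt by auto
    have "0 \<le> Kn s1 s2 - (norm (c s2 - c s1))\<^sup>2 / (s2 - s1)"
      using Kn_ge[of s1 s2] rng lt by (simp add: field_simps)
    moreover have "(h0 + \<kappa> - C * (q * sqrt T)) * (s2 - s1) \<le> integral {s1..s2} (\<lambda>r. V (c r))"
      using bad out rng lt by (intro integral_const_le Vc_integrable) auto
    moreover have "integral {s1..s2} (\<lambda>r. V (l r)) \<le> (h0 + C * (q * sqrt T)) * (s2 - s1)"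
    proof (rule integral_le_const)
      show "(\<lambda>r. V (l r)) integrable_on {s1..s2}" using ch(3) by (rule V_integrable)
      fix r assume "r \<in> {s1<..<s2}"
      then have ls: "l r \<in> closed_segment (c s1) (c s2)" using ch(2) by auto
      have "closed_segment (c s1) (c s2) \<subseteq> phase e"
        using s1 s2 by (intro closed_segment_subset convex_phase) (auto simp: Z_def)
      moreover have "closed_segment (c s1) (c s2) \<subseteq> ball x \<beta>"
        using c_ball[of s1] c_ball[of s2] rng lt by (intro closed_segment_subset convex_ball) auto
      moreover have "closed_segment (c s1) (c s2) \<subseteq> cball x (q * sqrt T)"
        using dist_bound'[of s1 T] dist_bound'[of s2 T] rng lt T
        by (intro closed_segment_subset convex_cball) (auto simp: dist_norm norm_minus_commute)
      ultimately show "V (l r) \<le> h0 + C * (q * sqrt T)"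
        using ls by (intro good) (auto simp: dist_norm norm_minus_commute)
    qed (use lt in auto)
    ultimately have "(h0 + \<kappa> - C * (q * sqrt T)) * (s2 - s1) \<le> (h0 + C * (q * sqrt T)) * (s2 - s1)"
      using ch(1) by linarith
    then have "h0 + \<kappa> - C * (q * sqrt T) \<le> h0 + C * (q * sqrt T)"
      by (rule mult_right_le_imp_le) (use lt in simp)
    then show False using T(1) by linarith
  qed
  then show ?thesis using b T by (intro exI[of _ b]) auto
qed

end

section \<open>Regularity inside a zone\<close>

text \<open>On the inner interval the increment of \<open>f\<close> differs from that of the outer
  chord by at most two chord errors, 2 L (t - s)^2; division by t' - s', which is at least (t -
  s)/4, gives the factor 8.\<close>

lemma chord_error_slopes:
  fixes f :: "real \<Rightarrow> 'a::real_normed_vector"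
  assumes err: "\<And>s r t. \<lbrakk>a \<le> s; s \<le> r; r \<le> t; t \<le> b; s < t; t - s \<le> \<tau>\<rbrakk> \<Longrightarrow>
      norm (f r - (f s + ((r - s) / (t - s)) *\<^sub>R (f t - f s))) \<le> L * (t - s)\<^sup>2"
    and L: "L \<ge> 0"
    and st: "a \<le> s" "s \<le> s'" "s' < t'" "t' \<le> t" "t \<le> b" "t - s \<le> \<tau>" "t - s \<le> 4 * (t' - s')"
  shows "norm ((1 / (t' - s')) *\<^sub>R (f t' - f s') - (1 / (t - s)) *\<^sub>R (f t - f s)) \<le> 8 * L * (t - s)"
proof -
  define l where "l r = f s + ((r - s) / (t - s)) *\<^sub>R (f t - f s)" for r
  have e: "norm (f r - l r) \<le> L * (t - s)\<^sup>2" if "s \<le> r" "r \<le> t" for r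
    unfolding l_def using st that by (intro err) auto
  have d: "l t' - l s' = ((t' - s') / (t - s)) *\<^sub>R (f t - f s)"
    by (simp add: l_def scaleR_diff_left[symmetric] diff_divide_distrib[symmetric])
  have "(1 / (t' - s')) *\<^sub>R (f t' - f s') - (1 / (t - s)) *\<^sub>R (f t - f s) =
      (1 / (t' - s')) *\<^sub>R ((f t' - l t') - (f s' - l s'))"
  proof -
    have "(1 / (t' - s')) *\<^sub>R (l t' - l s') = (1 / (t - s)) *\<^sub>R (f t - f s)" unfolding d using st by simp
    moreover have "(f t' - l t') - (f s' - l s') = (f t' - f s') - (l t' - l s')" by simp
    ultimately show ?thesis by (metis scaleR_diff_right)
  qed
  then have "norm ((1 / (t' - s')) *\<^sub>R (f t' - f s') - (1 / (t - s)) *\<^sub>R (f t - f s)) =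
      norm ((f t' - l t') - (f s' - l s')) / (t' - s')" using st by simp
  also have "\<dots> \<le> (2 * L * (t - s)\<^sup>2) / (t' - s')"
    using norm_triangle_ineq4[of "f t' - l t'" "f s' - l s'"] e[of t'] e[of s'] st
    by (intro divide_right_mono) auto
  also have "\<dots> \<le> 8 * L * (t - s)"
  proof -
    define d where "d = t - s"
    define d' where "d' = t' - s'"
    have d: "0 \<le> d" "d \<le> 4 * d'" "0 < d'" using st by (auto simp: d_def d'_def)
    have "2 * L * d * d \<le> 2 * L * d * (4 * d')" using d L by (intro mult_left_mono) auto
    then have "2 * L * d\<^sup>2 / d' \<le> 8 * L * d" using d by (simp add: pos_divide_le_eq power2_eq_square mult_ac)
    then show ?thesis by (simp add: d_def d'_def)
  qed
  finally show ?thesis .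
qed

lemma local_lipschitz_interval:
  fixes g :: "real \<Rightarrow> 'a::real_normed_vector"
  assumes \<tau>: "\<tau> > 0" and M: "M \<ge> 0"
    and loc: "\<And>p q. \<lbrakk>a \<le> p; p \<le> q; q \<le> b; q - p \<le> \<tau>\<rbrakk> \<Longrightarrow> norm (g q - g p) \<le> M * (q - p)"
  shows "M-lipschitz_on {a..b} g"
proof -
  have step: "norm (g q - g p) \<le> M * (q - p)" if "a \<le> p" "p \<le> q" "q \<le> b" "q - p \<le> real n * \<tau>" for n p q
    using that
  proof (induction n arbitrary: p)
    case 0
    then show ?case by simp
  next
    case (Suc n)
    show ?case
    proof (cases "q - p \<le> \<tau>")
      case True
      then show ?thesis using Suc.prems loc by blast
    next
      case False
      have "norm (g q - g (p + \<tau>)) \<le> M * (q - (p + \<tau>))"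
        using Suc.prems False \<tau> by (intro Suc.IH) (auto simp: algebra_simps)
      moreover have "norm (g (p + \<tau>) - g p) \<le> M * (p + \<tau> - p)"
        using Suc.prems False \<tau> by (intro loc) auto
      moreover have "norm (g q - g p) \<le> norm (g q - g (p + \<tau>)) + norm (g (p + \<tau>) - g p)"
        using norm_triangle_ineq[of "g q - g (p + \<tau>)" "g (p + \<tau>) - g p"] by simp
      ultimately show ?thesis by (simp add: algebra_simps)
    qed
  qed
  have ord: "norm (g q - g p) \<le> M * (q - p)" if "a \<le> p" "p \<le> q" "q \<le> b" for p q
  proof -
    obtain n :: nat where "(q - p) / \<tau> \<le> real n" using real_arch_simple by blast
    then have "q - p \<le> real n * \<tau>" using \<tau> by (simp add: pos_divide_le_eq)
    then show ?thesis using step that by blast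
  qed
  show ?thesis
  proof (rule lipschitz_onI[OF _ M])
    fix p q assume "p \<in> {a..b}" "q \<in> {a..b}"
    then show "dist (g p) (g q) \<le> M * dist p q"
      using ord[of p q] ord[of q p] by (cases "p \<le> q") (auto simp: dist_norm norm_minus_commute)
  qed
qed

text \<open>Slopes over comparable nested intervals differ by O(T), so slopes over intervals
  shrinking to \<open>p\<close> converge at that rate, uniformly in \<open>p\<close>. The limit is
  the derivative, and comparing the slope over [p, q] with the limits at both ends makes it
  Lipschitz with constant twice 64 L.\<close>

proposition chord_error_imp_C11:
  fixes f :: "real \<Rightarrow> 'a::banach"
  assumes err: "\<And>s r t. \<lbrakk>a \<le> s; s \<le> r; r \<le> t; t \<le> b; s < t; t - s \<le> \<tau>\<rbrakk> \<Longrightarrow>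
      norm (f r - (f s + ((r - s) / (t - s)) *\<^sub>R (f t - f s))) \<le> L * (t - s)\<^sup>2"
    and L: "L \<ge> 0" and \<tau>: "\<tau> > 0" and ab: "a < b"
  shows "C11_on a b f"
proof -
  define m where "m s t = (1 / (t - s)) *\<^sub>R (f t - f s)" for s t
  define \<tau>' where "\<tau>' = min \<tau> (b - a)"
  have \<tau>': "\<tau>' > 0" "\<tau>' \<le> \<tau>" "\<tau>' \<le> b - a" using \<tau> ab by (auto simp: \<tau>'_def)
  have cmp: "norm (m s' t' - m s t) \<le> 8 * L * (t - s)"
    if "a \<le> s" "s \<le> s'" "s' < t'" "t' \<le> t" "t \<le> b" "t - s \<le> \<tau>" "t - s \<le> 4 * (t' - s')" for s t s' t'
    unfolding m_def using chord_error_slopes[OF err L that] .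
  \<comment> \<open>The interval of length \<open>T\<close> starting at \<open>p\<close> is pushed
    to the left when it would cross \<open>b\<close>. These intervals are nested in
    \<open>T\<close>, so \<open>cmp\<close> applies; the constant is 32 = 2 * 8 / (1 - 1/2).\<close>
  have "\<exists>v. \<forall>T. 0 < T \<longrightarrow> T \<le> \<tau>' \<longrightarrow> norm (m (min p (b - T)) (min p (b - T) + T) - v) \<le> 32 * L * T" if p: "p \<in> {a..b}" for p
  proof -
    define u where "u T = m (min p (b - T)) (min p (b - T) + T)" for T
    obtain v where v: "\<And>T s. T \<in> {0<..\<tau>'} \<Longrightarrow> 0 < s \<Longrightarrow> s \<le> T \<Longrightarrow> norm (u s - v) \<le> 2 * (8 * L) / (1 - (1/2) powr 1) * T powr 1"
    proof (rule dyadic_limit[of "{0<..\<tau>'}" 1 "8 * L" u])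
      show "\<exists>T'\<in>{0<..\<tau>'}. T/4 \<le> T' \<and> T' \<le> T/2" if "T \<in> {0<..\<tau>'}" for T
        using that by (intro bexI[of _ "T/2"]) auto
      show "norm (u s - u T) \<le> 8 * L * T powr 1" if T: "T \<in> {0<..\<tau>'}" "T/4 \<le> s" "s \<le> T" for T s
      proof -
        have "norm (u s - u T) \<le> 8 * L * ((min p (b - T) + T) - min p (b - T))"
          unfolding u_def using T \<tau>' p by (intro cmp) auto
        then show ?thesis using T by simp
      qed
    qed (use \<tau>' L in auto)
    have "norm (u T - v) \<le> 32 * L * T" if "0 < T" "T \<le> \<tau>'" for T
      using v[of T T] that by simp
    then show ?thesis unfolding u_def by blast
  qed
  then obtain g where g: "\<And>p T. p \<in> {a..b} \<Longrightarrow> 0 < T \<Longrightarrow> T \<le> \<tau>' \<Longrightarrow> norm (m (min p (b - T)) (min p (b - T) + T) - g p) \<le> 32 * L * T"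
    by metis
  \<comment> \<open>Both [s, t] and the reference interval contain \<open>p\<close> and have length
    \<open>T\<close>, so their hull [S, E] has length at most \<open>2 * T\<close>. Each comparison
    with the hull costs 16 L T and the reference slope 32 L T, together 64 L T.\<close>
  have slope: "norm (m s t - g p) \<le> 64 * L * (t - s)" if st: "a \<le> s" "s < t" "t \<le> b" "s \<le> p" "p \<le> t" "t - s \<le> \<tau>'/2" for s t p
  proof -
    define T where "T = t - s"
    define s' where "s' = min p (b - T)"
    have T: "0 < T" "T \<le> \<tau>'/2" using st by (auto simp: T_def)
    have s': "a \<le> s'" "s' + T \<le> b" "s' \<le> p" "p \<le> s' + T" using st T \<tau>' by (auto simp: s'_def T_def)
    define S where "S = min s s'"
    define E where "E = max t (s' + T)"
    have SE: "a \<le> S" "E \<le> b" "T \<le> E - S" "E - S \<le> 2 * T" "S \<le> s" "S \<le> s'" "t \<le> E" "s' + T \<le> E"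
      using st s' T by (auto simp: S_def E_def T_def min_def max_def)
    have "norm (m s t - m S E) \<le> 8 * L * (E - S)"
      using SE T \<tau>' st by (intro cmp) (auto simp: T_def)
    moreover have "norm (m s' (s' + T) - m S E) \<le> 8 * L * (E - S)"
      using SE T \<tau>' st by (intro cmp) auto
    moreover have "norm (m s' (s' + T) - g p) \<le> 32 * L * T"
      unfolding s'_def using st T \<tau>' by (intro g) auto
    moreover have "8 * L * (E - S) \<le> 8 * L * (2 * T)" using SE L by (intro mult_left_mono) auto
    moreover have "norm (m s t - g p) \<le> norm (m s t - m S E) + norm (m s' (s' + T) - m S E) + norm (m s' (s' + T) - g p)"
    proof -
      have "norm (m s t - g p) = norm ((m s t - m S E) - (m s' (s' + T) - m S E) + (m s' (s' + T) - g p))" by simp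
      then show ?thesis
        using norm_triangle_ineq[of "(m s t - m S E) - (m s' (s' + T) - m S E)" "m s' (s' + T) - g p"]
          norm_triangle_ineq4[of "m s t - m S E" "m s' (s' + T) - m S E"] by linarith
    qed
    ultimately have "norm (m s t - g p) \<le> 64 * L * T" by linarith
    then show ?thesis by (simp add: T_def)
  qed
  have est: "norm (f y - f p - (y - p) *\<^sub>R g p) \<le> 64 * L * \<bar>y - p\<bar> * \<bar>y - p\<bar>" if y: "p \<in> {a..b}" "y \<in> {a..b}" "\<bar>y - p\<bar> \<le> \<tau>'/2" for p y
  proof (cases "y = p")
    case False
    define s where "s = min y p"
    define t where "t = max y p"
    have st: "s < t" "t - s = \<bar>y - p\<bar>" using False by (auto simp: s_def t_def)
    have "norm (m s t - g p) \<le> 64 * L * (t - s)"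
      using y st by (intro slope) (auto simp: s_def t_def)
    moreover have "f y - f p - (y - p) *\<^sub>R g p = (y - p) *\<^sub>R (m s t - g p)"
    proof -
      have "(y - p) *\<^sub>R m s t = f y - f p"
      proof (cases "y < p")
        case True
        then have "m s t = (1 / (p - y)) *\<^sub>R (f p - f y)" by (simp add: m_def s_def t_def)
        then have "(y - p) *\<^sub>R m s t = ((y - p) / (p - y)) *\<^sub>R (f p - f y)" by simp
        also have "(y - p) / (p - y) = - 1" using True by (simp add: divide_simps)
        finally show ?thesis by simp
      next
        case F: False
        then show ?thesis using False by (simp add: m_def s_def t_def)
      qed
      then show ?thesis by (simp add: scaleR_diff_right)
    qed
    ultimately have "norm (f y - f p - (y - p) *\<^sub>R g p) \<le> \<bar>y - p\<bar> * (64 * L * \<bar>y - p\<bar>)"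
      using st by (simp only: norm_scaleR) (intro mult_left_mono, auto)
    then show ?thesis by (simp only: mult_ac)
  qed simp
  have der: "(f has_vector_derivative g p) (at p within {a..b})" if p: "p \<in> {a..b}" for p
    unfolding has_vector_derivative_def has_derivative_within_alt
  proof (intro conjI allI impI)
    show "bounded_linear (\<lambda>x. x *\<^sub>R g p)" by (rule bounded_linear_scaleR_left)
    fix e :: real assume e: "e > 0"
    define d where "d = min (\<tau>'/2) (e / (64 * L + 1))"
    have d: "d > 0" using \<tau>' e L by (auto simp: d_def)
    have "norm (f y - f p - (y - p) *\<^sub>R g p) \<le> e * norm (y - p)" if y: "y \<in> {a..b}" "norm (y - p) < d" for y
    proof -
      have "norm (f y - f p - (y - p) *\<^sub>R g p) \<le> 64 * L * \<bar>y - p\<bar> * \<bar>y - p\<bar>"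
        using p y by (intro est) (auto simp: d_def)
      also have "\<dots> \<le> e * \<bar>y - p\<bar>"
      proof (rule mult_right_mono)
        have "64 * L * \<bar>y - p\<bar> \<le> (64 * L + 1) * (e / (64 * L + 1))"
          using y L by (intro mult_mono) (auto simp: d_def)
        also have "\<dots> = e" using L by simp
        finally show "64 * L * \<bar>y - p\<bar> \<le> e" .
      qed simp
      finally show ?thesis by simp
    qed
    then show "\<exists>d>0. \<forall>y\<in>{a..b}. norm (y - p) < d \<longrightarrow> norm (f y - f p - (y - p) *\<^sub>R g p) \<le> e * norm (y - p)"
      using d by blast
  qed
  have "(128 * L)-lipschitz_on {a..b} g"
  proof (rule local_lipschitz_interval[of "\<tau>'/2"])
    fix p q assume pq: "a \<le> p" "p \<le> q" "q \<le> b" "q - p \<le> \<tau>'/2"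
    show "norm (g q - g p) \<le> 128 * L * (q - p)"
    proof (cases "p = q")
      case False
      then have "norm (m p q - g p) \<le> 64 * L * (q - p)" "norm (m p q - g q) \<le> 64 * L * (q - p)"
        using pq by (auto intro!: slope)
      then show ?thesis using norm_triangle_ineq4[of "m p q - g p" "m p q - g q"] by simp
    qed simp
  qed (use \<tau>' L in auto)
  then show ?thesis unfolding C11_on_def using der by blast
qed

section \<open>The gradient of the potential with a fixed label\<close>

context potential
begin

lemma h'_nonneg: "s \<ge> 0 \<Longrightarrow> h' s \<ge> 0"
proof -
  assume s: "s \<ge> 0"
  have "((\<lambda>y. (h y - h s) / (y - s)) \<longlongrightarrow> h' s) (at s within {0..})"
    using h_deriv[OF s] by (simp add: has_field_derivative_iff)
  then have "((\<lambda>y. (h y - h s) / (y - s)) \<longlongrightarrow> h' s) (at_right s)"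
    by (rule tendsto_within_subset) (use s in auto)
  moreover have "\<forall>\<^sub>F y in at_right s. 0 \<le> (h y - h s) / (y - s)"
    using h_mono[of s] s by (intro eventually_at_rightI[of s "s + 1"]) auto
  ultimately show ?thesis by (rule tendsto_lowerbound) simp
qed

lemma H_has_derivative: "(H e has_derivative (\<lambda>v. 2 * ((y - e) \<bullet> v) * h' ((norm (y - e))\<^sup>2))) (at y)"
proof -
  have n: "((\<lambda>x::'a. (norm (x - e))\<^sup>2) has_derivative (\<lambda>v. 2 * ((y - e) \<bullet> v))) (at y)"
    unfolding power2_norm_eq_inner by (auto intro!: derivative_eq_intros simp: inner_commute)
  have "((\<lambda>x. h ((norm (x - e))\<^sup>2)) has_derivative (\<lambda>v. (*) (h' ((norm (y - e))\<^sup>2)) (2 * ((y - e) \<bullet> v)))) (at y within UNIV)"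
  proof (rule has_derivative_in_compose2[where t="{0..}" and g=h and g'="\<lambda>s. (*) (h' s)"])
    show "(h has_derivative (*) (h' s)) (at s within {0..})" if "s \<in> {0..}" for s
      using h_deriv[of s] that by (simp add: has_field_derivative_def)
  qed (use n in auto)
  then show ?thesis unfolding H_def[abs_def] by (simp add: mult_ac)
qed

text \<open>The gradient of \<open>H e\<close> at \<open>y\<close> has norm 2 h'(|y - e|^2) |y - e|,
  and continuity of \<open>h'\<close> lets it grow by less than \<open>\<mu>\<close> on a small
  ball. The factor 2 is cancelled later by the one in front of the excess.\<close>

lemma H_local_lipschitz:
  assumes "\<mu> > 0"
  obtains \<nu> where "\<nu> > 0" "\<And>x z. x \<in> ball y \<nu> \<Longrightarrow> z \<in> ball y \<nu> \<Longrightarrow>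
    \<bar>H e x - H e z\<bar> \<le> (2 * (h' ((norm (y - e))\<^sup>2) * norm (y - e)) + \<mu>) * norm (x - z)"
proof -
  define F where "F x = 2 * (h' ((norm (x - e))\<^sup>2) * norm (x - e))" for x :: 'a
  have "continuous_on UNIV F" unfolding F_def
    by (intro continuous_intros continuous_on_compose2[OF h'_cont]) auto
  then obtain \<nu> where \<nu>: "\<nu> > 0" "\<And>x. dist x y < \<nu> \<Longrightarrow> dist (F x) (F y) < \<mu>"
    using assms unfolding continuous_on_iff by (meson UNIV_I)
  have "norm (H e x - H e z) \<le> (F y + \<mu>) * norm (x - z)" if "x \<in> ball y \<nu>" "z \<in> ball y \<nu>" for x z
  proof (rule differentiable_bound[OF convex_ball _ _ that])
    show "(H e has_derivative (\<lambda>v. 2 * ((p - e) \<bullet> v) * h' ((norm (p - e))\<^sup>2))) (at p within ball y \<nu>)" for p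
      using H_has_derivative by (rule has_derivative_at_withinI)
    fix p assume p: "p \<in> ball y \<nu>"
    have h0: "0 \<le> h' ((norm (p - e))\<^sup>2)" by (intro h'_nonneg) simp
    have "onorm (\<lambda>v. 2 * ((p - e) \<bullet> v) * h' ((norm (p - e))\<^sup>2)) \<le> F p"
    proof (rule onorm_le)
      fix v
      have "norm (2 * ((p - e) \<bullet> v) * h' ((norm (p - e))\<^sup>2)) = 2 * \<bar>(p - e) \<bullet> v\<bar> * h' ((norm (p - e))\<^sup>2)"
        using h0 by (simp add: abs_mult)
      also have "\<dots> \<le> 2 * (norm (p - e) * norm v) * h' ((norm (p - e))\<^sup>2)"
        using h0 Cauchy_Schwarz_ineq2[of "p - e" v] by (intro mult_right_mono mult_left_mono) auto
      finally show "norm (2 * ((p - e) \<bullet> v) * h' ((norm (p - e))\<^sup>2)) \<le> F p * norm v"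
        by (simp add: F_def mult_ac)
    qed
    also have "F p \<le> F y + \<mu>" using \<nu>(2)[of p] p by (auto simp: dist_real_def dist_commute)
    finally show "onorm (\<lambda>v. 2 * ((p - e) \<bullet> v) * h' ((norm (p - e))\<^sup>2)) \<le> F y + \<mu>" .
  qed
  then show thesis using that[OF \<nu>(1)] by (simp add: F_def)
qed

lemma H_continuous: "continuous_on S (H e)"
  using H_has_derivative[of e] has_derivative_continuous continuous_at_imp_continuous_on by blast

end

section \<open>Kinetic excess over the chord\<close>

context minimizer
begin

definition excess :: "real \<Rightarrow> real \<Rightarrow> real" where
  "excess s t = Kin s t - (norm (\<gamma> t - \<gamma> s))\<^sup>2 / (t - s)"

definition lin :: "real \<Rightarrow> real \<Rightarrow> real \<Rightarrow> 'a" where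
  "lin s t r = \<gamma> s + ((r - s) / (t - s)) *\<^sub>R (\<gamma> t - \<gamma> s)"

lemma lin_segment: "s < t \<Longrightarrow> r \<in> {s..t} \<Longrightarrow> lin s t r \<in> closed_segment (\<gamma> s) (\<gamma> t)"
  unfolding closed_segment_def lin_def
  by (intro CollectI exI[of _ "(r - s) / (t - s)"]) (auto simp: algebra_simps)

lemma lin_continuous: "s < t \<Longrightarrow> continuous_on S (lin s t)"
  unfolding lin_def[abs_def] by (intro continuous_intros) auto

lemma excess_nonneg: "0 \<le> s \<Longrightarrow> s < t \<Longrightarrow> t \<le> \<delta> \<Longrightarrow> 0 \<le> excess s t"
  using Kin_ge[of s t] by (simp add: excess_def field_simps)

text \<open>Cutting at \<open>r\<close> and applying Cauchy-Schwarz on both pieces leaves the corner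
  term of \<open>two_chord_excess\<close> below the excess; then (r - s)(t - r) is at most (t - s)^2
  / 4.\<close>

lemma dev_le_excess:
  assumes st: "0 \<le> s" "s < t" "t \<le> \<delta>" and r: "s \<le> r" "r \<le> t"
  shows "norm (\<gamma> r - lin s t r) \<le> sqrt (excess s t * (t - s)) / 2"
proof (cases "r = s \<or> r = t")
  case True
  then show ?thesis using st excess_nonneg[OF st] by (auto simp: lin_def)
next
  case False
  then have r': "s < r" "r < t" using r by auto
  have "(norm (\<gamma> r - \<gamma> s))\<^sup>2 / (r - s) + (norm (\<gamma> t - \<gamma> r))\<^sup>2 / (t - r) \<le> Kin s r + Kin r t"
    using Kin_ge[of s r] Kin_ge[of r t] st r' by (intro add_mono) (simp_all add: field_simps)
  also have "\<dots> = Kin s t" using Kin_add[of s r t] st r by simp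
  finally have "(norm (\<gamma> r - lin s t r))\<^sup>2 * (t - s) / ((r - s) * (t - r)) \<le> excess s t"
    using two_chord_excess[of "r - s" "t - s" "\<gamma> r - \<gamma> s" "\<gamma> t - \<gamma> s"] r'
    by (simp add: excess_def lin_def diff_diff_eq)
  then have "(norm (\<gamma> r - lin s t r))\<^sup>2 * (t - s) \<le> excess s t * ((r - s) * (t - r))"
    using r' by (simp add: pos_divide_le_eq)
  also have "\<dots> \<le> excess s t * ((t - s)\<^sup>2 / 4)"
  proof (intro mult_left_mono excess_nonneg st)
    have "0 \<le> ((r - s) - (t - r))\<^sup>2" by simp
    then show "(r - s) * (t - r) \<le> (t - s)\<^sup>2 / 4" by (simp add: power2_eq_square algebra_simps)
  qed
  also have "\<dots> = (excess s t * (t - s) / 4) * (t - s)" by (simp add: power2_eq_square)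
  finally have "(norm (\<gamma> r - lin s t r))\<^sup>2 \<le> excess s t * (t - s) / 4"
    by (rule mult_right_le_imp_le) (use st in simp)
  then have "norm (\<gamma> r - lin s t r) \<le> sqrt (excess s t * (t - s) / 4)" by (rule real_le_rsqrt)
  then show ?thesis by (simp add: real_sqrt_divide)
qed

lemma zone_closure:
  assumes ab: "0 \<le> a" "a < b" "b \<le> \<delta>" and zone: "\<And>r. r \<in> {a<..<b} \<Longrightarrow> etaK K (\<gamma> r) = e"
    and r: "r \<in> {a..b}"
  shows "\<gamma> r \<in> phase e"
proof -
  have "\<gamma> ` closure {a<..<b} \<subseteq> phase e"
  proof (rule image_closure_subset)
    show "continuous_on (closure {a<..<b}) \<gamma>" using ab by (intro continuous_on_subset[OF \<gamma>_cont]) auto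
    show "\<gamma> ` {a<..<b} \<subseteq> phase e" using zone phase_eta by force
  qed (rule closed_phase)
  then show ?thesis using r ab by auto
qed

text \<open>Moved by \<open>\<epsilon>\<close> towards its chord, the curve stays in the convex set
  \<open>phase e\<close>, where \<open>V\<close> is at most \<open>H e\<close>, with equality along
  \<open>\<gamma>\<close> except possibly at the two ends. The kinetic gain
  \<open>(2 * \<epsilon> - \<epsilon>^2) * excess s t\<close> is thus at most
  \<open>\<epsilon> * \<Lambda>\<close> times the integrated distance to the chord; dividing by
  \<open>\<epsilon>\<close> and letting it tend to 0 produces the factor 2.\<close>

lemma excess_bound:
  assumes ab: "0 \<le> a" "a < b" "b \<le> \<delta>" and zone: "\<And>r. r \<in> {a<..<b} \<Longrightarrow> etaK K (\<gamma> r) = e"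
    and st: "a \<le> s" "s < t" "t \<le> b" and \<nu>: "\<nu> \<le> \<rho>/2" and ball: "\<And>r. r \<in> {s..t} \<Longrightarrow> \<gamma> r \<in> ball y \<nu>"
    and lip: "\<And>p q. p \<in> ball y \<nu> \<Longrightarrow> q \<in> ball y \<nu> \<Longrightarrow> \<bar>H e p - H e q\<bar> \<le> \<Lambda> * norm (p - q)"
  shows "2 * excess s t \<le> \<Lambda> * integral {s..t} (\<lambda>r. norm (lin s t r - \<gamma> r))"
proof -
  let ?I = "integral {s..t} (\<lambda>r. norm (lin s t r - \<gamma> r))"
  have st': "0 \<le> s" "t \<le> \<delta>" using st ab by auto
  have c\<gamma>: "continuous_on {s..t} \<gamma>" using st' by (intro continuous_on_subset[OF \<gamma>_cont]) auto
  have cl: "continuous_on {s..t} (lin s t)" using st by (intro lin_continuous)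
  have lball: "lin s t r \<in> ball y \<nu>" if "r \<in> {s..t}" for r
    using lin_segment[OF st(2) that] closed_segment_subset[OF _ _ convex_ball, of "\<gamma> s" y \<nu> "\<gamma> t"] ball[of s] ball[of t] st by auto
  have ph: "\<gamma> r \<in> phase e" if "r \<in> {s..t}" for r using zone_closure[OF ab zone] that st by auto
  have lph: "lin s t r \<in> phase e" if "r \<in> {s..t}" for r
    using lin_segment[OF st(2) that] closed_segment_subset[OF _ _ convex_phase, of "\<gamma> s" e "\<gamma> t"] ph[of s] ph[of t] st by auto
  have main: "(2 - \<epsilon>) * excess s t \<le> \<Lambda> * ?I" if \<epsilon>: "0 < \<epsilon>" "\<epsilon> \<le> 1" for \<epsilon>
  proof -
    define \<sigma> where "\<sigma> r = \<gamma> r + \<epsilon> *\<^sub>R (lin s t r - \<gamma> r)" for r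
    have \<sigma>_eq: "\<sigma> r = (1 - \<epsilon>) *\<^sub>R \<gamma> r + \<epsilon> *\<^sub>R lin s t r" for r by (simp add: \<sigma>_def algebra_simps)
    have c\<sigma>: "continuous_on {s..t} \<sigma>" unfolding \<sigma>_def by (intro continuous_intros c\<gamma> cl)
    have \<sigma>ball: "\<sigma> r \<in> ball y \<nu>" if r: "r \<in> {s..t}" for r
      unfolding \<sigma>_eq by (rule convexD[OF convex_ball]) (use ball[OF r] lball[OF r] \<epsilon> in auto)
    have \<sigma>ph: "\<sigma> r \<in> phase e" if r: "r \<in> {s..t}" for r
      unfolding \<sigma>_eq by (rule convexD[OF convex_phase]) (use ph[OF r] lph[OF r] \<epsilon> in auto)
    have "(2 * \<epsilon> - \<epsilon>\<^sup>2) * excess s t + integral {s..t} (\<lambda>r. V (\<gamma> r)) \<le> integral {s..t} (\<lambda>r. V (\<sigma> r))"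
      unfolding \<sigma>_def lin_def excess_def using st st' \<epsilon> ball \<nu> by (intro comparison_chord[of s t y]) force+
    also have "\<dots> \<le> integral {s..t} (\<lambda>r. H e (\<sigma> r))"
      using \<sigma>ph V_le by (intro integral_le V_integrable c\<sigma> integrable_continuous_real continuous_on_compose2[OF H_continuous c\<sigma>, of UNIV]) auto
    also have "\<dots> \<le> integral {s..t} (\<lambda>r. H e (\<gamma> r) + \<epsilon> * \<Lambda> * norm (lin s t r - \<gamma> r))"
    proof (rule integral_le)
      show "(\<lambda>r. H e (\<sigma> r)) integrable_on {s..t}"
        by (intro integrable_continuous_real continuous_on_compose2[OF H_continuous c\<sigma>, of UNIV]) auto
      show "(\<lambda>r. H e (\<gamma> r) + \<epsilon> * \<Lambda> * norm (lin s t r - \<gamma> r)) integrable_on {s..t}"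
        by (intro integrable_continuous_real continuous_intros c\<gamma> cl continuous_on_compose2[OF H_continuous c\<gamma>, of UNIV]) auto
      fix r assume r: "r \<in> {s..t}"
      have "H e (\<sigma> r) - H e (\<gamma> r) \<le> \<Lambda> * norm (\<sigma> r - \<gamma> r)" using lip[OF \<sigma>ball[OF r] ball[OF r]] by linarith
      also have "norm (\<sigma> r - \<gamma> r) = \<epsilon> * norm (lin s t r - \<gamma> r)" using \<epsilon> by (simp add: \<sigma>_def)
      finally show "H e (\<sigma> r) \<le> H e (\<gamma> r) + \<epsilon> * \<Lambda> * norm (lin s t r - \<gamma> r)" by (simp add: mult_ac)
    qed
    also have "\<dots> = integral {s..t} (\<lambda>r. H e (\<gamma> r)) + \<epsilon> * \<Lambda> * ?I"
    proof -
      have "(\<lambda>r. H e (\<gamma> r)) integrable_on {s..t}"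
        by (intro integrable_continuous_real continuous_on_compose2[OF H_continuous c\<gamma>, of UNIV]) auto
      moreover have "(\<lambda>r. \<epsilon> * \<Lambda> * norm (lin s t r - \<gamma> r)) integrable_on {s..t}"
        by (intro integrable_continuous_real continuous_intros c\<gamma> cl)
      ultimately show ?thesis by (simp add: Henstock_Kurzweil_Integration.integral_add)
    qed
    also have "integral {s..t} (\<lambda>r. H e (\<gamma> r)) = integral {s..t} (\<lambda>r. V (\<gamma> r))"
    proof (rule integral_spike[of "{s,t}"])
      fix r assume "r \<in> {s..t} - {s,t}"
      then have "etaK K (\<gamma> r) = e" using st by (intro zone) auto
      then show "V (\<gamma> r) = H e (\<gamma> r)" by (rule V_eq_H)
    qed auto
    finally have "\<epsilon> * ((2 - \<epsilon>) * excess s t) \<le> \<epsilon> * (\<Lambda> * ?I)"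
      by (simp add: power2_eq_square algebra_simps)
    then show ?thesis using \<epsilon> by simp
  qed
  have "((\<lambda>\<epsilon>. (2 - \<epsilon>) * excess s t) \<longlongrightarrow> (2 - 0) * excess s t) (at_right 0)"
    by (intro tendsto_intros filterlim_ident)
  moreover have "\<forall>\<^sub>F \<epsilon> in at_right 0. (2 - \<epsilon>) * excess s t \<le> \<Lambda> * ?I"
    using main by (intro eventually_at_rightI[of 0 1]) auto
  ultimately show "2 * excess s t \<le> \<Lambda> * ?I"
    using tendsto_upperbound[of "\<lambda>\<epsilon>. (2 - \<epsilon>) * excess s t"] by fastforce
qed

end

section \<open>Second-order bounds from the excess\<close>

lemma has_integral_sq_centered:
  fixes q r :: real
  assumes "q > 0"
  shows "((\<lambda>y. (y - r)\<^sup>2) has_integral 2 * q ^ 3 / 3) {r - q..r + q}"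
proof -
  have "((\<lambda>y. (y - r)\<^sup>2) has_integral (((r + q) - r) ^ 3 / 3 - ((r - q) - r) ^ 3 / 3)) {r - q..r + q}"
    by (rule fundamental_theorem_of_calculus)
       (use assms in \<open>auto intro!: derivative_eq_intros simp: has_real_derivative_iff_has_vector_derivative[symmetric]\<close>)
  then show ?thesis by simp
qed

context minimizer
begin

text \<open>Excess and deviation from the chord bound each other. With X^2 = excess * (t - s), the
  deviation is at most X/2, and the excess is at most C X (t - s) / 4. Hence X^2 <= X C (t - s)^2 /
  4, and the deviation is at most (C/8) (t - s)^2, as \<open>chord_error_imp_C11\<close>
  requires.\<close>

lemma zone_C11:
  assumes ab: "0 \<le> a" "a < b" "b \<le> \<delta>" and zone: "\<And>r. r \<in> {a<..<b} \<Longrightarrow> etaK K (\<gamma> r) = e"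
  shows "C11_on a b \<gamma>"
proof -
  define \<beta> where "\<beta> = \<rho>/2"
  have \<beta>: "\<beta> > 0" using \<rho> by (simp add: \<beta>_def)
  have "uniformly_continuous_on {0..\<delta>} \<gamma>" by (intro compact_uniformly_continuous \<gamma>_cont) auto
  then obtain d where d: "d > 0" "\<And>r s. r \<in> {0..\<delta>} \<Longrightarrow> s \<in> {0..\<delta>} \<Longrightarrow> dist r s < d \<Longrightarrow> dist (\<gamma> r) (\<gamma> s) < \<beta>"
    using \<beta> unfolding uniformly_continuous_on_def by metis
  have "bounded (\<gamma> ` {0..\<delta>})" by (intro compact_imp_bounded compact_continuous_image \<gamma>_cont) auto
  then obtain R1 where R1: "\<And>r. r \<in> {0..\<delta>} \<Longrightarrow> norm (\<gamma> r) \<le> R1" unfolding bounded_iff by (metis imageI)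
  obtain R0 where R0: "R0 > 0" "\<And>e. e \<in> convex hull K \<Longrightarrow> norm e \<le> R0" using hull_K_bounded by blast
  obtain C where C: "C \<ge> 0" "\<And>e x y. norm e \<le> max R0 (R1 + \<beta>) \<Longrightarrow> norm x \<le> max R0 (R1 + \<beta>) \<Longrightarrow> norm y \<le> max R0 (R1 + \<beta>)
      \<Longrightarrow> \<bar>H e x - H e y\<bar> \<le> C * norm (x - y)"
    using H_lipschitz_bounded[of "max R0 (R1 + \<beta>)"] by blast
  have "e \<in> convex hull K" using eta_hull_K[of "\<gamma> ((a+b)/2)"] zone[of "(a+b)/2"] ab by simp
  then have ne: "norm e \<le> max R0 (R1 + \<beta>)" using R0(2)[of e] by simp
  show ?thesis
  proof (rule chord_error_imp_C11[of a b "d/2" \<gamma> "C/8"])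
    fix s r t assume st: "a \<le> s" "s \<le> r" "r \<le> t" "t \<le> b" "s < t" "t - s \<le> d/2"
    have sd: "0 \<le> s" "t \<le> \<delta>" using st ab by auto
    have ball: "\<gamma> z \<in> ball (\<gamma> s) \<beta>" if "z \<in> {s..t}" for z
      using d(2)[of s z] that st sd d(1) by (auto simp: dist_real_def)
    have nb: "norm z \<le> max R0 (R1 + \<beta>)" if "z \<in> ball (\<gamma> s) \<beta>" for z
      using that R1[of s] sd st norm_triangle_ineq2[of z "\<gamma> s"] by (auto simp: dist_norm norm_minus_commute)
    define X where "X = sqrt (excess s t * (t - s))"
    have ex0: "0 \<le> excess s t" using sd st by (intro excess_nonneg) auto
    have X: "X \<ge> 0" "X\<^sup>2 = excess s t * (t - s)" using ex0 st by (auto simp: X_def)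
    have dev: "norm (\<gamma> z - lin s t z) \<le> X / 2" if "s \<le> z" "z \<le> t" for z
      unfolding X_def using sd st that by (intro dev_le_excess) auto
    have "2 * excess s t \<le> C * integral {s..t} (\<lambda>r. norm (lin s t r - \<gamma> r))"
      using ball nb ne by (intro excess_bound[of a b e s t \<beta> "\<gamma> s"] ab zone st C(2)) (auto simp: \<beta>_def)
    also have "\<dots> \<le> C * (X / 2 * (t - s))"
    proof (intro mult_left_mono integral_le_const C(1))
      show "(\<lambda>r. norm (lin s t r - \<gamma> r)) integrable_on {s..t}"
        using st sd by (intro integrable_continuous_real continuous_intros lin_continuous continuous_on_subset[OF \<gamma>_cont]) auto
    qed (use st dev in \<open>auto simp: norm_minus_commute\<close>)
    finally have "2 * excess s t * (t - s) \<le> C * (X / 2 * (t - s)) * (t - s)"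
      using st by (intro mult_right_mono) auto
    then have le: "X * X \<le> X * (C / 4 * (t - s)\<^sup>2)" using X(2) by (simp add: power2_eq_square mult_ac)
    have "X \<le> C / 4 * (t - s)\<^sup>2"
    proof (cases "X = 0")
      case False
      then show ?thesis using le X(1) by (simp add: mult_le_cancel_left_pos)
    qed (use C in auto)
    then show "norm (\<gamma> r - (\<gamma> s + ((r - s) / (t - s)) *\<^sub>R (\<gamma> t - \<gamma> s))) \<le> C/8 * (t - s)\<^sup>2"
      using dev[of r] st unfolding lin_def by simp
  qed (use C d ab in auto)
qed

text \<open>A blow-up at \<open>r\<close>: on [r - q, r + q] the curve is a parabola up to o(q^2).
  Inserting its excess (2/3) n^2 q^3 and its integrated distance to the chord (2/3) n q^3 into
  \<open>excess_bound\<close> with constant 2 F gives n^2 <= F n.\<close>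

lemma zone_acceleration:
  assumes ab: "0 \<le> a" "a < b" "b \<le> \<delta>" and zone: "\<And>r. r \<in> {a<..<b} \<Longrightarrow> etaK K (\<gamma> r) = e"
    and g: "\<And>t. t \<in> {a<..<b} \<Longrightarrow> (\<gamma> has_vector_derivative g t) (at t)"
    and r: "r \<in> {a<..<b}" and A: "(g has_vector_derivative A) (at r)"
  shows "norm A \<le> h' ((norm (\<gamma> r - e))\<^sup>2) * norm (\<gamma> r - e)"
proof -
  define F where "F = h' ((norm (\<gamma> r - e))\<^sup>2) * norm (\<gamma> r - e)"
  have F0: "F \<ge> 0" unfolding F_def by (intro mult_nonneg_nonneg h'_nonneg) auto
  define n where "n = norm A"
  \<comment> \<open>A single \<open>\<mu>\<close> measures the errors in the expansion of
    \<open>g\<close> and in the Lipschitz constant of \<open>H e\<close>. The factor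
    \<open>q ^ 3\<close> cancels, so the inequality no longer involves \<open>q\<close> and
    \<open>\<mu>\<close> may tend to 0.\<close>
  have key: "2 * (2/3 * n\<^sup>2 - 8 * n * \<mu>) \<le> (2 * F + \<mu>) * (2/3 * n + 8 * \<mu>)" if \<mu>: "\<mu> > 0" for \<mu>
  proof -
    obtain \<nu>0 where \<nu>0: "\<nu>0 > 0" "\<And>x z. x \<in> ball (\<gamma> r) \<nu>0 \<Longrightarrow> z \<in> ball (\<gamma> r) \<nu>0 \<Longrightarrow>
        \<bar>H e x - H e z\<bar> \<le> (2 * F + \<mu>) * norm (x - z)"
      using H_local_lipschitz[OF \<mu>, of "\<gamma> r" e] unfolding F_def by blast
    define \<nu> where "\<nu> = min \<nu>0 (\<rho>/2)"
    have \<nu>: "\<nu> > 0" "\<nu> \<le> \<nu>0" "\<nu> \<le> \<rho>/2" using \<nu>0 \<rho> by (auto simp: \<nu>_def)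
    obtain d1 where d1: "d1 > 0" "\<And>y. \<bar>y - r\<bar> < d1 \<Longrightarrow> norm (g y - g r - (y - r) *\<^sub>R A) \<le> \<mu> * \<bar>y - r\<bar>"
      using A \<mu> unfolding has_vector_derivative_def has_derivative_at_alt real_norm_def by blast
    have "isCont \<gamma> r" using g[OF r] has_vector_derivative_continuous by blast
    then obtain d2 where d2: "d2 > 0" "\<And>y. dist y r < d2 \<Longrightarrow> dist (\<gamma> y) (\<gamma> r) < \<nu>"
      using \<nu>(1) unfolding continuous_at_eps_delta by blast
    define q where "q = Min {d1, d2, r - a, b - r} / 2"
    have q: "0 < q" "q < d1" "q < d2" "a < r - q" "r + q < b"
    proof -
      have "0 < Min {d1, d2, r - a, b - r}" using d1 d2 r by auto
      moreover have "Min {d1, d2, r - a, b - r} \<le> d1" "Min {d1, d2, r - a, b - r} \<le> d2"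
        "Min {d1, d2, r - a, b - r} \<le> r - a" "Min {d1, d2, r - a, b - r} \<le> b - r" by auto
      ultimately show "0 < q" "q < d1" "q < d2" "a < r - q" "r + q < b" unfolding q_def by linarith+
    qed
    define s where "s = r - q"
    define t where "t = r + q"
    have st: "s < t" "t - s = 2 * q" "a < s" "t < b" "0 \<le> s" "t \<le> \<delta>" using q ab by (auto simp: s_def t_def)
    have abs_le: "\<bar>y - r\<bar> \<le> q" if "y \<in> {s..t}" for y using that by (auto simp: s_def t_def)
    define \<psi> where "\<psi> y = g y - g r - (y - r) *\<^sub>R A" for y
    have \<psi>: "norm (\<psi> y) \<le> \<mu> * q" if "y \<in> {s..t}" for y
    proof -
      have "norm (\<psi> y) \<le> \<mu> * \<bar>y - r\<bar>" unfolding \<psi>_def using abs_le[OF that] q by (intro d1(2)) auto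
      also have "\<dots> \<le> \<mu> * q" using abs_le[OF that] \<mu> by (intro mult_left_mono) auto
      finally show ?thesis .
    qed
    \<comment> \<open>The second-order Taylor remainder of \<open>\<gamma>\<close>; its derivative
      is \<open>\<psi>\<close>, so it is at most \<mu> q^2.\<close>
    define w where "w y = \<gamma> y - \<gamma> r - (y - r) *\<^sub>R g r - ((y - r)\<^sup>2 / 2) *\<^sub>R A" for y
    have w: "norm (w y) \<le> \<mu> * q\<^sup>2" if y: "y \<in> {s..t}" for y
    proof -
      have "norm (w y - w r) \<le> (\<mu> * q) * norm (y - r)"
      proof (rule differentiable_bound[of "{s..t}" w "\<lambda>z x. x *\<^sub>R \<psi> z"])
        fix z assume z: "z \<in> {s..t}"
        have "(\<gamma> has_vector_derivative g z) (at z)" using z st by (intro g) auto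
        then have "(w has_vector_derivative \<psi> z) (at z)"
          unfolding w_def[abs_def] \<psi>_def by (auto intro!: derivative_eq_intros simp: algebra_simps diff_divide_distrib)
        then show "(w has_derivative (\<lambda>x. x *\<^sub>R \<psi> z)) (at z within {s..t})"
          unfolding has_vector_derivative_def by (rule has_derivative_at_withinI)
        show "onorm (\<lambda>x. x *\<^sub>R \<psi> z) \<le> \<mu> * q"
          using \<psi>[OF z] by (intro onorm_le) (auto simp: mult.commute mult_left_mono)
      qed (use y q in \<open>auto simp: s_def t_def\<close>)
      also have "\<dots> \<le> (\<mu> * q) * q" using abs_le[OF y] \<mu> q by (intro mult_left_mono) auto
      finally show ?thesis by (simp add: w_def power2_eq_square)
    qed
    have \<gamma>_w: "\<gamma> y = \<gamma> r + (y - r) *\<^sub>R g r + ((y - r)\<^sup>2 / 2) *\<^sub>R A + w y" for y by (simp add: w_def)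
    define m where "m = (1 / (t - s)) *\<^sub>R (\<gamma> t - \<gamma> s)"
    \<comment> \<open>The quadratic term is even about \<open>r\<close> and cancels in
      \<open>\<gamma> t - \<gamma> s\<close>, so the mean velocity differs from \<open>g r\<close>
      by remainders only.\<close>
    define p where "p = (1 / (2 * q)) *\<^sub>R (w t - w s)"
    have mp: "m = g r + p"
    proof -
      have "\<gamma> t - \<gamma> s = (2 * q) *\<^sub>R g r + (w t - w s)"
        unfolding \<gamma>_w[of t] \<gamma>_w[of s] by (simp add: s_def t_def algebra_simps flip: scaleR_add_left)
      then show ?thesis unfolding m_def p_def st(2) using q by (simp add: scaleR_add_right)
    qed
    have p: "norm p \<le> \<mu> * q"
    proof -
      have "norm (w t - w s) \<le> \<mu> * q\<^sup>2 + \<mu> * q\<^sup>2"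
        using norm_triangle_ineq4[of "w t" "w s"] w[of t] w[of s] st by auto
      then have "norm (w t - w s) / (2 * q) \<le> (\<mu> * q\<^sup>2 + \<mu> * q\<^sup>2) / (2 * q)"
        using q(1) by (intro divide_right_mono) auto
      also have "\<dots> = \<mu> * q" using q(1) by (simp add: power2_eq_square)
      finally show ?thesis using q(1) by (simp add: p_def)
    qed
    have velg: "vel y = g y" if "y \<in> {s..t}" for y
    proof -
      have "at y within {0..\<delta>} = at y" using that st ab by (intro at_within_Icc_at) auto
      then show ?thesis unfolding vel_def using g[of y] that st by (simp add: vector_derivative_at)
    qed
    have devI: "((\<lambda>y. (norm (vel y - m))\<^sup>2) has_integral excess s t) {s..t}"
      unfolding m_def excess_def using st by (intro vel_dev) auto
    have sqI: "((\<lambda>y. (y - r)\<^sup>2) has_integral 2 * q ^ 3 / 3) {s..t}"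
      unfolding s_def t_def by (rule has_integral_sq_centered[OF q(1)])
    have constI: "((\<lambda>y. c) has_integral 2 * q * c) {s..t}" for c :: real
      using has_integral_const_real[of c s t] st by simp
    \<comment> \<open>The velocity minus its mean is (y - r) A plus remainders Z of size at most 2
      \<mu> q. The main square integrates to (2/3) n^2 q^3, the cross term is bounded by 4 n \<mu>
      q^2, and the square of Z is dropped.\<close>
    have low: "n\<^sup>2 * (2 * q ^ 3 / 3) - 2 * q * (4 * n * \<mu> * q\<^sup>2) \<le> excess s t"
    proof (rule has_integral_le[OF has_integral_diff[OF has_integral_mult_right[OF sqI] constI] devI])
      fix y assume y: "y \<in> {s..t}"
      define X where "X = (y - r) *\<^sub>R A"
      define Z where "Z = \<psi> y - p"
      have "vel y - m = X + Z" unfolding velg[OF y] mp X_def Z_def \<psi>_def by simp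
      then have "(norm (vel y - m))\<^sup>2 = (norm X)\<^sup>2 + 2 * (X \<bullet> Z) + (norm Z)\<^sup>2"
        by (simp add: power2_norm_eq_inner inner_add_left inner_add_right inner_commute)
      moreover have "\<bar>X \<bullet> Z\<bar> \<le> (q * n) * (2 * (\<mu> * q))"
      proof -
        have "\<bar>X \<bullet> Z\<bar> \<le> norm X * norm Z" by (rule Cauchy_Schwarz_ineq2)
        also have "\<dots> \<le> (q * n) * (2 * (\<mu> * q))"
          using abs_le[OF y] \<psi>[OF y] p norm_triangle_ineq4[of "\<psi> y" p] q
          by (intro mult_mono) (auto simp: X_def Z_def n_def intro: mult_right_mono)
        finally show ?thesis .
      qed
      moreover have "(norm X)\<^sup>2 = n\<^sup>2 * (y - r)\<^sup>2" by (simp add: X_def n_def power_mult_distrib)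
      moreover have "2 * ((q * n) * (2 * (\<mu> * q))) = 4 * n * \<mu> * q\<^sup>2" by (simp add: power2_eq_square)
      ultimately show "n\<^sup>2 * (y - r)\<^sup>2 - 4 * n * \<mu> * q\<^sup>2 \<le> (norm (vel y - m))\<^sup>2"
        using zero_le_power2[of "norm Z"] by linarith
    qed
    \<comment> \<open>The parabola is at distance (q^2 - (y - r)^2) n / 2 from its chord. The error
      4 \<mu> q^2 collects \<mu> q^2 from each of \<open>w s\<close> and \<open>w y\<close> and 2
      \<mu> q^2 from the correction \<open>p\<close> of the slope.\<close>
    have up: "integral {s..t} (\<lambda>y. norm (lin s t y - \<gamma> y)) \<le> 2 * q * (n * q\<^sup>2 / 2 + 4 * \<mu> * q\<^sup>2) - n / 2 * (2 * q ^ 3 / 3)"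
    proof (rule has_integral_le[OF integrable_integral has_integral_diff[OF constI has_integral_mult_right[OF sqI]]])
      show "(\<lambda>r. norm (lin s t r - \<gamma> r)) integrable_on {s..t}"
        using st by (intro integrable_continuous_real continuous_intros lin_continuous continuous_on_subset[OF \<gamma>_cont]) auto
      fix y assume y: "y \<in> {s..t}"
      have "lin s t y = \<gamma> s + (y - s) *\<^sub>R m" by (simp add: lin_def m_def)
      also have "\<dots> = \<gamma> r + (y - r) *\<^sub>R g r + (q\<^sup>2 / 2) *\<^sub>R A + w s + (y - s) *\<^sub>R p"
        unfolding mp \<gamma>_w[of s] by (simp add: s_def algebra_simps)
      finally have "lin s t y - \<gamma> y = ((q\<^sup>2 - (y - r)\<^sup>2) / 2) *\<^sub>R A + (w s + (y - s) *\<^sub>R p - w y)"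
        unfolding \<gamma>_w[of y] by (simp add: diff_divide_distrib scaleR_diff_left)
      then have "norm (lin s t y - \<gamma> y) \<le> norm (((q\<^sup>2 - (y - r)\<^sup>2) / 2) *\<^sub>R A) + norm (w s + (y - s) *\<^sub>R p - w y)"
        by (metis norm_triangle_ineq)
      moreover have "norm (((q\<^sup>2 - (y - r)\<^sup>2) / 2) *\<^sub>R A) = (q\<^sup>2 - (y - r)\<^sup>2) / 2 * n"
      proof -
        have "(y - r)\<^sup>2 \<le> q\<^sup>2" using abs_le[OF y] q by (simp add: abs_le_square_iff[symmetric])
        then show ?thesis by (simp add: n_def)
      qed
      moreover have "norm (w s + (y - s) *\<^sub>R p - w y) \<le> 4 * \<mu> * q\<^sup>2"
      proof -
        have "norm ((y - s) *\<^sub>R p) \<le> (2 * q) * (\<mu> * q)"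
          using p y st by (simp only: norm_scaleR) (intro mult_mono, auto)
        moreover have "norm (w s) \<le> \<mu> * q\<^sup>2" "norm (w y) \<le> \<mu> * q\<^sup>2" using w[of s] w[OF y] st by auto
        moreover have "norm (w s + (y - s) *\<^sub>R p - w y) \<le> norm (w s) + norm ((y - s) *\<^sub>R p) + norm (w y)"
          using norm_triangle_ineq4[of "w s + (y - s) *\<^sub>R p" "w y"] norm_triangle_ineq[of "w s" "(y - s) *\<^sub>R p"] by linarith
        moreover have "(2 * q) * (\<mu> * q) = 2 * (\<mu> * q\<^sup>2)" by (simp add: power2_eq_square)
        ultimately show ?thesis by linarith
      qed
      ultimately show "norm (lin s t y - \<gamma> y) \<le> (n * q\<^sup>2 / 2 + 4 * \<mu> * q\<^sup>2) - n / 2 * (y - r)\<^sup>2"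
        by (simp add: field_simps)
    qed
    have "2 * excess s t \<le> (2 * F + \<mu>) * integral {s..t} (\<lambda>y. norm (lin s t y - \<gamma> y))"
    proof (rule excess_bound[of a b e s t \<nu> "\<gamma> r"])
      show "\<gamma> y \<in> ball (\<gamma> r) \<nu>" if "y \<in> {s..t}" for y
        using d2(2)[of y] abs_le[OF that] q by (auto simp: dist_commute dist_real_def)
    qed (use ab zone st \<nu> \<nu>0 in auto)
    also have "\<dots> \<le> (2 * F + \<mu>) * (2 * q * (n * q\<^sup>2 / 2 + 4 * \<mu> * q\<^sup>2) - n / 2 * (2 * q ^ 3 / 3))"
      using up F0 \<mu> by (intro mult_left_mono) auto
    also have "2 * q * (n * q\<^sup>2 / 2 + 4 * \<mu> * q\<^sup>2) - n / 2 * (2 * q ^ 3 / 3) = q ^ 3 * (2/3 * n + 8 * \<mu>)"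
      by (simp add: power2_eq_square power3_eq_cube field_simps)
    finally have fin: "2 * excess s t \<le> (2 * F + \<mu>) * (q ^ 3 * (2/3 * n + 8 * \<mu>))" .
    have "n\<^sup>2 * (2 * q ^ 3 / 3) - 2 * q * (4 * n * \<mu> * q\<^sup>2) = q ^ 3 * (2/3 * n\<^sup>2 - 8 * n * \<mu>)"
      by (simp add: power2_eq_square power3_eq_cube field_simps)
    then have "2 * (q ^ 3 * (2/3 * n\<^sup>2 - 8 * n * \<mu>)) \<le> (2 * F + \<mu>) * (q ^ 3 * (2/3 * n + 8 * \<mu>))"
      using low fin by linarith
    then have "q ^ 3 * (2 * (2/3 * n\<^sup>2 - 8 * n * \<mu>)) \<le> q ^ 3 * ((2 * F + \<mu>) * (2/3 * n + 8 * \<mu>))"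
      by (simp only: mult_ac)
    then show ?thesis using q by (simp only: mult_le_cancel_left_pos zero_less_power)
  qed
  have "((\<lambda>\<mu>. 2 * (2/3 * n\<^sup>2 - 8 * n * \<mu>)) \<longlongrightarrow> 2 * (2/3 * n\<^sup>2 - 8 * n * 0)) (at_right 0)"
    by (intro tendsto_intros filterlim_ident)
  moreover have "((\<lambda>\<mu>. (2 * F + \<mu>) * (2/3 * n + 8 * \<mu>)) \<longlongrightarrow> (2 * F + 0) * (2/3 * n + 8 * 0)) (at_right 0)"
    by (intro tendsto_intros filterlim_ident)
  moreover have "\<forall>\<^sub>F \<mu> in at_right 0. 2 * (2/3 * n\<^sup>2 - 8 * n * \<mu>) \<le> (2 * F + \<mu>) * (2/3 * n + 8 * \<mu>)"
    using key by (intro eventually_at_rightI[of 0 1]) auto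
  ultimately have "2 * (2/3 * n\<^sup>2 - 8 * n * 0) \<le> (2 * F + 0) * (2/3 * n + 8 * 0)"
    using tendsto_le[OF trivial_limit_at_right_real] by blast
  then have "n * n \<le> n * F" by (simp add: power2_eq_square mult.commute)
  then have "n \<le> F" using F0 norm_ge_zero[of A] unfolding n_def[symmetric] by (cases "n = 0") auto
  then show ?thesis by (simp add: n_def F_def)
qed

end

section \<open>Finiteness of the shocks\<close>

lemma integral_shift_eq:
  fixes f :: "real \<Rightarrow> real"
  shows "integral {s..t} (\<lambda>r. f (\<tau> + r)) = integral {\<tau> + s..\<tau> + t} f"
proof -
  have "((\<lambda>r. f (\<tau> + r)) has_integral y) {s..t} \<longleftrightarrow> (f has_integral y) {\<tau> + s..\<tau> + t}" for y
    using has_integral_affinity_iff[of 1 f \<tau> y "\<tau> + s" "\<tau> + t"] by (simp add: add.commute)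
  then show ?thesis unfolding integral_def integrable_on_def by simp
qed

lemma integral_reflect_eq:
  fixes f :: "real \<Rightarrow> real"
  shows "integral {s..t} (\<lambda>r. f (\<tau> - r)) = integral {\<tau> - t..\<tau> - s} f"
  using Henstock_Kurzweil_Integration.integral_reflect_real[of "-s" "-t" "\<lambda>r. f (\<tau> + r)"]
    integral_shift_eq[of "-t" "-s" f \<tau>] by simp

context minimizer
begin

lemma one_sided_setup:
  assumes \<tau>: "\<tau> \<in> {0..\<delta>}"
  obtains d C where "d > 0" "C \<ge> 0" "\<And>s. s \<in> {0..\<delta>} \<Longrightarrow> \<bar>s - \<tau>\<bar> \<le> d \<Longrightarrow> \<gamma> s \<in> ball (\<gamma> \<tau>) (\<rho>/2)"
    "\<And>e y z. \<lbrakk>e \<in> convex hull K; y \<in> ball (\<gamma> \<tau>) (\<rho>/2); z \<in> ball (\<gamma> \<tau>) (\<rho>/2)\<rbrakk> \<Longrightarrow> \<bar>H e y - H e z\<bar> \<le> C * norm (y - z)"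
proof -
  obtain d where d: "d > 0" "\<And>s. s \<in> {0..\<delta>} \<Longrightarrow> dist s \<tau> < d \<Longrightarrow> dist (\<gamma> s) (\<gamma> \<tau>) < \<rho>/2"
    using \<gamma>_cont \<tau> half_gt_zero[OF \<rho>] unfolding continuous_on_iff by metis
  obtain R0 where R0: "R0 > 0" "\<And>e. e \<in> convex hull K \<Longrightarrow> norm e \<le> R0" using hull_K_bounded by blast
  define R where "R = max R0 (norm (\<gamma> \<tau>) + \<rho>/2)"
  obtain C where C: "C \<ge> 0" "\<And>e x y. norm e \<le> R \<Longrightarrow> norm x \<le> R \<Longrightarrow> norm y \<le> R \<Longrightarrow> \<bar>H e x - H e y\<bar> \<le> C * norm (x - y)"
    using H_lipschitz_bounded[of R] by blast
  have nb: "norm z \<le> R" if "z \<in> ball (\<gamma> \<tau>) (\<rho>/2)" for z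
    using that norm_triangle_ineq2[of z "\<gamma> \<tau>"] by (auto simp: R_def dist_norm norm_minus_commute)
  have ne: "norm e \<le> R" if "e \<in> convex hull K" for e using R0(2)[OF that] by (simp add: R_def)
  show thesis
  proof (rule that[of "d/2" C])
    show "\<gamma> s \<in> ball (\<gamma> \<tau>) (\<rho>/2)" if "s \<in> {0..\<delta>}" "\<bar>s - \<tau>\<bar> \<le> d/2" for s
      using d(2)[of s] that d(1) by (auto simp: dist_real_def dist_commute)
  qed (use d C nb ne in auto)
qed

lemma right_constant_zone:
  assumes \<tau>: "0 \<le> \<tau>" "\<tau> < \<delta>"
  shows "\<exists>r>0. \<exists>e. \<forall>s\<in>{\<tau><..<\<tau> + r}. s \<le> \<delta> \<and> etaK K (\<gamma> s) = e"
proof -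
  obtain d C where d: "d > 0" "C \<ge> 0" "\<And>s. s \<in> {0..\<delta>} \<Longrightarrow> \<bar>s - \<tau>\<bar> \<le> d \<Longrightarrow> \<gamma> s \<in> ball (\<gamma> \<tau>) (\<rho>/2)"
    "\<And>e y z. \<lbrakk>e \<in> convex hull K; y \<in> ball (\<gamma> \<tau>) (\<rho>/2); z \<in> ball (\<gamma> \<tau>) (\<rho>/2)\<rbrakk> \<Longrightarrow> \<bar>H e y - H e z\<bar> \<le> C * norm (y - z)"
    using one_sided_setup[of \<tau>] \<tau> by auto
  define T0 where "T0 = min d (\<delta> - \<tau>)"
  have Tb: "T0 > 0" "T0 \<le> d" "\<tau> + T0 \<le> \<delta>" using d \<tau> by (auto simp: T0_def)
  interpret one_sided K h h' "\<lambda>s. \<gamma> (\<tau> + s)" T0 "\<rho>/2" C "\<lambda>s t. Kin (\<tau> + s) (\<tau> + t)"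
  proof
    show "continuous_on {0..T0} (\<lambda>s. \<gamma> (\<tau> + s))"
      using Tb \<tau> by (intro continuous_on_compose2[OF \<gamma>_cont] continuous_intros) auto
    show "Kin (\<tau> + s) (\<tau> + t) = Kin (\<tau> + s) (\<tau> + r) + Kin (\<tau> + r) (\<tau> + t)" if "0 \<le> s" "s \<le> r" "r \<le> t" "t \<le> T0" for s r t
      using that Tb \<tau> by (intro Kin_add) auto
    show "(norm (\<gamma> (\<tau> + t) - \<gamma> (\<tau> + s)))\<^sup>2 \<le> (t - s) * Kin (\<tau> + s) (\<tau> + t)" if "0 \<le> s" "s < t" "t \<le> T0" for s t
      using Kin_ge[of "\<tau> + s" "\<tau> + t"] that Tb \<tau> by auto
    show "\<gamma> (\<tau> + r) \<in> ball (\<gamma> (\<tau> + 0)) (\<rho>/2)" if "r \<in> {0..T0}" for r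
      using d(3)[of "\<tau> + r"] that Tb \<tau> by auto
    fix s m t w w'
    assume st: "0 \<le> s" "s < m" "m < t" "t \<le> T0" and e: "\<gamma> (\<tau> + t) = \<gamma> (\<tau> + s) + (m - s) *\<^sub>R w + (t - m) *\<^sub>R w'"
      and b: "\<gamma> (\<tau> + s) + (m - s) *\<^sub>R w \<in> ball (\<gamma> (\<tau> + 0)) (\<rho>/2)"
    have "Kin (\<tau> + s) (\<tau> + t) + integral {\<tau> + s..\<tau> + t} (\<lambda>r. V (\<gamma> r)) \<le> ((\<tau> + m) - (\<tau> + s)) * (norm w)\<^sup>2 + ((\<tau> + t) - (\<tau> + m)) * (norm w')\<^sup>2
         + integral {\<tau> + s..\<tau> + t} (\<lambda>r. V (poly_curve (\<tau> + s) (\<tau> + m) (\<gamma> (\<tau> + s)) w w' r))"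
    proof (rule comparison_poly[of _ _ _ _ _ "\<gamma> \<tau>"])
      show "\<gamma> r \<in> ball (\<gamma> \<tau>) (\<rho>/2)" if "r \<in> {\<tau> + s..\<tau> + t}" for r using that st Tb \<tau> by (intro d(3)) auto
    qed (use st Tb \<tau> e b in auto)
    moreover have "poly_curve (\<tau> + s) (\<tau> + m) (\<gamma> (\<tau> + s)) w w' (\<tau> + r) = poly_curve s m (\<gamma> (\<tau> + s)) w w' r" for r
      by (simp add: poly_curve_def)
    ultimately show "Kin (\<tau> + s) (\<tau> + t) + integral {s..t} (\<lambda>r. V (\<gamma> (\<tau> + r))) \<le> (m - s) * (norm w)\<^sup>2 + (t - m) * (norm w')\<^sup>2
         + integral {s..t} (\<lambda>r. V (poly_curve s m (\<gamma> (\<tau> + s)) w w' r))"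
      using integral_shift_eq[of s t "\<lambda>r. V (\<gamma> r)" \<tau>]
        integral_shift_eq[of s t "\<lambda>r. V (poly_curve (\<tau> + s) (\<tau> + m) (\<gamma> (\<tau> + s)) w w' r)" \<tau>] by simp
  qed (use Tb d \<rho> in auto)
  obtain r e where r: "r > 0" "r \<le> T0" "\<forall>s\<in>{0<..<r}. etaK K (\<gamma> (\<tau> + s)) = e"
    using eventually_constant_zone by blast
  have all: "\<forall>s\<in>{\<tau><..<\<tau> + r}. s \<le> \<delta> \<and> etaK K (\<gamma> s) = e"
  proof
    fix s assume "s \<in> {\<tau><..<\<tau> + r}"
    then show "s \<le> \<delta> \<and> etaK K (\<gamma> s) = e" using r(3)[rule_format, of "s - \<tau>"] r Tb by auto
  qed
  show ?thesis by (rule exI[of _ r], rule conjI[OF r(1)], rule exI[of _ e], rule all)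
qed

text \<open>Time reversal: a broken line for the reversed curve is one for \<open>\<gamma>\<close>
  with its legs exchanged and velocities negated, so the squared speeds and, after reflection, the
  potential integrals are the same.\<close>

lemma left_constant_zone:
  assumes \<tau>: "0 < \<tau>" "\<tau> \<le> \<delta>"
  shows "\<exists>r>0. \<exists>e. \<forall>s\<in>{\<tau> - r<..<\<tau>}. 0 \<le> s \<and> etaK K (\<gamma> s) = e"
proof -
  obtain d C where d: "d > 0" "C \<ge> 0" "\<And>s. s \<in> {0..\<delta>} \<Longrightarrow> \<bar>s - \<tau>\<bar> \<le> d \<Longrightarrow> \<gamma> s \<in> ball (\<gamma> \<tau>) (\<rho>/2)"
    "\<And>e y z. \<lbrakk>e \<in> convex hull K; y \<in> ball (\<gamma> \<tau>) (\<rho>/2); z \<in> ball (\<gamma> \<tau>) (\<rho>/2)\<rbrakk> \<Longrightarrow> \<bar>H e y - H e z\<bar> \<le> C * norm (y - z)"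
    using one_sided_setup[of \<tau>] \<tau> by auto
  define T0 where "T0 = min d \<tau>"
  have Tb: "T0 > 0" "T0 \<le> d" "T0 \<le> \<tau>" using d \<tau> by (auto simp: T0_def)
  interpret one_sided K h h' "\<lambda>s. \<gamma> (\<tau> - s)" T0 "\<rho>/2" C "\<lambda>s t. Kin (\<tau> - t) (\<tau> - s)"
  proof
    show "continuous_on {0..T0} (\<lambda>s. \<gamma> (\<tau> - s))"
      using Tb \<tau> by (intro continuous_on_compose2[OF \<gamma>_cont] continuous_intros) auto
    show "Kin (\<tau> - t) (\<tau> - s) = Kin (\<tau> - r) (\<tau> - s) + Kin (\<tau> - t) (\<tau> - r)" if "0 \<le> s" "s \<le> r" "r \<le> t" "t \<le> T0" for s r t
      using Kin_add[of "\<tau> - t" "\<tau> - r" "\<tau> - s"] that Tb \<tau> by auto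
    show "(norm (\<gamma> (\<tau> - t) - \<gamma> (\<tau> - s)))\<^sup>2 \<le> (t - s) * Kin (\<tau> - t) (\<tau> - s)" if "0 \<le> s" "s < t" "t \<le> T0" for s t
      using Kin_ge[of "\<tau> - t" "\<tau> - s"] that Tb \<tau> by (auto simp: norm_minus_commute)
    show "\<gamma> (\<tau> - r) \<in> ball (\<gamma> (\<tau> - 0)) (\<rho>/2)" if "r \<in> {0..T0}" for r
      using d(3)[of "\<tau> - r"] that Tb \<tau> by auto
    fix s m t w w'
    assume st: "0 \<le> s" "s < m" "m < t" "t \<le> T0" and e: "\<gamma> (\<tau> - t) = \<gamma> (\<tau> - s) + (m - s) *\<^sub>R w + (t - m) *\<^sub>R w'"
      and b: "\<gamma> (\<tau> - s) + (m - s) *\<^sub>R w \<in> ball (\<gamma> (\<tau> - 0)) (\<rho>/2)"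
    have "Kin (\<tau> - t) (\<tau> - s) + integral {\<tau> - t..\<tau> - s} (\<lambda>r. V (\<gamma> r)) \<le> ((\<tau> - m) - (\<tau> - t)) * (norm (- w'))\<^sup>2 + ((\<tau> - s) - (\<tau> - m)) * (norm (- w))\<^sup>2
         + integral {\<tau> - t..\<tau> - s} (\<lambda>r. V (poly_curve (\<tau> - t) (\<tau> - m) (\<gamma> (\<tau> - t)) (- w') (- w) r))"
    proof (rule comparison_poly[of _ _ _ _ _ "\<gamma> \<tau>"])
      show "\<gamma> r \<in> ball (\<gamma> \<tau>) (\<rho>/2)" if "r \<in> {\<tau> - t..\<tau> - s}" for r using that st Tb \<tau> by (intro d(3)) auto
      show "\<gamma> (\<tau> - s) = \<gamma> (\<tau> - t) + (\<tau> - m - (\<tau> - t)) *\<^sub>R - w' + (\<tau> - s - (\<tau> - m)) *\<^sub>R - w"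
        unfolding e by (simp add: algebra_simps)
      have "\<gamma> (\<tau> - t) + (\<tau> - m - (\<tau> - t)) *\<^sub>R - w' = \<gamma> (\<tau> - s) + (m - s) *\<^sub>R w"
        unfolding e by (simp add: algebra_simps)
      then show "\<gamma> (\<tau> - t) + (\<tau> - m - (\<tau> - t)) *\<^sub>R - w' \<in> ball (\<gamma> \<tau>) (\<rho>/2)" using b by simp
    qed (use st Tb \<tau> in auto)
    moreover have "poly_curve (\<tau> - t) (\<tau> - m) (\<gamma> (\<tau> - t)) (- w') (- w) (\<tau> - r) = poly_curve s m (\<gamma> (\<tau> - s)) w w' r" for r
    proof (cases "r = m")
      case True
      then show ?thesis unfolding e by (simp add: poly_curve_def algebra_simps)
    next
      case False
      then show ?thesis unfolding e by (auto simp: poly_curve_def algebra_simps)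
    qed
    ultimately show "Kin (\<tau> - t) (\<tau> - s) + integral {s..t} (\<lambda>r. V (\<gamma> (\<tau> - r))) \<le> (m - s) * (norm w)\<^sup>2 + (t - m) * (norm w')\<^sup>2
         + integral {s..t} (\<lambda>r. V (poly_curve s m (\<gamma> (\<tau> - s)) w w' r))"
      using integral_reflect_eq[of s t "\<lambda>r. V (\<gamma> r)" \<tau>]
        integral_reflect_eq[of s t "\<lambda>r. V (poly_curve (\<tau> - t) (\<tau> - m) (\<gamma> (\<tau> - t)) (- w') (- w) r)" \<tau>] by simp
  qed (use Tb d \<rho> in auto)
  obtain r e where r: "r > 0" "r \<le> T0" "\<forall>s\<in>{0<..<r}. etaK K (\<gamma> (\<tau> - s)) = e"
    using eventually_constant_zone by blast
  have all: "\<forall>s\<in>{\<tau> - r<..<\<tau>}. 0 \<le> s \<and> etaK K (\<gamma> s) = e"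
  proof
    fix s assume "s \<in> {\<tau> - r<..<\<tau>}"
    then show "0 \<le> s \<and> etaK K (\<gamma> s) = e" using r(3)[rule_format, of "\<tau> - s"] r Tb by auto
  qed
  show ?thesis by (rule exI[of _ r], rule conjI[OF r(1)], rule exI[of _ e], rule all)
qed

lemma not_NDS:
  assumes "open U" "t \<in> U" "\<And>s. s \<in> U \<inter> {0..\<delta>} \<Longrightarrow> etaK K (\<gamma> s) = e"
  shows "t \<notin> NDS K \<delta> \<gamma>"
proof
  assume "t \<in> NDS K \<delta> \<gamma>"
  then have t: "t \<in> {0..\<delta>}" "\<forall>I. openin (top_of_set {0..\<delta>}) I \<and> t \<in> I \<longrightarrow> \<not> (\<exists>c. \<forall>s\<in>I. etaK K (\<gamma> s) = c)"
    unfolding NDS_def by auto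
  have "openin (top_of_set {0..\<delta>}) ({0..\<delta>} \<inter> U)" using assms(1) by (rule openin_open_Int)
  then show False using t assms(2,3) by blast
qed

text \<open>On each side of \<open>\<tau>\<close> there is an open interval with a single label,
  hence free of shocks; at 0 and at \<open>\<delta>\<close> one side contains no admissible
  time.\<close>

lemma NDS_isolated:
  assumes \<tau>: "\<tau> \<in> {0..\<delta>}"
  shows "\<exists>\<rho>>0. NDS K \<delta> \<gamma> \<inter> ball \<tau> \<rho> \<subseteq> {\<tau>}"
proof -
  have sub: "NDS K \<delta> \<gamma> \<subseteq> {0..\<delta>}" by (auto simp: NDS_def)
  have R: "\<exists>\<rho>>0. NDS K \<delta> \<gamma> \<inter> {\<tau><..<\<tau> + \<rho>} = {}"
  proof (cases "\<tau> < \<delta>")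
    case True
    then obtain r e where r: "r > 0" "\<forall>s\<in>{\<tau><..<\<tau> + r}. s \<le> \<delta> \<and> etaK K (\<gamma> s) = e"
      using right_constant_zone[of \<tau>] \<tau> by auto
    have "t \<notin> NDS K \<delta> \<gamma>" if "t \<in> {\<tau><..<\<tau> + r}" for t
      by (rule not_NDS[of "{\<tau><..<\<tau> + r}" _ e]) (use that r in auto)
    then show ?thesis using r(1) by blast
  next
    case False
    then have "NDS K \<delta> \<gamma> \<inter> {\<tau><..<\<tau> + 1} = {}" using \<tau> sub by force
    then show ?thesis using zero_less_one by blast
  qed
  have L: "\<exists>\<rho>>0. NDS K \<delta> \<gamma> \<inter> {\<tau> - \<rho><..<\<tau>} = {}"
  proof (cases "0 < \<tau>")
    case True
    then obtain r e where r: "r > 0" "\<forall>s\<in>{\<tau> - r<..<\<tau>}. 0 \<le> s \<and> etaK K (\<gamma> s) = e"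
      using left_constant_zone[of \<tau>] \<tau> by auto
    have "t \<notin> NDS K \<delta> \<gamma>" if "t \<in> {\<tau> - r<..<\<tau>}" for t
      by (rule not_NDS[of "{\<tau> - r<..<\<tau>}" _ e]) (use that r in auto)
    then show ?thesis using r(1) by blast
  next
    case False
    then have "NDS K \<delta> \<gamma> \<inter> {\<tau> - 1<..<\<tau>} = {}" using \<tau> sub by force
    then show ?thesis using zero_less_one by blast
  qed
  obtain \<rho>1 \<rho>2 where \<rho>: "\<rho>1 > 0" "\<rho>2 > 0" "NDS K \<delta> \<gamma> \<inter> {\<tau><..<\<tau> + \<rho>1} = {}" "NDS K \<delta> \<gamma> \<inter> {\<tau> - \<rho>2<..<\<tau>} = {}"
    using R L by blast
  have "NDS K \<delta> \<gamma> \<inter> ball \<tau> (min \<rho>1 \<rho>2) \<subseteq> {\<tau>}"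
  proof
    fix t assume t: "t \<in> NDS K \<delta> \<gamma> \<inter> ball \<tau> (min \<rho>1 \<rho>2)"
    then have "t \<notin> {\<tau><..<\<tau> + \<rho>1}" "t \<notin> {\<tau> - \<rho>2<..<\<tau>}" using \<rho> by blast+
    then show "t \<in> {\<tau>}" using t by (auto simp: dist_real_def)
  qed
  then show ?thesis using \<rho>(1,2) by (intro exI[of _ "min \<rho>1 \<rho>2"]) auto
qed

text \<open>An infinite set of shocks would accumulate somewhere in the compact interval
  [0, \<open>\<delta>\<close>]. Isolation was therefore established around every time, whether or
  not it is itself a shock.\<close>

lemma finite_NDS: "finite (NDS K \<delta> \<gamma>)"
proof (rule ccontr)
  assume inf: "infinite (NDS K \<delta> \<gamma>)"
  have "NDS K \<delta> \<gamma> \<subseteq> {0..\<delta>}" by (auto simp: NDS_def)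
  then obtain \<tau> where \<tau>: "\<tau> \<in> {0..\<delta>}" "\<tau> islimpt NDS K \<delta> \<gamma>"
    using compact_eq_Bolzano_Weierstrass[THEN iffD1, OF compact_Icc[of 0 \<delta>], rule_format, of "NDS K \<delta> \<gamma>"] inf
    by auto
  obtain \<rho> where \<rho>: "\<rho> > 0" "NDS K \<delta> \<gamma> \<inter> ball \<tau> \<rho> \<subseteq> {\<tau>}" using NDS_isolated[OF \<tau>(1)] by blast
  obtain t where "t \<in> NDS K \<delta> \<gamma>" "t \<in> ball \<tau> \<rho>" "t \<noteq> \<tau>"
    using \<tau>(2) \<rho>(1) unfolding islimpt_def by (meson centre_in_ball open_ball)
  then show False using \<rho>(2) by blast
qed

text \<open>Away from shocks the label is locally constant, and the interval is connected.\<close>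

lemma constant_between_NDS:
  assumes ab: "0 \<le> a" "a < b" "b \<le> \<delta>" and no: "{a<..<b} \<inter> NDS K \<delta> \<gamma> = {}"
  shows "\<exists>e. \<forall>r\<in>{a<..<b}. etaK K (\<gamma> r) = e"
proof -
  have "(\<lambda>r. etaK K (\<gamma> r)) constant_on {a<..<b}"
  proof (rule locally_constant_imp_constant)
    fix t assume t: "t \<in> {a<..<b}"
    then have "t \<notin> NDS K \<delta> \<gamma>" "t \<in> {0..\<delta>}" using no ab by auto
    then obtain I c where I: "openin (top_of_set {0..\<delta>}) I" "t \<in> I" "\<forall>s\<in>I. etaK K (\<gamma> s) = c"
      unfolding NDS_def by blast
    obtain U where U: "open U" "I = {0..\<delta>} \<inter> U" using I(1) by (auto simp: openin_open)
    have "openin (top_of_set {a<..<b}) ({a<..<b} \<inter> U)" using U(1) by (rule openin_open_Int)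
    moreover have "etaK K (\<gamma> s) = etaK K (\<gamma> t)" if "s \<in> {a<..<b} \<inter> U" for s
      using I U that ab by auto
    moreover have "t \<in> {a<..<b} \<inter> U" using t I(2) U(2) by blast
    ultimately show "\<exists>T. openin (top_of_set {a<..<b}) T \<and> t \<in> T \<and> (\<forall>x\<in>T. etaK K (\<gamma> x) = etaK K (\<gamma> t))"
      by (intro exI[of _ "{a<..<b} \<inter> U"] conjI ballI)
  qed (rule connected_Ioo)
  then show ?thesis unfolding constant_on_def .
qed

text \<open>The velocity is Lipschitz, so the almost everywhere differentiability theorem applies
  once more, now to the velocity. In the open interval \<open>g\<close> is the two-sided derivative
  of \<open>\<gamma>\<close>, which transfers the acceleration bound to the form with
  \<open>vector_derivative\<close>.\<close>

lemma zone_regularity: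
  assumes ab: "0 \<le> a" "a < b" "b \<le> \<delta>" and zone: "\<And>r. r \<in> {a<..<b} \<Longrightarrow> etaK K (\<gamma> r) = e"
  shows "AE r in lborel. r \<in> {a<..<b} \<longrightarrow>
               (\<lambda>s. vector_derivative \<gamma> (at s)) differentiable (at r) \<and>
               norm (vector_derivative (\<lambda>s. vector_derivative \<gamma> (at s)) (at r))
                 \<le> h' ((norm (\<gamma> r - e))\<^sup>2) * norm (\<gamma> r - e)"
proof -
  obtain g L where g: "\<And>t. t \<in> {a..b} \<Longrightarrow> (\<gamma> has_vector_derivative g t) (at t within {a..b})" "L-lipschitz_on {a..b} g"
    using zone_C11[OF ab zone] unfolding C11_on_def by blast
  have g': "(\<gamma> has_vector_derivative g t) (at t)" if "t \<in> {a<..<b}" for t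
  proof -
    have "at t within {a..b} = at t" using that by (intro at_within_Icc_at) auto
    then show ?thesis using g(1)[of t] that by auto
  qed
  let ?D = "\<lambda>s. vector_derivative \<gamma> (at s)"
  have D: "?D s = g s" if "s \<in> {a<..<b}" for s using g'[OF that] by (rule vector_derivative_at)
  define N where "N = {x \<in> {a<..<b}. \<not> g differentiable (at x)}"
  have "negligible N" unfolding N_def by (rule abs_cont_on_differentiable[OF abs_cont_on_lipschitz[OF g(2)]])
  then have "AE r in lebesgue. r \<notin> N" by (intro AE_not_in) (simp add: negligible_iff_null_sets)
  then have "AE r in lborel. r \<notin> N" by (simp add: AE_completion_iff)
  then show ?thesis
  proof (rule AE_mp, intro AE_I2 impI)
    fix r assume rN: "r \<notin> N" and r: "r \<in> {a<..<b}"
    define A where "A = vector_derivative g (at r)"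
    have A: "(g has_vector_derivative A) (at r)"
      unfolding A_def using rN r by (auto simp: N_def vector_derivative_works[symmetric])
    have DA: "(?D has_vector_derivative A) (at r)"
      by (rule has_vector_derivative_transform_within_open[OF A, of "{a<..<b}"]) (use r D in auto)
    have "norm A \<le> h' ((norm (\<gamma> r - e))\<^sup>2) * norm (\<gamma> r - e)"
      using zone_acceleration[OF ab zone g' r A] .
    then show "?D differentiable (at r) \<and> norm (vector_derivative ?D (at r)) \<le> h' ((norm (\<gamma> r - e))\<^sup>2) * norm (\<gamma> r - e)"
      using DA by (auto simp: vector_derivative_at intro: differentiableI_vector)
  qed
qed

end

text \<open>Consecutive times are expressed without an enumeration, as pairs \<open>a < b\<close>
  from 0, \<open>\<delta>\<close> and the shocks with no shock in between. Differentiability of the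
  velocity is asserted together with the bound because \<open>vector_derivative\<close> is a total
  function. The continuous derivative \<open>h'\<close>, one-sided at 0, encodes that
  \<open>h\<close> is continuously differentiable on the half-line.\<close>

theorem theorem3p11:
  fixes K :: "'a::euclidean_space set" and h h' :: "real \<Rightarrow> real"
    and \<delta> :: real and x0 x\<delta> :: 'a and \<gamma> :: "real \<Rightarrow> 'a"
  assumes K: "finite K" "K \<noteq> {}"
    and h_deriv: "\<And>s. s \<ge> 0 \<Longrightarrow> (h has_real_derivative h' s) (at s within {0..})"
    and h'_cont: "continuous_on {0..} h'"
    and h_nonneg: "\<And>s. s \<ge> 0 \<Longrightarrow> h s \<ge> 0"
    and h_strict: "strict_mono_on {0..} h"
    and \<delta>: "\<delta> > 0"
    and min: "local_minimizer K h \<delta> x0 x\<delta> \<gamma>"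
  shows "finite (NDS K \<delta> \<gamma>) \<and>
    (\<forall>a b. a \<in> insert 0 (insert \<delta> (NDS K \<delta> \<gamma>)) \<and> b \<in> insert 0 (insert \<delta> (NDS K \<delta> \<gamma>))
       \<and> a < b \<and> {a<..<b} \<inter> NDS K \<delta> \<gamma> = {} \<longrightarrow>
         (\<exists>e \<in> calE K. \<forall>r\<in>{a<..<b}. etaK K (\<gamma> r) = e)
       \<and> C11_on a b \<gamma>
       \<and> (\<forall>e \<in> calE K. \<gamma> ` {a<..<b} \<subseteq> potential_zone K e \<longrightarrow>
            (AE r in lborel. r \<in> {a<..<b} \<longrightarrow>
               (\<lambda>s. vector_derivative \<gamma> (at s)) differentiable (at r) \<and>
               norm (vector_derivative (\<lambda>s. vector_derivative \<gamma> (at s)) (at r))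
                 \<le> h' ((norm (\<gamma> r - e))\<^sup>2) * norm (\<gamma> r - e))))"
proof -
  obtain \<rho> where \<rho>: "\<rho> > 0" "\<And>\<sigma>. continuous_on {0..\<delta>} \<sigma> \<Longrightarrow> (SUP t\<in>{0..\<delta>}. dist (\<sigma> t) (\<gamma> t)) < \<rho>
                \<Longrightarrow> actI K h \<delta> x0 x\<delta> \<gamma> \<le> actI K h \<delta> x0 x\<delta> \<sigma>"
    using min unfolding local_minimizer_def by blast
  \<comment> \<open>\<open>local_minimizer\<close> asks for a supremum strictly below its radius;
    with half the radius a pointwise non-strict bound suffices, which is the form used for
    competitors.\<close>
  interpret minimizer K h h' \<delta> "\<rho>/2" x0 x\<delta> \<gamma>
  proof unfold_locales
    show "actI K h \<delta> x0 x\<delta> \<gamma> < \<infinity>" using min unfolding local_minimizer_def by blast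
    fix \<sigma> :: "real \<Rightarrow> 'a"
    assume \<sigma>: "continuous_on {0..\<delta>} \<sigma>" "\<And>t. t \<in> {0..\<delta>} \<Longrightarrow> dist (\<sigma> t) (\<gamma> t) \<le> \<rho>/2"
    have "(SUP t\<in>{0..\<delta>}. dist (\<sigma> t) (\<gamma> t)) \<le> \<rho>/2" using \<sigma>(2) \<delta> by (intro cSUP_least) auto
    also have "\<dots> < \<rho>" using \<rho>(1) by simp
    finally show "actI K h \<delta> x0 x\<delta> \<gamma> \<le> actI K h \<delta> x0 x\<delta> \<sigma>" by (rule \<rho>(2)[OF \<sigma>(1)])
  qed (use assms \<rho>(1) in auto)
  have rng: "0 \<le> a" "a \<le> \<delta>" if "a \<in> insert 0 (insert \<delta> (NDS K \<delta> \<gamma>))" for a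
    using that \<delta> by (auto simp: NDS_def)
  have zone: "etaK K (\<gamma> r) = e" if "\<gamma> ` {a<..<b} \<subseteq> potential_zone K e" "r \<in> {a<..<b}" for a b e r
    using that unfolding potential_zone_def by blast
  show ?thesis
  proof (intro conjI allI impI finite_NDS)
    fix a b
    assume *: "a \<in> insert 0 (insert \<delta> (NDS K \<delta> \<gamma>)) \<and> b \<in> insert 0 (insert \<delta> (NDS K \<delta> \<gamma>))
       \<and> a < b \<and> {a<..<b} \<inter> NDS K \<delta> \<gamma> = {}"
    have ab: "0 \<le> a" "a < b" "b \<le> \<delta>" using * rng by auto
    obtain e where e: "\<forall>r\<in>{a<..<b}. etaK K (\<gamma> r) = e" using constant_between_NDS[OF ab] * by blast
    have "e = etaK K (\<gamma> ((a + b) / 2))" using e ab by simp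
    then have "e \<in> calE K" by (simp add: calE_def)
    then show "\<exists>e\<in>calE K. \<forall>r\<in>{a<..<b}. etaK K (\<gamma> r) = e" using e by blast
    show "C11_on a b \<gamma>" using zone_C11[OF ab] e by blast
    show "\<forall>e\<in>calE K. \<gamma> ` {a<..<b} \<subseteq> potential_zone K e \<longrightarrow>
            (AE r in lborel. r \<in> {a<..<b} \<longrightarrow>
               (\<lambda>s. vector_derivative \<gamma> (at s)) differentiable (at r) \<and>
               norm (vector_derivative (\<lambda>s. vector_derivative \<gamma> (at s)) (at r))
                 \<le> h' ((norm (\<gamma> r - e))\<^sup>2) * norm (\<gamma> r - e))"
    proof (intro ballI impI)
      fix e' assume "\<gamma> ` {a<..<b} \<subseteq> potential_zone K e'"
      from zone_regularity[OF ab zone[OF this]]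
      show "AE r in lborel. r \<in> {a<..<b} \<longrightarrow>
               (\<lambda>s. vector_derivative \<gamma> (at s)) differentiable (at r) \<and>
               norm (vector_derivative (\<lambda>s. vector_derivative \<gamma> (at s)) (at r))
                 \<le> h' ((norm (\<gamma> r - e'))\<^sup>2) * norm (\<gamma> r - e')" .
    qed
  qed
qed

end
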